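(* Let $\mathbb{G}\leqslant\mathrm{Aut}(X,\lambda)$ be an ergodic full group on a standard $\sigma$-finite space $(X,\lambda)$. The group $\mathbb{G}_f=\{T\in\mathbb{G} : \lambda(\mathrm{supp}\,T)<\infty\}$ can be endowed with a Polish group topology if and only if $\mathbb{G}$ is the full group of a countable equivalence relation on $(X,\lambda)$.
   Context: A standard $\sigma$-finite space $(X,\lambda)$ is a standard Borel space $X$ with an atomless $\sigma$-finite Borel measure $\lambda$ such that $\lambda(X)=+\infty$. $\mathrm{Aut}(X,\lambda)$ is the group of Borel bijections $T$ of $X$ with $\lambda(T(A))=\lambda(T^{-1}(A))=\lambda(A)$ for every Borel $A$, where two bijections are identified when they coincide on a conull set. The support is $\mathrm{supp}\,T=\{x\in X: T(x)\neq x\}$. A full group is a subgroup $\mathbb{G}\leqslant\mathrm{Aut}(X,\lambda)$ stable under cutting and pasting: if $T\in\mathrm{Aut}(X,\lambda)$ and there are a countable partition $(A_n)$ of $X$ and elements $T_n\in\mathbb{G}$ with $T_{\restriction A_n}=T_{n\restriction A_n}$ for all $n$, then $T\in\mathbb{G}$. It is ergodic if every Borel $A\subseteq X$ with $\lambda(T(A)\Delta A)=0$ for all $T\in\mathbb{G}$ is null or conull. The full group of an equivalence relation $\mathcal{R}$ on $X$ is $[\mathcal{R}]=\{T\in\mathrm{Aut}(X,\lambda): (T(x),x)\in\mathcal{R}\text{ for almost all }x\in X\}$. A countable equivalence relation is a Borel equivalence relation $\mathcal{R}\subseteq X\times X$ all of whose classes are countable. *)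

theory Defs
  imports "HOL-Analysis.Analysis" "HOL-Algebra.Bij" "HOL-Algebra.Coset"
begin

section \<open>Standard sigma-finite spaces\<close>

definition polish_topology :: "'a topology \<Rightarrow> bool" where
  "polish_topology T \<longleftrightarrow> completely_metrizable_space T \<and> separable_space T"

definition standard_borel :: "'a measure \<Rightarrow> bool" where
  "standard_borel M \<longleftrightarrow>
     (\<exists>T. polish_topology T \<and> topspace T = space M \<and>
          sets M = sigma_sets (space M) {U. openin T U})"

definition atomless :: "'a measure \<Rightarrow> bool" where
  "atomless M \<longleftrightarrow>
     (\<forall>A\<in>sets M. emeasure M A > 0 \<longrightarrow>
        (\<exists>B\<in>sets M. B \<subseteq> A \<and> 0 < emeasure M B \<and> emeasure M B < emeasure M A))"

definition standard_sigma_finite_space :: "'a measure \<Rightarrow> bool" where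
  "standard_sigma_finite_space M \<longleftrightarrow>
     standard_borel M \<and> sigma_finite_measure M \<and> atomless M \<and> emeasure M (space M) = \<infinity>"


section \<open>The automorphism group\<close>

text \<open>Elements of \<^term>\<open>Bij (space M)\<close> are \<^const>\<open>undefined\<close> outside \<^term>\<open>space M\<close>, so a
  bijection of the space is a single function. A Borel bijection is required to have a Borel
  inverse; on a standard Borel space this is automatic.\<close>

definition measure_preserving_bijections :: "'a measure \<Rightarrow> ('a \<Rightarrow> 'a) set" where
  "measure_preserving_bijections M =
     {T \<in> Bij (space M).
        T \<in> measurable M M \<and> inv_into (space M) T \<in> measurable M M \<and>
        (\<forall>A\<in>sets M. emeasure M (T ` A) = emeasure M A \<and>
                    emeasure M (T -` A \<inter> space M) = emeasure M A)}"

definition aut_class :: "'a measure \<Rightarrow> ('a \<Rightarrow> 'a) \<Rightarrow> ('a \<Rightarrow> 'a) set" where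
  "aut_class M T = {S \<in> measure_preserving_bijections M. AE x in M. S x = T x}"

text \<open>Classes are multiplied elementwise; \<open>aut_class_mult\<close> below shows that this is the
  composition of representatives.\<close>

definition Aut :: "'a measure \<Rightarrow> ('a \<Rightarrow> 'a) set monoid" where
  "Aut M =
     \<lparr>carrier = aut_class M ` measure_preserving_bijections M,
      mult = \<lambda>s t. s <#>\<^bsub>BijGroup (space M)\<^esub> t,
      one = aut_class M (\<lambda>x\<in>space M. x)\<rparr>"

lemma mpb_Bij: "T \<in> measure_preserving_bijections M \<Longrightarrow> T \<in> Bij (space M)"
  by (simp add: measure_preserving_bijections_def)

lemma mpb_in_space:
  "T \<in> measure_preserving_bijections M \<Longrightarrow> x \<in> space M \<Longrightarrow> T x \<in> space M"
  using Bij_imp_funcset mpb_Bij by fastforce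

lemma mpb_inv_image:
  assumes "T \<in> Bij (space M)" "A \<subseteq> space M"
  shows "(\<lambda>x\<in>space M. inv_into (space M) T x) ` A = T -` A \<inter> space M"
    and "(\<lambda>x\<in>space M. inv_into (space M) T x) -` A \<inter> space M = T ` A"
proof -
  have T: "bij_betw T (space M) (space M)"
    using assms(1) by (simp add: Bij_def)
  have l: "\<And>x. x \<in> space M \<Longrightarrow> inv_into (space M) T (T x) = x"
    and r: "\<And>x. x \<in> space M \<Longrightarrow> T (inv_into (space M) T x) = x"
    and s: "\<And>x. x \<in> space M \<Longrightarrow> inv_into (space M) T x \<in> space M"
    and m: "\<And>x. x \<in> space M \<Longrightarrow> T x \<in> space M"
    using T by (auto simp: bij_betw_inv_into_left bij_betw_inv_into_right bij_betw_apply
        bij_betw_apply[OF bij_betw_inv_into])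
  show "(\<lambda>x\<in>space M. inv_into (space M) T x) ` A = T -` A \<inter> space M"
  proof (intro equalityI subsetI)
    fix y assume "y \<in> (\<lambda>x\<in>space M. inv_into (space M) T x) ` A"
    then show "y \<in> T -` A \<inter> space M" using assms(2) r s by auto
  next
    fix y assume "y \<in> T -` A \<inter> space M"
    then show "y \<in> (\<lambda>x\<in>space M. inv_into (space M) T x) ` A"
      using l m by (auto intro!: image_eqI[where x = "T y"])
  qed
  show "(\<lambda>x\<in>space M. inv_into (space M) T x) -` A \<inter> space M = T ` A"
  proof (intro equalityI subsetI)
    fix y assume "y \<in> (\<lambda>x\<in>space M. inv_into (space M) T x) -` A \<inter> space M"
    then show "y \<in> T ` A"
      using r by (auto intro!: image_eqI[where x = "inv_into (space M) T y"])
  next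
    fix y assume "y \<in> T ` A"
    then show "y \<in> (\<lambda>x\<in>space M. inv_into (space M) T x) -` A \<inter> space M"
      using assms(2) l m by auto
  qed
qed

lemma mpb_image_sets:
  assumes "T \<in> measure_preserving_bijections M" "A \<in> sets M"
  shows "T ` A \<in> sets M"
proof -
  have "inv_into (space M) T \<in> measurable M M"
    using assms(1) by (simp add: measure_preserving_bijections_def)
  then have "inv_into (space M) T -` A \<inter> space M \<in> sets M"
    using assms(2) by (rule measurable_sets)
  moreover have "inv_into (space M) T -` A \<inter> space M
      = (\<lambda>x\<in>space M. inv_into (space M) T x) -` A \<inter> space M"
    by auto
  ultimately show ?thesis
    using mpb_inv_image(2)[OF mpb_Bij[OF assms(1)] sets.sets_into_space[OF assms(2)]] by simp
qed

lemma mpb_compose: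
  assumes S: "S \<in> measure_preserving_bijections M" and T: "T \<in> measure_preserving_bijections M"
  shows "compose (space M) S T \<in> measure_preserving_bijections M"
proof -
  have bS: "bij_betw S (space M) (space M)" and bT: "bij_betw T (space M) (space M)"
    using S T by (simp_all add: measure_preserving_bijections_def Bij_def)
  have sT: "\<And>x. x \<in> space M \<Longrightarrow> T x \<in> space M"
    using T by (rule mpb_in_space)
  have mT: "T \<in> measurable M M" and mS: "S \<in> measurable M M"
    and iT: "inv_into (space M) T \<in> measurable M M"
    and iS: "inv_into (space M) S \<in> measurable M M"
    using S T by (simp_all add: measure_preserving_bijections_def)
  have bC: "compose (space M) S T \<in> Bij (space M)"
    using S T by (intro compose_Bij mpb_Bij)
  have m: "compose (space M) S T \<in> measurable M M"
    using measurable_compose[OF mT mS] by (subst measurable_cong) (auto simp: compose_def)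
  have inv_eq: "inv_into (space M) (compose (space M) S T) y
      = inv_into (space M) T (inv_into (space M) S y)" if y: "y \<in> space M" for y
  proof (rule inv_into_f_eq)
    show "inj_on (compose (space M) S T) (space M)"
      using bC by (simp add: Bij_def bij_betw_def)
    have "inv_into (space M) S y \<in> space M"
      using y bS by (metis bij_betw_def inv_into_into)
    then show "inv_into (space M) T (inv_into (space M) S y) \<in> space M"
      using bT by (metis bij_betw_def inv_into_into)
    then show "compose (space M) S T (inv_into (space M) T (inv_into (space M) S y)) = y"
      using \<open>inv_into (space M) S y \<in> space M\<close> y bS bT
      by (simp add: compose_def bij_betw_inv_into_right)
  qed
  have i: "inv_into (space M) (compose (space M) S T) \<in> measurable M M"
    using measurable_compose[OF iS iT] by (subst measurable_cong[OF inv_eq]) auto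
  have "emeasure M (compose (space M) S T ` A) = emeasure M A \<and>
        emeasure M (compose (space M) S T -` A \<inter> space M) = emeasure M A"
    if A: "A \<in> sets M" for A
  proof -
    have 1: "compose (space M) S T ` A = S ` (T ` A)"
      using sets.sets_into_space[OF A] by (force simp: compose_def)
    have 2: "compose (space M) S T -` A \<inter> space M = T -` (S -` A \<inter> space M) \<inter> space M"
      using sT by (auto simp: compose_def)
    have "T ` A \<in> sets M" "S -` A \<inter> space M \<in> sets M"
      using mpb_image_sets[OF T A] measurable_sets[OF mS A] by auto
    then show ?thesis
      using A S T unfolding 1 2
      by (simp add: measure_preserving_bijections_def del: vimage_Int)
  qed
  with bC m i show ?thesis
    by (simp add: measure_preserving_bijections_def)
qed

lemma mpb_id: "(\<lambda>x\<in>space M. x) \<in> measure_preserving_bijections M"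
proof -
  have "(\<lambda>x\<in>space M. x) \<in> measurable M M"
    by (subst measurable_cong[of _ _ "\<lambda>x. x"]) auto
  moreover have "inv_into (space M) (\<lambda>x\<in>space M. x) x = x" if "x \<in> space M" for x
    using that by (intro inv_into_f_eq) (auto simp: inj_on_def)
  then have "inv_into (space M) (\<lambda>x\<in>space M. x) \<in> measurable M M"
    by (subst measurable_cong[of _ _ "\<lambda>x. x"]) auto
  moreover have "(\<lambda>x\<in>space M. x) ` A = A" "(\<lambda>x\<in>space M. x) -` A \<inter> space M = A"
    if "A \<in> sets M" for A
    using sets.sets_into_space[OF that] by (auto simp: image_iff)
  ultimately show ?thesis
    by (simp add: measure_preserving_bijections_def id_Bij)
qed

lemma mpb_inv:
  assumes T: "T \<in> measure_preserving_bijections M"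
  shows "(\<lambda>x\<in>space M. inv_into (space M) T x) \<in> measure_preserving_bijections M"
proof -
  let ?I = "\<lambda>x\<in>space M. inv_into (space M) T x"
  have bT: "bij_betw T (space M) (space M)"
    using T by (simp add: measure_preserving_bijections_def Bij_def)
  have bI: "?I \<in> Bij (space M)"
    using T by (intro restrict_inv_into_Bij mpb_Bij)
  have "inv_into (space M) T \<in> measurable M M" "T \<in> measurable M M"
    using T by (simp_all add: measure_preserving_bijections_def)
  then have mI: "?I \<in> measurable M M"
    by (subst measurable_cong[of _ _ "inv_into (space M) T"]) auto
  have "inv_into (space M) ?I x = T x" if "x \<in> space M" for x
    using that bI bT mpb_in_space[OF T that]
    by (intro inv_into_f_eq) (auto simp: Bij_def bij_betw_def bij_betw_inv_into_left)
  then have "inv_into (space M) ?I \<in> measurable M M"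
    using \<open>T \<in> measurable M M\<close> by (subst measurable_cong[of _ _ T]) auto
  moreover have "emeasure M (?I ` A) = emeasure M A \<and>
      emeasure M (?I -` A \<inter> space M) = emeasure M A" if A: "A \<in> sets M" for A
    unfolding mpb_inv_image[OF mpb_Bij[OF T] sets.sets_into_space[OF A]]
    using T A by (simp add: measure_preserving_bijections_def)
  ultimately show ?thesis
    using bI mI by (simp add: measure_preserving_bijections_def)
qed

lemma mpb_AE:
  assumes T: "T \<in> measure_preserving_bijections M" and P: "AE x in M. P x"
  shows "AE x in M. P (T x)"
proof -
  obtain N where N: "N \<in> null_sets M" "{x \<in> space M. \<not> P x} \<subseteq> N"
    using P by (auto simp: eventually_ae_filter)
  have "T -` N \<inter> space M \<in> null_sets M"
    using T N(1) measurable_sets[of T M M N]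
    by (auto simp: null_sets_def measure_preserving_bijections_def)
  moreover have "{x \<in> space M. \<not> P (T x)} \<subseteq> T -` N \<inter> space M"
    using N(2) mpb_in_space[OF T] by auto
  ultimately show ?thesis
    unfolding eventually_ae_filter by blast
qed

lemma aut_class_eq_iff:
  assumes "S \<in> measure_preserving_bijections M" "T \<in> measure_preserving_bijections M"
  shows "aut_class M S = aut_class M T \<longleftrightarrow> (AE x in M. S x = T x)"
proof
  assume "aut_class M S = aut_class M T"
  moreover have "S \<in> aut_class M S"
    using assms by (simp add: aut_class_def)
  ultimately show "AE x in M. S x = T x"
    by (simp add: aut_class_def)
next
  assume eq: "AE x in M. S x = T x"
  have "(AE x in M. U x = S x) \<longleftrightarrow> (AE x in M. U x = T x)" for U
    by (intro eventually_cong[OF eq]) simp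
  then show "aut_class M S = aut_class M T"
    by (auto simp: aut_class_def)
qed

lemma mpb_mult_BijGroup:
  "S \<in> measure_preserving_bijections M \<Longrightarrow> T \<in> measure_preserving_bijections M \<Longrightarrow>
   S \<otimes>\<^bsub>BijGroup (space M)\<^esub> T = compose (space M) S T"
  by (simp add: BijGroup_def mpb_Bij)

lemma aut_class_mult:
  assumes S: "S \<in> measure_preserving_bijections M" and T: "T \<in> measure_preserving_bijections M"
  shows "aut_class M S \<otimes>\<^bsub>Aut M\<^esub> aut_class M T = aut_class M (compose (space M) S T)"
proof -
  have "aut_class M S <#>\<^bsub>BijGroup (space M)\<^esub> aut_class M T = aut_class M (compose (space M) S T)"
  proof (intro equalityI subsetI)
    fix U assume "U \<in> aut_class M S <#>\<^bsub>BijGroup (space M)\<^esub> aut_class M T"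
    then obtain S' T' where
      S': "S' \<in> measure_preserving_bijections M" "AE x in M. S' x = S x" and
      T': "T' \<in> measure_preserving_bijections M" "AE x in M. T' x = T x" and
      U: "U = compose (space M) S' T'"
      by (auto simp: set_mult_def aut_class_def mpb_mult_BijGroup)
    from mpb_AE[OF T S'(2)] T'(2)
    have "AE x in M. U x = compose (space M) S T x"
      unfolding U by eventually_elim (simp add: compose_def)
    then show "U \<in> aut_class M (compose (space M) S T)"
      using mpb_compose[OF S'(1) T'(1)] by (simp add: aut_class_def U)
  next
    fix U assume "U \<in> aut_class M (compose (space M) S T)"
    then have U: "U \<in> measure_preserving_bijections M"
      "AE x in M. U x = compose (space M) S T x"
      by (auto simp: aut_class_def)
    let ?I = "\<lambda>x\<in>space M. inv_into (space M) T x"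
    have I: "?I \<in> measure_preserving_bijections M"
      using T by (rule mpb_inv)
    have bT: "bij_betw T (space M) (space M)" and eT: "T \<in> extensional (space M)"
      using T by (simp_all add: measure_preserving_bijections_def Bij_def)
    have "AE x in M. compose (space M) U ?I x = S x"
      using mpb_AE[OF I U(2)] AE_space
    proof eventually_elim
      case (elim x)
      then show ?case
        using mpb_in_space[OF I, of x] bT by (simp add: compose_def bij_betw_inv_into_right)
    qed
    then have "compose (space M) U ?I \<in> aut_class M S"
      using mpb_compose[OF U(1) I] by (simp add: aut_class_def)
    moreover have "T \<in> aut_class M T"
      using T by (simp add: aut_class_def)
    moreover have "U = compose (space M) (compose (space M) U ?I) T"
    proof (rule extensionalityI[of _ "space M"])
      show "U \<in> extensional (space M)"
        using U(1) by (simp add: measure_preserving_bijections_def Bij_def)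
      show "compose (space M) (compose (space M) U ?I) T \<in> extensional (space M)"
        by (simp add: compose_def)
      fix x assume "x \<in> space M"
      then show "U x = compose (space M) (compose (space M) U ?I) T x"
        using mpb_in_space[OF T] bT by (simp add: compose_def bij_betw_inv_into_left)
    qed
    ultimately show "U \<in> aut_class M S <#>\<^bsub>BijGroup (space M)\<^esub> aut_class M T"
      using mpb_mult_BijGroup[OF mpb_compose[OF U(1) I] T] unfolding set_mult_def
      by (metis (no_types, lifting) UN_iff singletonI)
  qed
  then show ?thesis by (simp add: Aut_def)
qed

theorem group_Aut: "group (Aut M)"
proof (rule groupI)
  have car: "carrier (Aut M) = aut_class M ` measure_preserving_bijections M"
    and one: "\<one>\<^bsub>Aut M\<^esub> = aut_class M (\<lambda>x\<in>space M. x)"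
    by (simp_all add: Aut_def)
  show "\<one>\<^bsub>Aut M\<^esub> \<in> carrier (Aut M)"
    unfolding car one using mpb_id by blast
  show "x \<otimes>\<^bsub>Aut M\<^esub> y \<in> carrier (Aut M)" if "x \<in> carrier (Aut M)" "y \<in> carrier (Aut M)" for x y
    using that unfolding car by (auto simp: aut_class_mult intro!: imageI mpb_compose)
  show "x \<otimes>\<^bsub>Aut M\<^esub> y \<otimes>\<^bsub>Aut M\<^esub> z = x \<otimes>\<^bsub>Aut M\<^esub> (y \<otimes>\<^bsub>Aut M\<^esub> z)"
    if xyz: "x \<in> carrier (Aut M)" "y \<in> carrier (Aut M)" "z \<in> carrier (Aut M)" for x y z
  proof -
    from xyz obtain R S T where
      "R \<in> measure_preserving_bijections M" "S \<in> measure_preserving_bijections M"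
      "T \<in> measure_preserving_bijections M"
      "x = aut_class M R" "y = aut_class M S" "z = aut_class M T"
      unfolding car by blast
    then show ?thesis
      using compose_assoc[OF Bij_imp_funcset[OF mpb_Bij], of T M R S]
      by (simp add: aut_class_mult mpb_compose)
  qed
  show "\<one>\<^bsub>Aut M\<^esub> \<otimes>\<^bsub>Aut M\<^esub> x = x" if x: "x \<in> carrier (Aut M)" for x
  proof -
    from x obtain T where T: "T \<in> measure_preserving_bijections M" "x = aut_class M T"
      unfolding car by blast
    then have "compose (space M) (\<lambda>x\<in>space M. x) T = T"
      using Bij_imp_funcset[OF mpb_Bij[OF T(1)]] Bij_imp_extensional[OF mpb_Bij[OF T(1)]]
      by simp
    then show ?thesis
      using T by (simp add: one aut_class_mult mpb_id)
  qed
  show "\<exists>y\<in>carrier (Aut M). y \<otimes>\<^bsub>Aut M\<^esub> x = \<one>\<^bsub>Aut M\<^esub>" if x: "x \<in> carrier (Aut M)" for x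
  proof -
    from x obtain T where T: "T \<in> measure_preserving_bijections M" "x = aut_class M T"
      unfolding car by blast
    then show ?thesis
      unfolding car one using mpb_inv[OF T(1)] Bij_compose_restrict_eq[OF mpb_Bij[OF T(1)]]
      by (intro bexI[of _ "aut_class M (\<lambda>x\<in>space M. inv_into (space M) T x)"])
        (simp_all add: aut_class_mult)
  qed
qed


section \<open>Full groups\<close>

text \<open>The blocks \<open>A n\<close> may be empty, so finite partitions are included. Elements of \<^term>\<open>Aut M\<close>
  being classes, agreement on a block is agreement almost everywhere on it.\<close>

definition full_group :: "'a measure \<Rightarrow> ('a \<Rightarrow> 'a) set set \<Rightarrow> bool" where
  "full_group M G \<longleftrightarrow>
     subgroup G (Aut M) \<and>
     (\<forall>T\<in>measure_preserving_bijections M. \<forall>(A :: nat \<Rightarrow> 'a set) (S :: nat \<Rightarrow> 'a \<Rightarrow> 'a).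
        range A \<subseteq> sets M \<and> disjoint_family A \<and> (\<Union>n. A n) = space M \<and>
        (\<forall>n. S n \<in> measure_preserving_bijections M \<and> aut_class M (S n) \<in> G) \<and>
        (\<forall>n. AE x in M. x \<in> A n \<longrightarrow> T x = S n x)
        \<longrightarrow> aut_class M T \<in> G)"

definition ergodic :: "'a measure \<Rightarrow> ('a \<Rightarrow> 'a) set set \<Rightarrow> bool" where
  "ergodic M G \<longleftrightarrow>
     (\<forall>A\<in>sets M.
        (\<forall>T\<in>measure_preserving_bijections M. aut_class M T \<in> G \<longrightarrow>
           emeasure M (sym_diff (T ` A) A) = 0)
        \<longrightarrow> A \<in> null_sets M \<or> space M - A \<in> null_sets M)"

definition support :: "'a measure \<Rightarrow> ('a \<Rightarrow> 'a) \<Rightarrow> 'a set" where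
  "support M T = {x \<in> space M. T x \<noteq> x}"

definition finite_support_part :: "'a measure \<Rightarrow> ('a \<Rightarrow> 'a) set set \<Rightarrow> ('a \<Rightarrow> 'a) set set" where
  "finite_support_part M G =
     {aut_class M T | T. T \<in> measure_preserving_bijections M \<and> aut_class M T \<in> G \<and>
        emeasure M (support M T) < \<infinity>}"

definition countable_equivalence_relation :: "'a measure \<Rightarrow> ('a \<times> 'a) set \<Rightarrow> bool" where
  "countable_equivalence_relation M R \<longleftrightarrow>
     equiv (space M) R \<and> R \<in> sets (M \<Otimes>\<^sub>M M) \<and> (\<forall>x\<in>space M. countable (R `` {x}))"

definition full_group_of_relation :: "'a measure \<Rightarrow> ('a \<times> 'a) set \<Rightarrow> ('a \<Rightarrow> 'a) set set" where
  "full_group_of_relation M R =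
     {aut_class M T | T. T \<in> measure_preserving_bijections M \<and> (AE x in M. (T x, x) \<in> R)}"


section \<open>Polish group topologies\<close>

definition polish_group_topology :: "('g, 'b) monoid_scheme \<Rightarrow> 'g topology \<Rightarrow> bool" where
  "polish_group_topology G \<tau> \<longleftrightarrow>
     group G \<and> topspace \<tau> = carrier G \<and> polish_topology \<tau> \<and>
     continuous_map (prod_topology \<tau> \<tau>) \<tau> (\<lambda>(x, y). x \<otimes>\<^bsub>G\<^esub> y) \<and>
     continuous_map \<tau> \<tau> (m_inv G)"

end

theory Submission
  imports Defs
begin

text \<open>The group \<open>G\<^sub>f\<close> carries the bi-invariant metric \<open>d(S, T) = \<lambda>{S \<noteq> T}\<close>, which is complete
  for every full group. If \<open>G\<close> is the full group of a countable Borel relation \<open>R\<close>, then \<open>R\<close> is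
  covered almost everywhere by countably many measurable functions, hence \<open>d\<close> is separable.

  Conversely, let \<open>\<tau>\<close> be a Polish group topology on \<open>G\<^sub>f\<close>. The subgroup of elements supported in
  a Borel set \<open>B\<close> is a centralizer, hence \<open>\<tau>\<close>-closed. By ergodicity every element of \<open>G\<^sub>f\<close> is
  conjugate to one supported in a member of a fixed countable exhaustion by sets of finite
  measure, so \<open>G\<^sub>f\<close> is a countable union of continuous images of Polish spaces. One of them,
  consisting of elements with supports of measure at most \<open>c\<close>, is nonmeager, and a Pettis-type
  argument shows that countably many \<open>d\<close>-balls of radius \<open>2c\<close> cover \<open>G\<^sub>f\<close>. Since the total measure
  is infinite, copying an element on \<open>K\<close> disjoint pieces multiplies distances by \<open>K\<close>, so over a set
  of finite measure the net can be refined to any scale. The orbit relation of the group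
  generated by countably many such nets has full group \<open>G\<close>.\<close>

section \<open>Polish spaces and nonmeager images\<close>

text \<open>Nothing relates \<open>\<tau>\<close> to \<open>d\<close> in advance, so all information
  about \<open>\<tau>\<close> has to come from the group law; this is why supports are described by
  commutation. The images g h g^-1 of the Polish pieces are in general only analytic in
  \<open>\<tau>\<close>. Pettis' argument usually relies on their Baire property; here it suffices
  that two continuous images of Polish spaces, both nonmeager in every part of one open set, have a
  common point. The constant c is the measure of the chosen member of the exhaustion, since
  conjugation does not change the distance to the identity, and 2c arises from writing an element as
  s t^-1 with s and t within c of the identity. A net of one fixed radius alone carries no
  information on elements of small support; infinite total measure is what turns the coarse net into
  fine ones. Nets of all scales force an element supported in a set of finite measure to agree at
  almost every point with one of countably many elements, because the set where it differs from all
  of them has arbitrarily small measure. In the other direction a cover of the relation almost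
  everywhere is enough, as \<open>d\<close> ignores null sets.\<close>

lemma polish_topologyE:
  assumes "polish_topology X"
  obtains S d where "Metric_space S d" "Metric_space.mcomplete S d" "X = Metric_space.mtopology S d"
    "second_countable X"
proof -
  obtain S d where Sd: "Metric_space S d" "Metric_space.mcomplete S d"
    "X = Metric_space.mtopology S d"
    using assms unfolding polish_topology_def completely_metrizable_space_def by blast
  interpret Metric_space S d by (rule Sd)
  obtain C where C: "countable C" "C \<subseteq> S" "mtopology closure_of C = S"
    using assms unfolding polish_topology_def separable_space_def Sd(3) by auto
  let ?B = "(\<lambda>(c, n::nat). mball c (inverse (Suc n))) ` (C \<times> UNIV)"
  have "\<exists>V\<in>?B. x \<in> V \<and> V \<subseteq> U" if U: "openin mtopology U" "x \<in> U" for U x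
  proof -
    obtain r where r: "r > 0" "mball x r \<subseteq> U" and x: "x \<in> S"
      using U unfolding openin_mtopology by blast
    obtain n :: nat where n: "inverse (Suc n) < r / 2"
      using r(1) reals_Archimedean[of "r / 2"] by auto
    have "\<forall>r>0. \<exists>c\<in>C. c \<in> mball x r" using x C(3) metric_closure_of[of C] by blast
    then obtain c where c: "c \<in> C" "c \<in> mball x (inverse (Suc n))"
      by (metis inverse_positive_iff_positive of_nat_0_less_iff zero_less_Suc)
    have "mball c (inverse (Suc n)) \<subseteq> mball x r"
    proof
      fix y assume y: "y \<in> mball c (inverse (Suc n))"
      then have "d x y \<le> d x c + d c y" using triangle c x by auto
      then show "y \<in> mball x r" using y c n x by auto
    qed
    moreover have "x \<in> mball c (inverse (Suc n))" using c x commute by auto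
    ultimately show ?thesis using r c by blast
  qed
  moreover have "countable ?B" using C(1) by auto
  moreover have "\<forall>V\<in>?B. openin mtopology V" by auto
  ultimately have "second_countable mtopology"
    unfolding second_countable_def by (intro exI[of _ ?B]) simp
  with Sd that show ?thesis by blast
qed

lemma polish_second_countable: "polish_topology X \<Longrightarrow> second_countable X"
  by (metis polish_topologyE)

lemma polish_Hausdorff: "polish_topology X \<Longrightarrow> Hausdorff_space X"
  by (simp add: polish_topology_def completely_metrizable_imp_metrizable_space
      metrizable_imp_Hausdorff_space)

lemma polish_subtopology:
  assumes "polish_topology X" "completely_metrizable_space (subtopology X S)"
  shows "polish_topology (subtopology X S)"
  using assms polish_second_countable second_countable_subtopology
    second_countable_imp_separable_space unfolding polish_topology_def by blast

lemma polish_closedin: "polish_topology X \<Longrightarrow> closedin X S \<Longrightarrow> polish_topology (subtopology X S)"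
  using completely_metrizable_space_closedin polish_subtopology polish_topology_def by blast

lemma polish_openin: "polish_topology X \<Longrightarrow> openin X S \<Longrightarrow> polish_topology (subtopology X S)"
  using completely_metrizable_space_openin polish_subtopology polish_topology_def by blast

lemma polish_prod_topology:
  assumes "polish_topology X" "polish_topology Y"
  shows "polish_topology (prod_topology X Y)"
proof -
  obtain C D where "countable C" "C \<subseteq> topspace X" "X closure_of C = topspace X"
    "countable D" "D \<subseteq> topspace Y" "Y closure_of D = topspace Y"
    using assms unfolding polish_topology_def separable_space_def by metis
  then have "separable_space (prod_topology X Y)"
    unfolding separable_space_def by (intro exI[of _ "C \<times> D"]) (auto simp: closure_of_Times)
  with assms show ?thesis
    by (simp add: polish_topology_def completely_metrizable_space_prod_topology)
qed

section \<open>Baire category: sets that are nonmeager in every part of an open set\<close>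

definition meager_in :: "'a topology \<Rightarrow> 'a set \<Rightarrow> bool" where
  "meager_in X A \<longleftrightarrow>
     (\<exists>\<C>. countable \<C> \<and> (\<forall>C\<in>\<C>. closedin X C \<and> X interior_of C = {}) \<and> A \<subseteq> \<Union>\<C>)"

lemma meager_in_mono: "meager_in X A \<Longrightarrow> B \<subseteq> A \<Longrightarrow> meager_in X B"
  unfolding meager_in_def by (meson order_trans)

lemma meager_in_empty: "meager_in X {}"
  unfolding meager_in_def by (rule exI[of _ "{}"]) auto

lemma meager_in_Union:
  assumes "countable \<A>" "\<And>A. A \<in> \<A> \<Longrightarrow> meager_in X A"
  shows "meager_in X (\<Union>\<A>)"
proof -
  obtain \<C> where \<C>: "\<And>A. A \<in> \<A> \<Longrightarrow> countable (\<C> A) \<and>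
      (\<forall>C\<in>\<C> A. closedin X C \<and> X interior_of C = {}) \<and> A \<subseteq> \<Union>(\<C> A)"
    using assms(2) unfolding meager_in_def by metis
  then show ?thesis
    unfolding meager_in_def
  proof (intro exI conjI)
    show "countable (\<Union>(\<C> ` \<A>))" using assms(1) \<C> by auto
    show "\<forall>C\<in>\<Union>(\<C> ` \<A>). closedin X C \<and> X interior_of C = {}" using \<C> by blast
    show "\<Union>\<A> \<subseteq> \<Union>(\<Union>(\<C> ` \<A>))"
    proof
      fix x assume "x \<in> \<Union>\<A>"
      then obtain A where A: "A \<in> \<A>" "x \<in> A" by (elim UnionE)
      then obtain C where "C \<in> \<C> A" "x \<in> C" using \<C>[OF A(1)] by (meson UnionE subsetD)
      with A show "x \<in> \<Union>(\<Union>(\<C> ` \<A>))" by (metis UN_I UnionI)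
    qed
  qed
qed

lemma meager_in_closedin: "closedin X C \<Longrightarrow> X interior_of C = {} \<Longrightarrow> meager_in X C"
  unfolding meager_in_def by (rule exI[of _ "{C}"]) auto

lemma meager_in_Un: "meager_in X A \<Longrightarrow> meager_in X B \<Longrightarrow> meager_in X (A \<union> B)"
  using meager_in_Union[of "{A, B}" X] by auto

lemma not_meager_in_openin:
  assumes "completely_metrizable_space X" "openin X U" "U \<noteq> {}"
  shows "\<not> meager_in X U"
proof
  assume "meager_in X U"
  then obtain \<C> where \<C>: "countable \<C>" "\<forall>C\<in>\<C>. closedin X C \<and> X interior_of C = {}" "U \<subseteq> \<Union>\<C>"
    unfolding meager_in_def by blast
  have "X interior_of \<Union>\<C> = {}"
    using assms(1) \<C> by (intro Baire_category_alt) auto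
  with assms \<C>(3) show False
    by (metis interior_of_maximal subset_empty)
qed

lemma meager_in_homeomorphic_image:
  assumes h: "homeomorphic_map X Y h" and "meager_in X A" 
  shows "meager_in Y (h ` A)"
proof -
  obtain \<C> where \<C>: "countable \<C>" "\<forall>C\<in>\<C>. closedin X C \<and> X interior_of C = {}" "A \<subseteq> \<Union>\<C>"
    using assms unfolding meager_in_def by blast
  have "closedin Y (h ` C) \<and> Y interior_of (h ` C) = {}" if "C \<in> \<C>" for C
  proof -
    have C: "closedin X C" "X interior_of C = {}" using that \<C> by auto
    have "C \<subseteq> topspace X" using C closedin_subset by blast
    then show ?thesis
      using C homeomorphic_map_closedness[OF h] homeomorphic_map_interior_of[OF h] by auto
  qed
  then show ?thesis
    unfolding meager_in_def
  proof (intro exI conjI)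
    show "countable ((`) h ` \<C>)" using \<C>(1) by simp
    show "h ` A \<subseteq> \<Union>((`) h ` \<C>)" using \<C>(3) by blast
  qed blast
qed

text \<open>A substitute for being comeager in \<open>U\<close>: for sets with the Baire property
  the two notions agree, but this one makes sense for arbitrary images. It is inherited by smaller
  \<open>U\<close>.\<close>

definition nonmeager_on :: "'a topology \<Rightarrow> 'a set \<Rightarrow> 'a set \<Rightarrow> bool" where
  "nonmeager_on X A U \<longleftrightarrow>
     (\<forall>V. openin X V \<and> V \<subseteq> U \<and> V \<noteq> {} \<longrightarrow> \<not> meager_in X (A \<inter> V))"

lemma nonmeager_on_subset: "nonmeager_on X A U \<Longrightarrow> V \<subseteq> U \<Longrightarrow> nonmeager_on X A V"
  unfolding nonmeager_on_def by blast

lemma nonmeager_onD: "nonmeager_on X A U \<Longrightarrow> openin X V \<Longrightarrow> V \<subseteq> U \<Longrightarrow> V \<noteq> {} \<Longrightarrow> A \<inter> V \<noteq> {}"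
  unfolding nonmeager_on_def using meager_in_empty by metis

text \<open>If no such \<open>V\<close> existed, the basic open sets in which \<open>A\<close> is
  meager would be dense in \<open>U\<close>. Then \<open>F\<close>, the part of the closure of
  \<open>U\<close> outside them, is closed with empty interior, and \<open>A \<inter> U\<close> is
  covered by \<open>F\<close> together with countably many meager pieces.\<close>

lemma ex_nonmeager_on:
  assumes X: "second_countable X" and U: "openin X U" and A: "\<not> meager_in X (A \<inter> U)"
  obtains V where "openin X V" "V \<subseteq> U" "V \<noteq> {}" "nonmeager_on X A V"
proof (rule ccontr)
  assume no: "\<not> thesis"
  obtain \<B> where \<B>: "countable \<B>" "\<And>V. V \<in> \<B> \<Longrightarrow> openin X V"
    "\<And>U x. openin X U \<Longrightarrow> x \<in> U \<Longrightarrow> \<exists>V\<in>\<B>. x \<in> V \<and> V \<subseteq> U"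
    using X unfolding second_countable_def by metis
  define \<G> where "\<G> = {V \<in> \<B>. meager_in X (A \<inter> V)}"
  define F where "F = X closure_of U - \<Union>\<G>"
  have cF: "closedin X F"
    unfolding F_def by (intro closedin_diff closedin_closure_of openin_Union) (use \<B> in \<open>auto simp: \<G>_def\<close>)
  have iF: "X interior_of F = {}"
  proof (rule ccontr)
    assume "X interior_of F \<noteq> {}"
    moreover have "X interior_of F \<subseteq> X closure_of U"
      using interior_of_subset[of X F] unfolding F_def by auto
    ultimately have ne: "X interior_of F \<inter> U \<noteq> {}"
      using openin_Int_closure_of_eq_empty[of X "X interior_of F" U] by auto
    have op: "openin X (X interior_of F \<inter> U)" using U by auto
    from no that[OF op] ne have "\<not> nonmeager_on X A (X interior_of F \<inter> U)" by auto
    then obtain V where V: "openin X V" "V \<subseteq> X interior_of F \<inter> U" "V \<noteq> {}" "meager_in X (A \<inter> V)"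
      unfolding nonmeager_on_def by blast
    then obtain x where x: "x \<in> V" by blast
    then obtain V' where V': "V' \<in> \<B>" "x \<in> V'" "V' \<subseteq> V" using \<B>(3) V(1) by blast
    then have "meager_in X (A \<inter> V')" using V(4) by (elim meager_in_mono) auto
    then have "x \<in> \<Union>\<G>" using V' unfolding \<G>_def by blast
    moreover have "x \<in> F" using x V(2) interior_of_subset[of X F] by auto
    ultimately show False unfolding F_def by auto
  qed
  have "meager_in X (\<Union>((\<lambda>V. A \<inter> V) ` \<G>))"
    by (rule meager_in_Union) (use \<B>(1) in \<open>auto simp: \<G>_def\<close>)
  then have "meager_in X (F \<union> \<Union>((\<lambda>V. A \<inter> V) ` \<G>))"
    using meager_in_Un meager_in_closedin[OF cF iF] by blast
  moreover have "A \<inter> U \<subseteq> F \<union> \<Union>((\<lambda>V. A \<inter> V) ` \<G>)"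
    using closure_of_subset[OF openin_subset[OF U]] unfolding F_def by auto
  ultimately show False using A meager_in_mono by blast
qed

text \<open>One step of the Cantor scheme. Countably many basic open sets with small closure inside
  \<open>W\<close> cover \<open>W\<close>, so the image of one of them is still nonmeager in
  \<open>U\<close>; \<open>ex_nonmeager_on\<close> then localises the target. Closures are
  controlled so that nested intersections stay inside the earlier sets.\<close>

lemma (in Metric_space) shrink_nonmeager_image:
  assumes sc: "second_countable mtopology" "second_countable X" and f:
    "continuous_map mtopology X f"
    and W: "openin mtopology W" and U: "openin X U" and nm: "\<not> meager_in X (f ` W \<inter> U)"
    and e: "e > 0"
  obtains W' U' a where "openin mtopology W'" "mtopology closure_of W' \<subseteq> W"
    "mtopology closure_of W' \<subseteq> mcball a e" "openin X U'" "U' \<subseteq> U" "U' \<noteq> {}"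
    "nonmeager_on X (f ` W') U'"
proof -
  obtain \<B> where \<B>: "countable \<B>" "\<And>V. V \<in> \<B> \<Longrightarrow> openin mtopology V"
    "\<And>U x. openin mtopology U \<Longrightarrow> x \<in> U \<Longrightarrow> \<exists>V\<in>\<B>. x \<in> V \<and> V \<subseteq> U"
    using sc(1) unfolding second_countable_def by metis
  define \<G> where "\<G> = {V \<in> \<B>. mtopology closure_of V \<subseteq> W \<and> (\<exists>a. mtopology closure_of V \<subseteq> mcball a e)}"
  have cov: "W \<subseteq> \<Union>\<G>"
  proof
    fix x assume x: "x \<in> W"
    then obtain r where r: "r > 0" "mball x r \<subseteq> W" and xS: "x \<in> M"
      using W x unfolding openin_mtopology by blast
    define s where "s = min (r / 2) e"
    have s: "s > 0" "s < r" "s \<le> e" using r(1) e unfolding s_def by auto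
    obtain V where V: "V \<in> \<B>" "x \<in> V" "V \<subseteq> mball x s"
      using \<B>(3)[of "mball x s" x] s xS by auto
    have "mtopology closure_of V \<subseteq> mcball x s"
      using V(3) by (meson closure_of_minimal closedin_mcball mball_subset_mcball order_trans)
    moreover have "mcball x s \<subseteq> mball x r" "mcball x s \<subseteq> mcball x e" using s by auto
    ultimately show "x \<in> \<Union>\<G>" using V r(2) unfolding \<G>_def by blast
  qed
  have "\<exists>V\<in>\<G>. \<not> meager_in X (f ` V \<inter> U)"
  proof (rule ccontr)
    assume "\<not> ?thesis"
    then have "meager_in X (\<Union>((\<lambda>V. f ` V \<inter> U) ` \<G>))"
      using \<B>(1) by (intro meager_in_Union) (auto simp: \<G>_def)
    moreover have "f ` W \<inter> U \<subseteq> \<Union>((\<lambda>V. f ` V \<inter> U) ` \<G>)" using cov by blast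
    ultimately show False using nm meager_in_mono by blast
  qed
  then obtain V where V: "V \<in> \<G>" "\<not> meager_in X (f ` V \<inter> U)" by blast
  obtain U' where "openin X U'" "U' \<subseteq> U" "U' \<noteq> {}" "nonmeager_on X (f ` V) U'"
    using ex_nonmeager_on[OF sc(2) U V(2)] by blast
  with V(1) \<B>(2) that show ?thesis unfolding \<G>_def by blast
qed

text \<open>This replaces the Baire property of analytic sets: a Cantor-type scheme shrinks both
  sources while keeping both images nonmeager in every part of a common open set.\<close>

lemma nonmeager_images_meet:
  assumes Q1: "polish_topology Q1" and Q2: "polish_topology Q2"
    and X: "second_countable X" "Hausdorff_space X"
    and f: "continuous_map Q1 X f" and g: "continuous_map Q2 X g"
    and U: "openin X U" "U \<noteq> {}"
    and nm: "nonmeager_on X (f ` topspace Q1) U" "nonmeager_on X (g ` topspace Q2) U"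
  shows "\<exists>x\<in>topspace Q1. \<exists>y\<in>topspace Q2. f x = g y"
proof -
  obtain S d where Q1': "Metric_space S d" "Metric_space.mcomplete S d"
    "Q1 = Metric_space.mtopology S d"
    "second_countable Q1" using polish_topologyE[OF Q1] by metis
  obtain S' d' where Q2': "Metric_space S' d'" "Metric_space.mcomplete S' d'"
    "Q2 = Metric_space.mtopology S' d'"
    "second_countable Q2" using polish_topologyE[OF Q2] by metis
  interpret A: Metric_space S d by (rule Q1')
  interpret B: Metric_space S' d' by (rule Q2')
  \<comment> \<open>The common open set \<open>O'\<close> is the only link between the two sources,
    so it must remain the same set for both images at every stage.\<close>
  define P where "P = (\<lambda>(n::nat) (W, V, O').
     openin Q1 W \<and> openin Q2 V \<and> openin X O' \<and> O' \<noteq> {} \<and>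
     nonmeager_on X (f ` W) O' \<and> nonmeager_on X (g ` V) O')"
  define R where "R = (\<lambda>(n::nat) (W, V, O'::'c set) (W', V', O''). 
     Q1 closure_of W' \<subseteq> W \<and> Q2 closure_of V' \<subseteq> V \<and> O'' \<subseteq> O' \<and>
     (\<exists>a. Q1 closure_of W' \<subseteq> A.mcball a (inverse (Suc n))) \<and>
     (\<exists>a. Q2 closure_of V' \<subseteq> B.mcball a (inverse (Suc n))))"
  have "\<exists>s. \<forall>n. P n (s n) \<and> R n (s n) (s (Suc n))"
  proof (rule dependent_nat_choice)
    show "\<exists>s. P 0 s"
      unfolding P_def using U nm by (intro exI[of _ "(topspace Q1, topspace Q2, U)"]) auto
  next
    fix s n assume "P n s"
    then obtain W V O1 where s: "s = (W, V, O1)" and P: "openin Q1 W" "openin Q2 V" "openin X O1"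
      "O1 \<noteq> {}"
      "nonmeager_on X (f ` W) O1" "nonmeager_on X (g ` V) O1"
      unfolding P_def by (cases s) auto
    have e: "inverse (real (Suc n)) > 0" by simp
    have "\<not> meager_in X (f ` W \<inter> O1)" using P unfolding nonmeager_on_def by blast
    then obtain W' O2 a where W': "openin Q1 W'" "Q1 closure_of W' \<subseteq> W"
      "Q1 closure_of W' \<subseteq> A.mcball a (inverse (Suc n))" "openin X O2" "O2 \<subseteq> O1" "O2 \<noteq> {}"
      "nonmeager_on X (f ` W') O2"
      by (rule A.shrink_nonmeager_image[folded Q1'(3), OF Q1'(4) X(1) f P(1) P(3) _ e]) (rule that)
    \<comment> \<open>The second source is shrunk inside the target \<open>O2\<close> left by the
      first. This does not spoil the first image, since nonmeagerness in every part passes down to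
      \<open>O3\<close>.\<close>
    have "\<not> meager_in X (g ` V \<inter> O2)" using P W' unfolding nonmeager_on_def by blast
    then obtain V' O3 b where V': "openin Q2 V'" "Q2 closure_of V' \<subseteq> V"
      "Q2 closure_of V' \<subseteq> B.mcball b (inverse (Suc n))" "openin X O3" "O3 \<subseteq> O2" "O3 \<noteq> {}"
      "nonmeager_on X (g ` V') O3"
      by (rule B.shrink_nonmeager_image[folded Q2'(3), OF Q2'(4) X(1) g P(2) W'(4) _ e]) (rule that)
    have "P (Suc n) (W', V', O3)"
      unfolding P_def using W' V' nonmeager_on_subset[OF W'(7) V'(5)] by auto
    moreover have "R n s (W', V', O3)"
      unfolding R_def s using W' V' by auto
    ultimately show "\<exists>s'. P (Suc n) s' \<and> R n s s'" by blast
  qed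
  then obtain s where s: "\<And>n. P n (s n)" "\<And>n. R n (s n) (s (Suc n))" by blast
  define W where "W = (\<lambda>n. fst (s n))"
  define V where "V = (\<lambda>n. fst (snd (s n)))"
  define O' where "O' = (\<lambda>n. snd (snd (s n)))"
  have sn: "s n = (W n, V n, O' n)" for n unfolding W_def V_def O'_def by simp
  have P: "openin Q1 (W n)" "openin Q2 (V n)" "openin X (O' n)" "O' n \<noteq> {}"
    "nonmeager_on X (f ` W n) (O' n)" "nonmeager_on X (g ` V n) (O' n)" for n
    using s(1)[of n] unfolding P_def sn by auto
  have R: "Q1 closure_of W (Suc n) \<subseteq> W n" "Q2 closure_of V (Suc n) \<subseteq> V n"
     "\<exists>a. Q1 closure_of W (Suc n) \<subseteq> A.mcball a (inverse (Suc n))"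
     "\<exists>a. Q2 closure_of V (Suc n) \<subseteq> B.mcball a (inverse (Suc n))" for n
    using s(2)[of n] unfolding R_def sn by auto
  have subW: "W n \<subseteq> Q1 closure_of W n" and subV: "V n \<subseteq> Q2 closure_of V n" for n
    using P by (simp_all add: closure_of_subset openin_subset)
  have "W (Suc n) \<subseteq> W n" and "V (Suc n) \<subseteq> V n" for n
    using R(1,2) subW subV by blast+
  then have decW: "W m \<subseteq> W n" and decV: "V m \<subseteq> V n" if "n \<le> m" for n m
    using lift_Suc_antimono_le[of W n m] lift_Suc_antimono_le[of V n m] that by simp_all
  have small: "\<exists>n a. C n \<subseteq> MC a e"
    if C: "\<And>n. \<exists>a. C n \<subseteq> MC a (inverse (real (Suc n)))" and e: "e > 0"
      and MC: "\<And>a r e. r \<le> e \<Longrightarrow> MC a r \<subseteq> MC a e"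
    for C :: "nat \<Rightarrow> 'z set" and MC :: "'z \<Rightarrow> real \<Rightarrow> 'z set" and e
  proof -
    obtain n :: nat where "inverse (Suc n) < e" using e reals_Archimedean by blast
    then show ?thesis using C[of n] MC[of "inverse (Suc n)" e] by fastforce
  qed
  have neW: "W n \<noteq> {}" and neV: "V n \<noteq> {}" for n
    using nonmeager_onD[OF P(5) P(3) order_refl P(4), of n]
      nonmeager_onD[OF P(6) P(3) order_refl P(4), of n] by blast+
  have "\<Inter>(range (\<lambda>n. Q1 closure_of W (Suc n))) \<noteq> {}"
  proof (rule A.mcomplete_nest[THEN iffD1, OF Q1'(2), rule_format], intro conjI allI impI)
    show "closedin A.mtopology (Q1 closure_of W (Suc n))" for n using Q1' by simp
    show "Q1 closure_of W (Suc n) \<noteq> {}" for n using neW subW by blast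
    show "decseq (\<lambda>n. Q1 closure_of W (Suc n))"
      by (intro decseq_SucI closure_of_mono decW) simp
    show "\<exists>n a. Q1 closure_of W (Suc n) \<subseteq> A.mcball a e" if "e > 0" for e
      using R(3) that by (intro small) auto
  qed
  then obtain x where x: "\<And>n. x \<in> Q1 closure_of W (Suc n)" by auto
  have "\<Inter>(range (\<lambda>n. Q2 closure_of V (Suc n))) \<noteq> {}"
  proof (rule B.mcomplete_nest[THEN iffD1, OF Q2'(2), rule_format], intro conjI allI impI)
    show "closedin B.mtopology (Q2 closure_of V (Suc n))" for n using Q2' by simp
    show "Q2 closure_of V (Suc n) \<noteq> {}" for n using neV subV by blast
    show "decseq (\<lambda>n. Q2 closure_of V (Suc n))"
      by (intro decseq_SucI closure_of_mono decV) simp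
    show "\<exists>n a. Q2 closure_of V (Suc n) \<subseteq> B.mcball a e" if "e > 0" for e
      using R(4) that by (intro small) auto
  qed
  then obtain y where y: "\<And>n. y \<in> Q2 closure_of V (Suc n)" by auto
  have xS: "x \<in> topspace Q1" and yS: "y \<in> topspace Q2"
    using x y closure_of_subset_topspace by fastforce+
  have "f x = g y"
  proof (rule ccontr)
    assume neq: "f x \<noteq> g y"
    have "f x \<in> topspace X" "g y \<in> topspace X"
      using xS yS f g by (auto simp: continuous_map_def)
    then obtain U1 U2 where U12: "openin X U1" "openin X U2" "f x \<in> U1" "g y \<in> U2" "disjnt U1 U2"
      using X(2) neq unfolding Hausdorff_space_def by meson
    have "openin A.mtopology {z \<in> topspace Q1. f z \<in> U1}" "x \<in> {z \<in> topspace Q1. f z \<in> U1}"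
      using openin_continuous_map_preimage[OF f U12(1)] U12(3) xS Q1'(3) by auto
    then obtain r where r: "r > 0" "A.mball x r \<subseteq> {z \<in> topspace Q1. f z \<in> U1}"
      unfolding A.openin_mtopology by blast
    have "openin B.mtopology {z \<in> topspace Q2. g z \<in> U2}" "y \<in> {z \<in> topspace Q2. g z \<in> U2}"
      using openin_continuous_map_preimage[OF g U12(2)] U12(4) yS Q2'(3) by auto
    then obtain r' where r': "r' > 0" "B.mball y r' \<subseteq> {z \<in> topspace Q2. g z \<in> U2}"
      unfolding B.openin_mtopology by blast
    obtain n :: nat where n: "inverse (Suc n) < min r r' / 2"
      using r(1) r'(1) reals_Archimedean[of "min r r' / 2"] by auto
    obtain a b where ab: "Q1 closure_of W (Suc n) \<subseteq> A.mcball a (inverse (Suc n))"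
       "Q2 closure_of V (Suc n) \<subseteq> B.mcball b (inverse (Suc n))" using R(3,4) by blast
    have "W (Suc n) \<subseteq> A.mball x r"
    proof
      fix z assume "z \<in> W (Suc n)"
      then have "z \<in> A.mcball a (inverse (Suc n))" "x \<in> A.mcball a (inverse (Suc n))"
        using subW ab x by blast+
      then show "z \<in> A.mball x r"
        using n A.triangle''[of x a z] A.commute by auto
    qed
    moreover have "V (Suc n) \<subseteq> B.mball y r'"
    proof
      fix z assume "z \<in> V (Suc n)"
      then have "z \<in> B.mcball b (inverse (Suc n))" "y \<in> B.mcball b (inverse (Suc n))"
        using subV ab y by blast+
      then show "z \<in> B.mball y r'"
        using n B.triangle''[of y b z] B.commute by auto
    qed
    ultimately have fW: "f ` W (Suc n) \<subseteq> U1" and gV: "g ` V (Suc n) \<subseteq> U2"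
      using r(2) r'(2) by blast+
    \<comment> \<open>Nonmeagerness is used twice: the first image meets \<open>O'\<close>, so the
      open set \<open>O' \<inter> U1\<close> is nonempty, and hence the second image meets it as
      well, although that image lies in \<open>U2\<close>.\<close>
    have "O' (Suc n) \<inter> U1 \<noteq> {}"
      using nonmeager_onD[OF P(5) P(3) order_refl P(4), of "Suc n"] fW by blast
    then have "g ` V (Suc n) \<inter> (O' (Suc n) \<inter> U1) \<noteq> {}"
      by (intro nonmeager_onD[OF P(6)]) (use U12 P(3) in auto)
    with gV U12(5) show False by (auto simp: disjnt_def)
  qed
  with xS yS show ?thesis by blast
qed

section \<open>Standard Borel and sigma-finite measure spaces\<close>

lemma standard_borel_topologyE:
  assumes "standard_borel M"
  obtains T where "polish_topology T" "topspace T = space M"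
    "sets M = sigma_sets (space M) {U. openin T U}"
  using assms unfolding standard_borel_def by blast

lemma standard_borel_countable_base:
  assumes "standard_borel M"
  obtains E :: "nat \<Rightarrow> 'a set" where "range E \<subseteq> sets M" "sets M = sigma_sets (space M) (range E)"
    "\<And>x y. x \<in> space M \<Longrightarrow> y \<in> space M \<Longrightarrow> x \<noteq> y \<Longrightarrow> \<exists>n. x \<in> E n \<and> y \<notin> E n"
proof -
  obtain T where T: "polish_topology T" "topspace T = space M"
    "sets M = sigma_sets (space M) {U. openin T U}"
    using assms by (rule standard_borel_topologyE)
  obtain \<B> where \<B>: "countable \<B>" "\<And>V. V \<in> \<B> \<Longrightarrow> openin T V"
    "\<And>U x. openin T U \<Longrightarrow> x \<in> U \<Longrightarrow> \<exists>V\<in>\<B>. x \<in> V \<and> V \<subseteq> U"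
    using polish_second_countable[OF T(1)] unfolding second_countable_def by metis
  \<comment> \<open>The empty set is added because \<open>from_nat_into\<close> enumerates only
    nonempty sets; it changes neither the generated sigma-algebra nor the separation of
    points.\<close>
  define E where "E = from_nat_into (insert {} \<B>)"
  have E: "range E = insert {} \<B>"
    unfolding E_def using \<B>(1) by (intro range_from_nat_into) auto
  have op: "openin T (E n)" for n
    using E \<B>(2) openin_empty by (metis insertE rangeI)
  show thesis
  proof (rule that)
    show ran: "range E \<subseteq> sets M" unfolding T(3) using op by blast
    have "U \<in> sigma_sets (space M) (range E)" if U: "openin T U" for U
    proof -
      have "U = \<Union>{V \<in> \<B>. V \<subseteq> U}" using \<B>(3)[OF U] by blast
      also have "\<dots> \<in> sigma_sets (space M) (range E)"
      proof (rule sigma_sets_UNION)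
        show "countable {V \<in> \<B>. V \<subseteq> U}" using \<B>(1) by simp
        show "V \<in> sigma_sets (space M) (range E)" if "V \<in> {V \<in> \<B>. V \<subseteq> U}" for V
          using that E by (intro sigma_sets.Basic) auto
      qed
      finally show ?thesis .
    qed
    then have "sets M \<subseteq> sigma_sets (space M) (range E)"
      unfolding T(3) by (intro sigma_sets_mono) auto
    moreover have "sigma_sets (space M) (range E) \<subseteq> sets M"
      using ran by (rule sets.sigma_sets_subset)
    ultimately show "sets M = sigma_sets (space M) (range E)" by blast
    fix x y assume xy: "x \<in> space M" "y \<in> space M" "x \<noteq> y"
    then obtain U V where UV: "openin T U" "x \<in> U" "y \<in> V" "disjnt U V"
      using polish_Hausdorff[OF T(1)] T(2) unfolding Hausdorff_space_def by metis
    then obtain W where W: "W \<in> \<B>" "x \<in> W" "W \<subseteq> U" using \<B>(3) by blast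
    then obtain n where "E n = W" using E by (metis insertI2 rangeE)
    then show "\<exists>n. x \<in> E n \<and> y \<notin> E n"
      using W UV by (metis disjnt_iff subsetD)
  qed
qed

text \<open>A countable family separating points turns the equation into countably many measurable
  conditions.\<close>

lemma sets_Collect_eq_standard_borel:
  assumes M: "standard_borel M" and fg: "f \<in> measurable N M" "g \<in> measurable N M"
  shows "{x \<in> space N. f x = g x} \<in> sets N"
proof -
  obtain E :: "nat \<Rightarrow> 'a set" where E: "range E \<subseteq> sets M" "sets M = sigma_sets (space M) (range E)"
    "\<And>x y. x \<in> space M \<Longrightarrow> y \<in> space M \<Longrightarrow> x \<noteq> y \<Longrightarrow> \<exists>n. x \<in> E n \<and> y \<notin> E n"
    using standard_borel_countable_base[OF M] by metis
  have [measurable]: "E n \<in> sets M" for n using E(1) by auto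
  note fg[measurable]
  have "f x = g x \<longleftrightarrow> (\<forall>n. f x \<in> E n \<longleftrightarrow> g x \<in> E n)" if "x \<in> space N" for x
    using E(3)[of "f x" "g x"] measurable_space[OF fg(1) that] measurable_space[OF fg(2) that]
      by metis
  then have "{x \<in> space N. f x = g x} = {x \<in> space N. \<forall>n. f x \<in> E n \<longleftrightarrow> g x \<in> E n}" by blast
  also have "\<dots> \<in> sets N" by measurable
  finally show ?thesis .
qed

section \<open>Essential unions and separability of the measure algebra\<close>

text \<open>A strictly positive integrable density gives a finite measure \<open>N\<close> with the
  same null sets. Among countable subfamilies the supremum of the \<open>N\<close>-measure of the
  union is attained, by uniting near-optimal ones, and a member with nonnull part outside that union
  would exceed the supremum.\<close>

lemma essential_union:
  assumes "sigma_finite_measure M" and \<A>: "\<A> \<subseteq> sets M"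
  obtains \<B> where "countable \<B>" "\<B> \<subseteq> \<A>" "\<And>A. A \<in> \<A> \<Longrightarrow> A - \<Union>\<B> \<in> null_sets M"
proof -
  interpret sigma_finite_measure M by fact
  obtain h where h: "h \<in> borel_measurable M" "integral\<^sup>N M h \<noteq> \<infinity>"
    "\<And>x. x \<in> space M \<Longrightarrow> 0 < h x"
    using Ex_finite_integrable_function by metis
  define N where "N = density M h"
  have sN: "sets N = sets M" "space N = space M" unfolding N_def by auto
  have "emeasure N (space N) = (\<integral>\<^sup>+x. h x * indicator (space M) x \<partial>M)"
    unfolding N_def using h(1) by (simp add: emeasure_density)
  also have "\<dots> = integral\<^sup>N M h" by (intro nn_integral_cong) simp
  finally interpret N: finite_measure N using h(2) by (intro finite_measureI) simp
  have null: "A \<in> null_sets M" if "A \<in> sets M" "measure N A = 0" for A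
  proof -
    have "A \<in> null_sets N" using that sN by (simp add: null_sets_def N.emeasure_eq_measure)
    then have "AE x in M. x \<in> A \<longrightarrow> h x = 0"
      unfolding N_def using null_sets_density_iff[OF h(1)] by blast
    then have "AE x in M. x \<notin> A" using AE_space by eventually_elim (use h(3) in force)
    then show ?thesis using that(1) AE_iff_null_sets by blast
  qed
  define c where "c = (\<lambda>\<B>. measure N (\<Union>\<B>))"
  define S where "S = c ` {\<B>. countable \<B> \<and> \<B> \<subseteq> \<A>}"
  have S: "S \<noteq> {}" unfolding S_def by (auto intro!: exI[of _ "{}"])
  have bdd: "bdd_above S" unfolding S_def c_def
    by (intro bdd_aboveI[of _ "measure N (space N)"]) (auto simp: N.bounded_measure)
  have meas: "\<Union>\<B> \<in> sets M" if "countable \<B>" "\<B> \<subseteq> \<A>" for \<B>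
    using that \<A> by (intro sets.countable_Union) auto
  have "\<exists>\<B>. countable \<B> \<and> \<B> \<subseteq> \<A> \<and> c \<B> > Sup S - inverse (real (Suc n))" for n
  proof -
    have "Sup S - inverse (real (Suc n)) < Sup S" by simp
    then obtain s where "s \<in> S" "Sup S - inverse (real (Suc n)) < s"
      using less_cSup_iff[OF S bdd] by blast
    then show ?thesis unfolding S_def by auto
  qed
  then obtain \<B>' where \<B>': "\<And>n. countable (\<B>' n)" "\<And>n. \<B>' n \<subseteq> \<A>"
    "\<And>n. c (\<B>' n) > Sup S - inverse (real (Suc n))" by metis
  define \<B> where "\<B> = (\<Union>n. \<B>' n)"
  have \<B>: "countable \<B>" "\<B> \<subseteq> \<A>" unfolding \<B>_def using \<B>' by auto
  have ge: "c \<B> \<ge> Sup S"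
  proof (rule field_le_epsilon)
    fix e :: real assume "e > 0"
    then obtain n where n: "inverse (real (Suc n)) < e" using reals_Archimedean by blast
    have "c (\<B>' n) \<le> c \<B>" unfolding c_def
      by (rule N.finite_measure_mono) (use meas[OF \<B>] sN in \<open>auto simp: \<B>_def\<close>)
    with \<B>'(3)[of n] n show "Sup S \<le> c \<B> + e" by linarith
  qed
  show ?thesis
  proof (rule that[OF \<B>])
    fix A assume A: "A \<in> \<A>"
    have "c (insert A \<B>) \<le> Sup S"
      by (rule cSup_upper[OF _ bdd]) (use A \<B> in \<open>auto simp: S_def\<close>)
    moreover have "c (insert A \<B>) = measure N (\<Union>\<B>) + measure N (A - \<Union>\<B>)"
      unfolding c_def using A \<A> meas[OF \<B>] sN 
      by (subst N.finite_measure_Union[symmetric]) (auto intro!: arg_cong[of _ _ "measure N"])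
    ultimately have "measure N (A - \<Union>\<B>) \<le> 0" using ge unfolding c_def by linarith
    then show "A - \<Union>\<B> \<in> null_sets M"
      using A \<A> meas[OF \<B>] by (intro null) (auto simp: measure_le_0_iff)
  qed
qed

text \<open>The approximable sets form a sigma-algebra. For countable unions, finiteness of the
  measure lets a finite partial union replace the whole union up to \<open>e / 2\<close>.\<close>

lemma (in finite_measure) approx_by_algebra:
  assumes gen: "sets M = sigma_sets (space M) \<G>" and \<D>: "\<G> \<subseteq> \<D>" "\<D> \<subseteq> sets M"
    and compl: "\<And>D. D \<in> \<D> \<Longrightarrow> space M - D \<in> \<D>"
    and un: "\<And>D D'. D \<in> \<D> \<Longrightarrow> D' \<in> \<D> \<Longrightarrow> D \<union> D' \<in> \<D>"
    and ne: "\<D> \<noteq> {}"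
    and B: "B \<in> sets M"
  shows "\<forall>e>0. \<exists>D\<in>\<D>. measure M (sym_diff B D) < e"
proof -
  have un': "\<forall>e>0. \<exists>D\<in>\<D>. measure M (sym_diff (A \<union> B) D) < e"
    if A: "A \<in> sets M" "\<forall>e>0. \<exists>D\<in>\<D>. measure M (sym_diff A D) < e"
      and B: "B \<in> sets M" "\<forall>e>0. \<exists>D\<in>\<D>. measure M (sym_diff B D) < e" for A B
  proof (intro allI impI)
    fix e :: real assume e: "e > 0"
    obtain D where D: "D \<in> \<D>" "measure M (sym_diff A D) < e / 2" using A(2) e half_gt_zero by blast
    obtain D' where D': "D' \<in> \<D>" "measure M (sym_diff B D') < e / 2" using B(2) e half_gt_zero
      by blast
    have m: "D \<in> sets M" "D' \<in> sets M" using D D' \<D> by auto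
    have "measure M (sym_diff (A \<union> B) (D \<union> D')) \<le> measure M (sym_diff A D \<union> sym_diff B D')"
      by (rule finite_measure_mono) (use A B m in auto)
    also have "\<dots> \<le> measure M (sym_diff A D) + measure M (sym_diff B D')"
      by (rule measure_Un_le) (use A B m in auto)
    also have "\<dots> < e" using D D' by simp
    finally show "\<exists>D\<in>\<D>. measure M (sym_diff (A \<union> B) D) < e" using un D D' by blast
  qed
  have "B \<in> sigma_sets (space M) \<G>" using B gen by simp
  then show ?thesis
  proof (induction rule: sigma_sets.induct)
    case (Basic a)
    then show ?case using \<D> by (intro allI impI bexI[of _ a]) auto
  next
    case Empty
    obtain D where "D \<in> \<D>" using ne by blast
    then have "space M - D \<in> \<D>" "D \<union> (space M - D) \<in> \<D>" "D \<subseteq> space M"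
      using compl un \<D> sets.sets_into_space by blast+
    then have "{} \<in> \<D>" using compl[of "D \<union> (space M - D)"] by (simp add: Un_absorb1)
    then show ?case by (intro allI impI bexI[of _ "{}"]) auto
  next
    case (Compl a)
    have a: "a \<in> sets M" using Compl gen by simp
    show ?case
    proof (intro allI impI)
      fix e :: real assume "e > 0"
      then obtain D where D: "D \<in> \<D>" "measure M (sym_diff a D) < e" using Compl by blast
      have "sym_diff (space M - a) (space M - D) = sym_diff a D"
        using D \<D> a sets.sets_into_space by blast
      then show "\<exists>D\<in>\<D>. measure M (sym_diff (space M - a) D) < e" using D compl by metis
    qed
  next
    case (Union a)
    have a: "a i \<in> sets M" for i using Union gen by simp
    have fin: "\<forall>e>0. \<exists>D\<in>\<D>. measure M (sym_diff (\<Union>i\<le>n. a i) D) < e" for n :: nat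
    proof (induction n)
      case 0 then show ?case using Union by simp
    next
      case (Suc n)
      have "(\<Union>i\<le>Suc n. a i) = (\<Union>i\<le>n. a i) \<union> a (Suc n)" by (auto simp: le_Suc_eq)
      then show ?case using un'[OF _ Suc.IH a Union.IH, of "Suc n"] a by auto
    qed
    show ?case
    proof (intro allI impI)
      fix e :: real assume e: "e > 0"
      define F where "F = (\<lambda>n. (\<Union>i\<le>n. a i))"
      have F: "F n \<in> sets M" for n unfolding F_def using a by auto
      have U: "(\<Union>n. F n) = (\<Union>i. a i)" unfolding F_def by auto
      have "(\<lambda>n. measure M (F n)) \<longlonglongrightarrow> measure M (\<Union>n. F n)"
        using F by (intro finite_Lim_measure_incseq) (auto intro!: incseq_SucI simp: F_def le_Suc_eq)
      then obtain n where n: "\<bar>measure M (F n) - measure M (\<Union>i. a i)\<bar> < e / 2"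
        using e unfolding LIMSEQ_iff U real_norm_def by (metis half_gt_zero order_refl)
      have sub: "F n \<subseteq> (\<Union>i. a i)" unfolding F_def by auto
      have mU: "(\<Union>i. a i) \<in> sets M" using a by auto
      have d: "measure M ((\<Union>i. a i) - F n) < e / 2"
        using n finite_measure_Diff[OF mU F sub] finite_measure_mono[OF sub mU] by linarith
      obtain D where D: "D \<in> \<D>" "measure M (sym_diff (F n) D) < e / 2"
        using fin e half_gt_zero unfolding F_def by blast
      have m: "D \<in> sets M" using D \<D> by auto
      have "measure M (sym_diff (\<Union>i. a i) D) \<le> measure M (((\<Union>i. a i) - F n) \<union> sym_diff (F n) D)"
        by (rule finite_measure_mono) (use mU F m sub in auto)
      also have "\<dots> \<le> measure M ((\<Union>i. a i) - F n) + measure M (sym_diff (F n) D)"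
        by (rule measure_Un_le) (use mU F m in auto)
      also have "\<dots> < e" using D d by simp
      finally show "\<exists>D\<in>\<D>. measure M (sym_diff (\<Union>i. a i) D) < e" using D by blast
    qed
  qed
qed

text \<open>Stated for one unary and one binary operation so that it yields both a countable algebra
  of sets (complement, union) and a countable subgroup (inverse, composition).\<close>

lemma countable_closure:
  assumes "countable \<G>" "\<G> \<subseteq> \<A>"
    and "\<And>A. A \<in> \<A> \<Longrightarrow> c A \<in> \<A>" "\<And>A B. A \<in> \<A> \<Longrightarrow> B \<in> \<A> \<Longrightarrow> b A B \<in> \<A>"
  obtains \<D> where "countable \<D>" "\<G> \<subseteq> \<D>" "\<D> \<subseteq> \<A>"
    "\<And>D. D \<in> \<D> \<Longrightarrow> c D \<in> \<D>" "\<And>D E. D \<in> \<D> \<Longrightarrow> E \<in> \<D> \<Longrightarrow> b D E \<in> \<D>"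
proof -
  define step where "step = (\<lambda>\<D>. \<D> \<union> c ` \<D> \<union> (\<lambda>(D, E). b D E) ` (\<D> \<times> \<D>))"
  define \<D> where "\<D> = (\<lambda>n. (step ^^ n) \<G>)"
  have D_Suc: "\<D> (Suc n) = step (\<D> n)" for n unfolding \<D>_def by simp
  have cnt: "countable (\<D> n)" for n
    by (induction n) (use assms(1) in \<open>auto simp: \<D>_def step_def\<close>)
  have sub: "\<D> n \<subseteq> \<A>" for n
  proof (induction n)
    case 0 then show ?case using assms(2) by (simp add: \<D>_def)
  next
    case (Suc n)
    have "c D \<in> \<A>" if "D \<in> \<D> n" for D using assms(3) Suc.IH that by auto
    moreover have "b D E \<in> \<A>" if "D \<in> \<D> n" "E \<in> \<D> n" for D E using assms(4) Suc.IH that by auto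
    ultimately show ?case using Suc.IH by (auto simp: D_Suc step_def)
  qed
  have mono: "\<D> m \<subseteq> \<D> n" if "m \<le> n" for m n
    by (rule lift_Suc_mono_le[OF _ that]) (auto simp: D_Suc step_def)
  show thesis
  proof (rule that[of "\<Union>n. \<D> n"])
    show "\<G> \<subseteq> (\<Union>n. \<D> n)" using UN_upper[of 0 UNIV \<D>] by (simp add: \<D>_def)
    show "c D \<in> (\<Union>n. \<D> n)" if "D \<in> (\<Union>n. \<D> n)" for D
    proof -
      obtain n where "D \<in> \<D> n" using \<open>D \<in> _\<close> by blast
      then have "c D \<in> \<D> (Suc n)" unfolding D_Suc step_def by blast
      then show ?thesis by blast
    qed
    show "b D E \<in> (\<Union>n. \<D> n)" if DE: "D \<in> (\<Union>n. \<D> n)" "E \<in> (\<Union>n. \<D> n)" for D E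
    proof -
      obtain m n where "D \<in> \<D> m" "E \<in> \<D> n" using DE by blast
      then have "D \<in> \<D> (max m n)" "E \<in> \<D> (max m n)" using mono
        by (meson max.cobounded1 max.cobounded2 subsetD)+
      then have "b D E \<in> \<D> (Suc (max m n))" unfolding D_Suc step_def by auto
      then show ?thesis by blast
    qed
  qed (use cnt sub in auto)
qed

text \<open>A set of finite measure is nearly contained in some \<open>Y n\<close>, and on
  \<open>Y n\<close> the measure is finite, so a countable generating algebra is dense there.
  Members of the algebra may have infinite measure, hence the dense family consists of their traces
  on the \<open>Y n\<close>.\<close>

lemma countable_dense_measure_algebra:
  assumes std: "standard_borel M" and "sigma_finite_measure M"
  obtains \<D> where "countable \<D>" "\<D> \<subseteq> sets M"
    "\<And>B e. B \<in> sets M \<Longrightarrow> emeasure M B < \<infinity> \<Longrightarrow> e > 0 \<Longrightarrow>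
       \<exists>D\<in>\<D>. emeasure M (sym_diff B D) < ennreal e"
proof -
  interpret sigma_finite_measure M by fact
  obtain E :: "nat \<Rightarrow> 'a set" where E: "range E \<subseteq> sets M" "sets M = sigma_sets (space M) (range E)"
    using standard_borel_countable_base[OF std] by metis
  obtain Y :: "nat \<Rightarrow> 'a set" where Y: "range Y \<subseteq> sets M" "(\<Union>i. Y i) = space M"
    "\<And>i. emeasure M (Y i) \<noteq> \<infinity>" "incseq Y"
    using sigma_finite_incseq by blast
  have Ym: "Y i \<in> sets M" for i using Y by auto
  obtain \<A> where \<A>: "countable \<A>" "range E \<subseteq> \<A>" "\<A> \<subseteq> sets M"
    "\<And>D. D \<in> \<A> \<Longrightarrow> space M - D \<in> \<A>" "\<And>D E. D \<in> \<A> \<Longrightarrow> E \<in> \<A> \<Longrightarrow> D \<union> E \<in> \<A>"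
    using countable_closure[of "range E" "sets M" "\<lambda>D. space M - D" "(\<union>)"] E(1) by auto
  show thesis
  proof (rule that[of "(\<lambda>(D, i). D \<inter> Y i) ` (\<A> \<times> UNIV)"])
    show "countable ((\<lambda>(D, i). D \<inter> Y i) ` (\<A> \<times> UNIV))" using \<A>(1) by auto
    show "(\<lambda>(D, i). D \<inter> Y i) ` (\<A> \<times> UNIV) \<subseteq> sets M" using \<A>(3) Ym by auto
    fix B and e :: real assume B: "B \<in> sets M" "emeasure M B < \<infinity>" and e: "e > 0"
    have "(\<lambda>n. emeasure M (B \<inter> Y n)) \<longlonglongrightarrow> emeasure M (\<Union>n. B \<inter> Y n)"
      using B Ym Y(4) by (intro Lim_emeasure_incseq) (auto simp: incseq_def)
    moreover have BY: "(\<Union>n. B \<inter> Y n) = B" using Y(2) sets.sets_into_space[OF B(1)] by auto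
    ultimately have lim: "(\<lambda>n. measure M (B \<inter> Y n)) \<longlonglongrightarrow> measure M B"
      unfolding measure_def using B(2) by (intro tendsto_enn2real) auto
    then obtain n where n: "\<bar>measure M (B \<inter> Y n) - measure M B\<bar> < e / 2"
      using e unfolding LIMSEQ_iff real_norm_def by (metis half_gt_zero order_refl)
    have "measure M (B - B \<inter> Y n) = measure M B - measure M (B \<inter> Y n)"
      using B Ym by (intro measure_Diff) auto
    then have d: "emeasure M (B - Y n) < ennreal (e / 2)"
    proof -
      have fin: "emeasure M (B - Y n) < \<infinity>"
        using B Ym emeasure_mono[of "B - Y n" B M] by (auto simp: less_top[symmetric] top_unique)
      have "B - B \<inter> Y n = B - Y n" by auto
      with \<open>measure M (B - B \<inter> Y n) = _\<close>
      have "measure M (B - Y n) = measure M B - measure M (B \<inter> Y n)" by simp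
      with n have "measure M (B - Y n) < e / 2" by linarith
      with fin show ?thesis using e by (simp add: emeasure_eq_ennreal_measure ennreal_lessI)
    qed
    define N where "N = density M (indicator (Y n))"
    have sN: "sets N = sets M" "space N = space M" unfolding N_def by auto
    have eN: "emeasure N A = emeasure M (Y n \<inter> A)" if "A \<in> sets M" for A
      unfolding N_def by (rule emeasure_restricted) (use that Ym in auto)
    interpret N: finite_measure N
      using eN[of "space M"] Y(3)[of n] sN sets.sets_into_space[OF Ym[of n]]
      by (intro finite_measureI) (auto simp: Int_absorb2)
    have "\<exists>D\<in>\<A>. measure N (sym_diff B D) < e / 2"
    proof (rule N.approx_by_algebra[rule_format, of "range E" \<A> B])
      show "sets N = sigma_sets (space N) (range E)" using E(2) sN by simp
    qed (use \<A> E sN B(1) e in auto)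
    then obtain D where D: "D \<in> \<A>" "measure N (sym_diff B D) < e / 2" by blast
    have Dm: "D \<in> sets M" using D \<A>(3) by auto
    have "emeasure N (sym_diff B D) < ennreal (e / 2)"
      using D(2) e by (simp add: N.emeasure_eq_measure ennreal_lessI)
    then have D': "emeasure M (Y n \<inter> sym_diff B D) < ennreal (e / 2)"
      using eN[of "sym_diff B D"] B(1) Dm by auto
    have "emeasure M (sym_diff B (D \<inter> Y n)) \<le> emeasure M ((B - Y n) \<union> (Y n \<inter> sym_diff B D))"
      by (rule emeasure_mono) (use B Ym Dm in auto)
    also have "\<dots> \<le> emeasure M (B - Y n) + emeasure M (Y n \<inter> sym_diff B D)"
      by (rule emeasure_subadditive) (use B Ym Dm in auto)
    also have "\<dots> < ennreal (e / 2) + ennreal (e / 2)" using d D' by (rule add_strict_mono)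
    also have "\<dots> = ennreal e" using e by (simp flip: ennreal_plus)
    finally show "\<exists>D\<in>(\<lambda>(D, i). D \<inter> Y i) ` (\<A> \<times> UNIV). emeasure M (sym_diff B D) < ennreal e"
      using D(1) by (intro bexI[of _ "D \<inter> Y n"]) auto
  qed
qed

section \<open>Measurable relations with countable sections\<close>

text \<open>Plays the role of a finer Polish topology on the Borel set \<open>B\<close>: a choice of cover elements
  with the finite intersection property inside \<open>B\<close> converges to a point of \<open>B\<close>.\<close>

definition complete_covers :: "'z topology \<Rightarrow> 'z set set \<Rightarrow> 'z set \<Rightarrow> (nat \<Rightarrow> 'z set set) \<Rightarrow> bool" where
  "complete_covers X \<Sigma> B \<U> \<longleftrightarrow>
     (\<forall>k. countable (\<U> k) \<and> \<U> k \<subseteq> \<Sigma> \<and> B \<subseteq> \<Union>(\<U> k)) \<and>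
     (\<forall>N. (\<forall>k. N k \<in> \<U> k \<and> B \<inter> (\<Inter>j\<le>k. N j) \<noteq> {}) \<longrightarrow>
        (\<exists>p\<in>B. \<forall>V. openin X V \<and> p \<in> V \<longrightarrow> (\<exists>k. B \<inter> (\<Inter>j\<le>k. N j) \<subseteq> V)))"

lemma complete_coversD:
  assumes "complete_covers X \<Sigma> B \<U>"
  shows "countable (\<U> k)" "\<U> k \<subseteq> \<Sigma>" "B \<subseteq> \<Union>(\<U> k)"
  using assms unfolding complete_covers_def by blast+

lemma complete_covers_limit:
  assumes "complete_covers X \<Sigma> B \<U>" "\<And>k. N k \<in> \<U> k" "\<And>k. B \<inter> (\<Inter>j\<le>k. N j) \<noteq> {}"
  obtains p where "p \<in> B" "\<And>V. openin X V \<Longrightarrow> p \<in> V \<Longrightarrow> \<exists>k. B \<inter> (\<Inter>j\<le>k. N j) \<subseteq> V"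
  using assms unfolding complete_covers_def by metis

text \<open>The cover of index k consists of the balls of radius 1/(k+1) about a countable dense
  set. The closures of the finite intersections are then nested with shrinking size, and
  completeness provides the limit. The balls are open only relative to \<open>B\<close>, which is
  why \<open>\<Sigma>\<close> has to contain traces of open sets.\<close>

lemma complete_covers_polish:
  assumes pol: "polish_topology (subtopology X B)" and BX: "B \<subseteq> topspace X"
    and \<Sigma>: "\<And>V. openin X V \<Longrightarrow> V \<inter> B \<in> \<Sigma>"
  shows "\<exists>\<U>. complete_covers X \<Sigma> B \<U>"
proof -
  obtain S d where Sd: "Metric_space S d" "Metric_space.mcomplete S d"
    "subtopology X B = Metric_space.mtopology S d" "second_countable (subtopology X B)"
    using polish_topologyE[OF pol] by metis
  interpret Metric_space S d by (rule Sd)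
  have S: "S = B" using topspace_mtopology BX unfolding Sd(3)[symmetric] by auto
  obtain C where C: "countable C" "C \<subseteq> S" "mtopology closure_of C = S"
    using pol unfolding polish_topology_def separable_space_def Sd(3) by auto
  define \<U> where "\<U> = (\<lambda>k::nat. (\<lambda>c. mball c (inverse (real (Suc k)))) ` C)"
  have opB: "V \<in> \<Sigma>" if "openin mtopology V" for V
    using that \<Sigma> unfolding Sd(3)[symmetric] openin_subtopology by auto
  have "complete_covers X \<Sigma> B \<U>"
    unfolding complete_covers_def
  proof (intro conjI allI impI)
    fix k
    show "countable (\<U> k)" unfolding \<U>_def using C by simp
    show "\<U> k \<subseteq> \<Sigma>" unfolding \<U>_def using opB by auto
    show "B \<subseteq> \<Union>(\<U> k)"
    proof
      fix x assume "x \<in> B"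
      then have x: "x \<in> S" "x \<in> mtopology closure_of C" using S C by auto
      then have "\<forall>r>0. \<exists>c\<in>C. c \<in> mball x r" using metric_closure_of[of C] by blast
      then obtain c where c: "c \<in> C" "c \<in> mball x (inverse (real (Suc k)))"
        by (metis inverse_positive_iff_positive of_nat_0_less_iff zero_less_Suc)
      then have "x \<in> mball c (inverse (real (Suc k)))" using commute by auto
      with c show "x \<in> \<Union>(\<U> k)" unfolding \<U>_def by blast
    qed
  next
    fix N assume N: "\<forall>k. N k \<in> \<U> k \<and> B \<inter> (\<Inter>j\<le>k. N j) \<noteq> {}"
    define K where "K = (\<lambda>k. B \<inter> (\<Inter>j\<le>k. N j))"
    have KS: "K k \<subseteq> S" for k unfolding K_def S by auto
    have Kdec: "K m \<subseteq> K k" if "k \<le> m" for k m unfolding K_def using that by auto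
    have Kb: "\<exists>c. mtopology closure_of K k \<subseteq> mcball c (inverse (real (Suc k)))" for k
    proof -
      obtain c where "N k = mball c (inverse (real (Suc k)))" using N unfolding \<U>_def by blast
      moreover have "K k \<subseteq> N k" unfolding K_def by auto
      ultimately have "K k \<subseteq> mcball c (inverse (real (Suc k)))"
        using mball_subset_mcball[of c] by (metis order_trans)
      then show ?thesis by (meson closure_of_minimal closedin_mcball)
    qed
    have Ksub: "K k \<subseteq> mtopology closure_of K k" for k
      using KS by (simp add: closure_of_subset)
    have "\<Inter>(range (\<lambda>k. mtopology closure_of K k)) \<noteq> {}"
    proof (rule mcomplete_nest[THEN iffD1, OF Sd(2), rule_format], intro conjI allI impI)
      show "mtopology closure_of K k \<noteq> {}" for k using Ksub N unfolding K_def by blast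
      show "decseq (\<lambda>k. mtopology closure_of K k)"
        by (intro decseq_SucI closure_of_mono Kdec) simp
      fix e :: real assume "e > 0"
      then obtain n :: nat where n: "inverse (real (Suc n)) < e" using reals_Archimedean by blast
      obtain c where "mtopology closure_of K n \<subseteq> mcball c (inverse (real (Suc n)))" using Kb
        by blast
      moreover have "mcball c (inverse (real (Suc n))) \<subseteq> mcball c e" using n by auto
      ultimately show "\<exists>n a. mtopology closure_of K n \<subseteq> mcball a e" by blast
    qed simp
    then obtain p where p: "\<And>k. p \<in> mtopology closure_of K k" by auto
    have "p \<in> S" using p[of 0] closure_of_subset_topspace[of mtopology "K 0"]
      unfolding topspace_mtopology by blast
    then have pB: "p \<in> B" using S by simp
    show "\<exists>p\<in>B. \<forall>V. openin X V \<and> p \<in> V \<longrightarrow> (\<exists>k. B \<inter> (\<Inter>j\<le>k. N j) \<subseteq> V)"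
    proof (intro bexI[of _ p] allI impI pB)
      fix V assume V: "openin X V \<and> p \<in> V"
      then have "openin mtopology (B \<inter> V)"
        unfolding Sd(3)[symmetric] by (simp add: openin_subtopology_Int2)
      then obtain r where r: "r > 0" "mball p r \<subseteq> B \<inter> V"
        using V pB unfolding openin_mtopology by blast
      obtain n :: nat where n: "inverse (real (Suc n)) < r / 2"
        using reals_Archimedean[of "r / 2"] r by auto
      obtain c where c: "mtopology closure_of K n \<subseteq> mcball c (inverse (real (Suc n)))" using Kb
        by blast
      have "K n \<subseteq> mball p r"
      proof
        fix z assume "z \<in> K n"
        then have "z \<in> mcball c (inverse (real (Suc n)))" "p \<in> mcball c (inverse (real (Suc n)))"
          using c p Ksub by blast+
        then show "z \<in> mball p r" using n triangle''[of p c z] commute by auto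
      qed
      then show "\<exists>k. B \<inter> (\<Inter>j\<le>k. N j) \<subseteq> V" using r unfolding K_def by blast
    qed
  qed
  then show ?thesis by blast
qed

text \<open>The covers of all the sets are interleaved through \<open>prod_decode\<close>, so a
  choice for the intersection contains a choice for each \<open>B i\<close> and has a limit in each
  \<open>B i\<close>. All these limits agree because the space is Hausdorff, and the common limit
  lies in the intersection.\<close>

lemma complete_covers_INT:
  assumes cc: "\<And>i::nat. complete_covers X \<Sigma> (B i) (\<U> i)" and X: "Hausdorff_space X"
    and BX: "\<And>i. B i \<subseteq> topspace X"
  shows "complete_covers X \<Sigma> (\<Inter>i. B i) (\<lambda>n. \<U> (fst (prod_decode n)) (snd (prod_decode n)))"
  unfolding complete_covers_def
proof (intro conjI allI impI)
  fix n
  show "countable (\<U> (fst (prod_decode n)) (snd (prod_decode n)))"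
    "\<U> (fst (prod_decode n)) (snd (prod_decode n)) \<subseteq> \<Sigma>"
    using complete_coversD(1,2)[OF cc] by auto
  show "(\<Inter>i. B i) \<subseteq> \<Union>(\<U> (fst (prod_decode n)) (snd (prod_decode n)))"
    using complete_coversD(3)[OF cc, of "fst (prod_decode n)" "snd (prod_decode n)"] by blast
next
  fix N assume N: "\<forall>k. N k \<in> \<U> (fst (prod_decode k)) (snd (prod_decode k)) \<and>
    (\<Inter>i. B i) \<inter> (\<Inter>j\<le>k. N j) \<noteq> {}"
  define L where "L = (\<lambda>k. (\<Inter>i. B i) \<inter> (\<Inter>j\<le>k. N j))"
  have L: "L k \<noteq> {}" for k using N unfolding L_def by blast
  have Ldec: "L m \<subseteq> L k" if "k \<le> m" for k m unfolding L_def using that by auto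
  have sub: "\<exists>m. L m \<subseteq> B i \<inter> (\<Inter>j\<le>k. N (prod_encode (i, j)))" for i k
  proof -
    define m where "m = Max ((\<lambda>j. prod_encode (i, j)) ` {..k})"
    have "prod_encode (i, j) \<le> m" if "j \<le> k" for j unfolding m_def using that by (intro Max_ge) auto
    then have "L m \<subseteq> B i \<inter> (\<Inter>j\<le>k. N (prod_encode (i, j)))" unfolding L_def by auto
    then show ?thesis by blast
  qed
  have "\<exists>p\<in>B i. \<forall>V. openin X V \<and> p \<in> V \<longrightarrow> (\<exists>k. L k \<subseteq> V)" for i
  proof -
    have "N (prod_encode (i, k)) \<in> \<U> i k" for k using N[rule_format, of "prod_encode (i, k)"]
      by simp
    moreover have "B i \<inter> (\<Inter>j\<le>k. N (prod_encode (i, j))) \<noteq> {}" for k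
      using sub[of i k] L by (metis subset_empty)
    ultimately obtain p where p: "p \<in> B i"
      "\<And>V. openin X V \<Longrightarrow> p \<in> V \<Longrightarrow> \<exists>k. B i \<inter> (\<Inter>j\<le>k. N (prod_encode (i, j))) \<subseteq> V"
      using complete_covers_limit[OF cc, of "\<lambda>k. N (prod_encode (i, k))" i] by blast
    have "\<exists>k. L k \<subseteq> V" if "openin X V" "p \<in> V" for V
      using p(2)[OF that] sub[of i] by (meson order_trans)
    with p(1) show ?thesis by blast
  qed
  then obtain p where p: "\<And>i. p i \<in> B i" "\<And>i V. openin X V \<Longrightarrow> p i \<in> V \<Longrightarrow> \<exists>k. L k \<subseteq> V"
    by metis
  have "p i = p 0" for i
  proof (rule ccontr)
    assume "p i \<noteq> p 0"
    moreover have "p i \<in> topspace X" "p 0 \<in> topspace X" using p(1) BX by blast+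
    ultimately obtain U V where UV: "openin X U" "openin X V" "p i \<in> U" "p 0 \<in> V" "disjnt U V"
      using X unfolding Hausdorff_space_def by metis
    obtain k m where "L k \<subseteq> U" "L m \<subseteq> V" using p(2) UV by meson
    then have "L (max k m) \<subseteq> U \<inter> V"
      using Ldec[of k "max k m"] Ldec[of m "max k m"] by auto
    then show False using L UV(5) by (auto simp: disjnt_def)
  qed
  then have "p 0 \<in> (\<Inter>i. B i)" using p(1) by (metis INT_I)
  with p(2)[of _ 0] show "\<exists>p\<in>\<Inter>i. B i. \<forall>V. openin X V \<and> p \<in> V \<longrightarrow>
      (\<exists>k. (\<Inter>i. B i) \<inter> (\<Inter>j\<le>k. N j) \<subseteq> V)"
    unfolding L_def by blast
qed

text \<open>The analogue of a disjoint sum of Polish spaces. Cutting the cover elements down to the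
  \<open>B i\<close> makes the index visible: two choices that intersect must have the same index,
  so the whole sequence lives in the set selected by the first choice.\<close>

lemma complete_covers_disjoint_UN:
  assumes cc: "\<And>i::nat. complete_covers X \<Sigma> (B i) (\<U> i)" and disj: "disjoint_family B"
    and \<Sigma>: "\<And>i N. N \<in> \<Sigma> \<Longrightarrow> N \<inter> B i \<in> \<Sigma>"
  shows "complete_covers X \<Sigma> (\<Union>i. B i) (\<lambda>k. \<Union>i. (\<lambda>N. N \<inter> B i) ` \<U> i k)"
  unfolding complete_covers_def
proof (intro conjI allI impI)
  fix k
  show "countable (\<Union>i. (\<lambda>N. N \<inter> B i) ` \<U> i k)" using complete_coversD(1)[OF cc] by auto
  show "(\<Union>i. (\<lambda>N. N \<inter> B i) ` \<U> i k) \<subseteq> \<Sigma>" using complete_coversD(2)[OF cc] \<Sigma> by blast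
  show "(\<Union>i. B i) \<subseteq> \<Union>(\<Union>i. (\<lambda>N. N \<inter> B i) ` \<U> i k)"
  proof
    fix x assume "x \<in> (\<Union>i. B i)"
    then obtain i where x: "x \<in> B i" by (elim UN_E)
    then obtain N where N: "N \<in> \<U> i k" "x \<in> N" using complete_coversD(3)[OF cc, of i k]
      by (meson UnionE subsetD)
    then have "N \<inter> B i \<in> (\<Union>i. (\<lambda>N. N \<inter> B i) ` \<U> i k)" by (intro UN_I[of i]) auto
    with x N(2) show "x \<in> \<Union>(\<Union>i. (\<lambda>N. N \<inter> B i) ` \<U> i k)" by (intro UnionI[of "N \<inter> B i"]) auto
  qed
next
  fix N' assume N': "\<forall>k. N' k \<in> (\<Union>i. (\<lambda>N. N \<inter> B i) ` \<U> i k) \<and> (\<Union>i. B i) \<inter> (\<Inter>j\<le>k. N' j) \<noteq> {}"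
  then have "\<exists>i N. N \<in> \<U> i k \<and> N' k = N \<inter> B i" for k by blast
  then obtain i N where iN: "\<And>k. N k \<in> \<U> (i k) k" "\<And>k. N' k = N k \<inter> B (i k)" by metis
  have i: "i k = i 0" for k
  proof -
    obtain z where "z \<in> (\<Inter>j\<le>k. N' j)" using N' by blast
    then have "z \<in> N' 0" "z \<in> N' k" by auto
    then show ?thesis using disj iN(2) by (auto simp: disjoint_family_on_def)
  qed
  have eq: "(\<Union>i. B i) \<inter> (\<Inter>j\<le>k. N' j) = B (i 0) \<inter> (\<Inter>j\<le>k. N j)" for k
  proof -
    have "N' j = N j \<inter> B (i 0)" for j using iN(2) i by metis
    then have "(\<Inter>j\<le>k. N' j) = B (i 0) \<inter> (\<Inter>j\<le>k. N j)" by auto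
    then show ?thesis by blast
  qed
  have "N k \<in> \<U> (i 0) k" for k using iN(1)[of k] i[of k] by simp
  moreover have "B (i 0) \<inter> (\<Inter>j\<le>k. N j) \<noteq> {}" for k using N' eq by metis
  ultimately obtain p where "p \<in> B (i 0)"
      "\<And>V. openin X V \<Longrightarrow> p \<in> V \<Longrightarrow> \<exists>k. B (i 0) \<inter> (\<Inter>j\<le>k. N j) \<subseteq> V"
    using complete_covers_limit[OF cc, of N "i 0"] by blast
  then show "\<exists>p\<in>\<Union>i. B i. \<forall>V. openin X V \<and> p \<in> V \<longrightarrow> (\<exists>k. (\<Union>i. B i) \<inter> (\<Inter>j\<le>k. N' j) \<subseteq> V)"
    unfolding eq by blast
qed

text \<open>Second countability writes an open subset of the product as a countable union of open
  rectangles, so the product sigma-algebra contains all of them.\<close>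

lemma sets_pair_standard_borel:
  assumes T: "polish_topology T" "topspace T = space M"
    "sets M = sigma_sets (space M) {U. openin T U}"
  shows "sets (M \<Otimes>\<^sub>M M) = sigma_sets (space M \<times> space M) {U \<times> V |U V. openin T U \<and> openin T V}"
    and "openin (prod_topology T T) W \<Longrightarrow> W \<in> sets (M \<Otimes>\<^sub>M M)"
proof -
  have "sets (M \<Otimes>\<^sub>M M) = sets (sigma (space M \<times> space M)
      {a \<times> b |a b. a \<in> {U. openin T U} \<and> b \<in> {U. openin T U}})"
    by (rule sets_pair_eq[of _ _ "{topspace T}" _ _ "{topspace T}"])
      (use T openin_subset[of T] openin_topspace[of T] in auto)
  moreover have "{U \<times> V |U V. openin T U \<and> openin T V} \<subseteq> Pow (space M \<times> space M)"
    using openin_subset T(2) by fastforce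
  ultimately show eq: "sets (M \<Otimes>\<^sub>M M) = sigma_sets (space M \<times> space M) {U \<times> V |U V. openin T U \<and> openin T V}"
    by simp
  assume W: "openin (prod_topology T T) W"
  obtain \<B> where \<B>: "countable \<B>" "\<And>V. V \<in> \<B> \<Longrightarrow> openin T V"
    "\<And>U x. openin T U \<Longrightarrow> x \<in> U \<Longrightarrow> \<exists>V\<in>\<B>. x \<in> V \<and> V \<subseteq> U"
    using polish_second_countable[OF T(1)] unfolding second_countable_def by metis
  let ?C = "{P \<in> (\<lambda>(U, V). U \<times> V) ` (\<B> \<times> \<B>). P \<subseteq> W}"
  have "W \<subseteq> \<Union>?C"
  proof
    fix z assume z: "z \<in> W"
    obtain x y where xy: "z = (x, y)" by (cases z)
    then obtain U V where "openin T U" "openin T V" "x \<in> U" "y \<in> V" "U \<times> V \<subseteq> W"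
      using W z unfolding openin_prod_topology_alt by metis
    moreover from this obtain U' V' where "U' \<in> \<B>" "x \<in> U'" "U' \<subseteq> U" "V' \<in> \<B>" "y \<in> V'" "V' \<subseteq> V"
      using \<B>(3) by metis
    ultimately have "U' \<times> V' \<in> ?C" "z \<in> U' \<times> V'" unfolding xy by auto
    then show "z \<in> \<Union>?C" by blast
  qed
  then have "W = \<Union>?C" by blast
  moreover have "\<Union>?C \<in> sets (M \<Otimes>\<^sub>M M)"
  proof (rule sets.countable_Union)
    show "countable ?C" using \<B>(1) by auto
    have "V \<in> sets M" if "V \<in> \<B>" for V unfolding T(3) using \<B>(2)[OF that]
      by (intro sigma_sets.Basic) simp
    then show "?C \<subseteq> sets (M \<Otimes>\<^sub>M M)" by auto
  qed
  ultimately show "W \<in> sets (M \<Otimes>\<^sub>M M)" by simp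
qed

text \<open>A cover of a set does not directly produce one of its complement, so the induction over
  Borel sets carries both at once. A disjoint union then pairs with an intersection of complements,
  and open and closed subsets of the product serve as the base case, being Polish.\<close>

lemma ex_complete_covers:
  assumes T: "polish_topology T" "topspace T = space M"
    "sets M = sigma_sets (space M) {U. openin T U}"
    and B: "B \<in> sets (M \<Otimes>\<^sub>M M)"
  shows "\<exists>\<U>. complete_covers (prod_topology T T) (sets (M \<Otimes>\<^sub>M M)) B \<U>"
proof -
  let ?Z = "prod_topology T T" and ?S = "sets (M \<Otimes>\<^sub>M M)" and ?\<Omega> = "space M \<times> space M"
  let ?G = "{U \<times> V |U V. openin T U \<and> openin T V}"
  have Z: "topspace ?Z = ?\<Omega>" "polish_topology ?Z" using T by (auto intro: polish_prod_topology)
  have haus: "Hausdorff_space ?Z" using Z by (intro polish_Hausdorff)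
  note pair = sets_pair_standard_borel[OF T]
  have sub: "?G \<subseteq> Pow ?\<Omega>" using openin_subset T(2) by fastforce
  have sp: "space (M \<Otimes>\<^sub>M M) = ?\<Omega>" by (simp add: space_pair_measure)
  have "(\<exists>\<U>. complete_covers ?Z ?S B \<U>) \<and> (\<exists>\<U>. complete_covers ?Z ?S (?\<Omega> - B) \<U>)"
  proof (rule sigma_sets_induct_disjoint[where G = ?G and \<Omega> = ?\<Omega> and A = B and
        P = "\<lambda>B. (\<exists>\<U>. complete_covers ?Z ?S B \<U>) \<and> (\<exists>\<U>. complete_covers ?Z ?S (?\<Omega> - B) \<U>)"])
    show "Int_stable ?G"
    proof (rule Int_stableI)
      fix a b assume "a \<in> ?G" "b \<in> ?G"
      then obtain U V U' V' where "a = U \<times> V" "b = U' \<times> V'" "openin T U" "openin T V" "openin T U'"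
        "openin T V'"
        by blast
      then have "a \<inter> b = (U \<inter> U') \<times> (V \<inter> V')" "openin T (U \<inter> U')" "openin T (V \<inter> V')" by auto
      then show "a \<inter> b \<in> ?G" by blast
    qed
    show "?G \<subseteq> Pow ?\<Omega>" by (rule sub)
    show "B \<in> sigma_sets ?\<Omega> ?G" using B pair(1) by simp
  next
    fix A assume "A \<in> ?G"
    then have op: "openin ?Z A" by (auto simp: openin_prod_Times_iff)
    have cl: "closedin ?Z (?\<Omega> - A)" using op Z(1) by (metis openin_closedin_eq)
    have m: "A \<in> ?S" "?\<Omega> - A \<in> ?S" using pair(2)[OF op] sp sets.compl_sets by metis+
    have "\<exists>\<U>. complete_covers ?Z ?S A \<U>"
      by (rule complete_covers_polish[OF polish_openin[OF Z(2) op] openin_subset[OF op]])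
        (use m pair(2) in auto)
    moreover have "\<exists>\<U>. complete_covers ?Z ?S (?\<Omega> - A) \<U>"
      by (rule complete_covers_polish[OF polish_closedin[OF Z(2) cl] closedin_subset[OF cl]])
        (use m pair(2) in auto)
    ultimately show "(\<exists>\<U>. complete_covers ?Z ?S A \<U>) \<and> (\<exists>\<U>. complete_covers ?Z ?S (?\<Omega> - A) \<U>)" ..
  next
    have "\<exists>\<U>. complete_covers ?Z ?S ?\<Omega> \<U>"
      by (rule complete_covers_polish)
        (use Z pair(2) sp in \<open>auto simp: subtopology_topspace[of ?Z, unfolded Z(1)] intro: sets.Int\<close>)
    moreover have "complete_covers ?Z ?S {} (\<lambda>_. {})" by (simp add: complete_covers_def)
    ultimately show "(\<exists>\<U>. complete_covers ?Z ?S {} \<U>) \<and> (\<exists>\<U>. complete_covers ?Z ?S (?\<Omega> - {}) \<U>)"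
      by auto
  next
    fix A assume A: "A \<in> sigma_sets ?\<Omega> ?G"
      "(\<exists>\<U>. complete_covers ?Z ?S A \<U>) \<and> (\<exists>\<U>. complete_covers ?Z ?S (?\<Omega> - A) \<U>)"
    then have "?\<Omega> - (?\<Omega> - A) = A" using sigma_sets_into_sp[OF sub] by blast
    with A(2) show "(\<exists>\<U>. complete_covers ?Z ?S (?\<Omega> - A) \<U>) \<and>
        (\<exists>\<U>. complete_covers ?Z ?S (?\<Omega> - (?\<Omega> - A)) \<U>)" by simp
  next
    fix A :: "nat \<Rightarrow> ('a \<times> 'a) set"
    assume A: "disjoint_family A" "range A \<subseteq> sigma_sets ?\<Omega> ?G"
      "\<And>i. (\<exists>\<U>. complete_covers ?Z ?S (A i) \<U>) \<and> (\<exists>\<U>. complete_covers ?Z ?S (?\<Omega> - A i) \<U>)"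
    have "\<exists>\<U>. \<forall>i. complete_covers ?Z ?S (A i) (\<U> i)" using A(3) by (intro choice) blast
    moreover have "\<exists>\<V>. \<forall>i. complete_covers ?Z ?S (?\<Omega> - A i) (\<V> i)" using A(3)
      by (intro choice) blast
    ultimately obtain \<U> \<V> where UV: "\<And>i. complete_covers ?Z ?S (A i) (\<U> i)"
      "\<And>i. complete_covers ?Z ?S (?\<Omega> - A i) (\<V> i)" by auto
    have "A i \<in> ?S" for i using A(2) pair(1) by auto
    then have "complete_covers ?Z ?S (\<Union>i. A i) (\<lambda>k. \<Union>i. (\<lambda>N. N \<inter> A i) ` \<U> i k)"
      by (intro complete_covers_disjoint_UN UV A) auto
    moreover have "complete_covers ?Z ?S (\<Inter>i. ?\<Omega> - A i)
        (\<lambda>n. \<V> (fst (prod_decode n)) (snd (prod_decode n)))"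
      by (intro complete_covers_INT UV haus) (use Z(1) in auto)
    moreover have "(\<Inter>i. ?\<Omega> - A i) = ?\<Omega> - (\<Union>i. A i)" by auto
    ultimately show "(\<exists>\<U>. complete_covers ?Z ?S (\<Union>i. A i) \<U>) \<and>
        (\<exists>\<U>. complete_covers ?Z ?S (?\<Omega> - (\<Union>i. A i)) \<U>)" by auto
  qed
  then show ?thesis ..
qed

text \<open>The last property holds because otherwise a choice of cover elements avoiding the points of
  the section one by one would converge to a further point of the section.\<close>

lemma ex_isolating_sets:
  assumes std: "standard_borel M" and R: "R \<in> sets (M \<Otimes>\<^sub>M M)"
  obtains \<N> where "countable \<N>" "\<N> \<subseteq> sets (M \<Otimes>\<^sub>M M)"
    "\<And>N N'. N \<in> \<N> \<Longrightarrow> N' \<in> \<N> \<Longrightarrow> N \<inter> N' \<in> \<N>"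
    "\<And>z z'. z \<in> space M \<times> space M \<Longrightarrow> z' \<in> space M \<times> space M \<Longrightarrow> z \<noteq> z' \<Longrightarrow> \<exists>N\<in>\<N>. z \<in> N \<and> z' \<notin> N"
    "\<And>x D. x \<in> space M \<Longrightarrow> countable (R `` {x}) \<Longrightarrow> D \<subseteq> R `` {x} \<Longrightarrow> D \<noteq> {} \<Longrightarrow>
        \<exists>N\<in>\<N>. \<exists>y. {y \<in> D. (x, y) \<in> N} = {y}"
proof -
  obtain T where T: "polish_topology T" "topspace T = space M"
    "sets M = sigma_sets (space M) {U. openin T U}"
    using std by (rule standard_borel_topologyE)
  let ?Z = "prod_topology T T" and ?S = "sets (M \<Otimes>\<^sub>M M)" and ?\<Omega> = "space M \<times> space M"
  have Z: "topspace ?Z = ?\<Omega>" "polish_topology ?Z" using T by (auto intro: polish_prod_topology)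
  note haus = polish_Hausdorff[OF Z(2)]
  have sp: "space (M \<Otimes>\<^sub>M M) = ?\<Omega>" by (simp add: space_pair_measure)
  obtain \<U> where cc: "complete_covers ?Z ?S R \<U>" using ex_complete_covers[OF T R] by blast
  obtain \<B> where \<B>: "countable \<B>" "\<And>V. V \<in> \<B> \<Longrightarrow> openin ?Z V"
    "\<And>U x. openin ?Z U \<Longrightarrow> x \<in> U \<Longrightarrow> \<exists>V\<in>\<B>. x \<in> V \<and> V \<subseteq> U"
    using polish_second_countable[OF Z(2)] unfolding second_countable_def by metis
  define \<G> where "\<G> = \<B> \<union> (\<Union>k. \<U> k)"
  have \<G>: "countable \<G>" "\<G> \<subseteq> ?S"
    unfolding \<G>_def using \<B>(1,2) complete_coversD(1,2)[OF cc] sets_pair_standard_borel(2)[OF T]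
      by blast+
  \<comment> \<open>Finite intersections make the family stable under intersection; the factor
    \<open>?\<Omega>\<close> gives the empty family a sensible value.\<close>
  define \<N> where "\<N> = (\<lambda>F. ?\<Omega> \<inter> \<Inter>F) ` {F. finite F \<and> F \<subseteq> \<G>}"
  show thesis
  proof (rule that[of \<N>])
    show "countable \<N>" unfolding \<N>_def using countable_Collect_finite_subset[OF \<G>(1)] by simp
    show "\<N> \<subseteq> ?S"
    proof
      fix N assume "N \<in> \<N>"
      then obtain F where F: "finite F" "F \<subseteq> \<G>" "N = ?\<Omega> \<inter> \<Inter>F" unfolding \<N>_def by blast
      show "N \<in> ?S"
      proof (cases "F = {}")
        case True then show ?thesis using F(3) sp sets.top[of "M \<Otimes>\<^sub>M M"] by simp
      next
        case False
        have "\<Inter>F \<in> ?S" using F \<G>(2) False sets.finite_INT[of F id "M \<Otimes>\<^sub>M M"] by auto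
        then show ?thesis using F(3) sp sets.top[of "M \<Otimes>\<^sub>M M"] by auto
      qed
    qed
    show "N \<inter> N' \<in> \<N>" if N: "N \<in> \<N>" "N' \<in> \<N>" for N N'
    proof -
      obtain F where F: "N = ?\<Omega> \<inter> \<Inter>F" "F \<in> {F. finite F \<and> F \<subseteq> \<G>}"
        using N(1) unfolding \<N>_def by (rule imageE)
      obtain F' where F': "N' = ?\<Omega> \<inter> \<Inter>F'" "F' \<in> {F. finite F \<and> F \<subseteq> \<G>}"
        using N(2) unfolding \<N>_def by (rule imageE)
      have "N \<inter> N' = ?\<Omega> \<inter> \<Inter>(F \<union> F')" using F(1) F'(1) by blast
      moreover have "F \<union> F' \<in> {F. finite F \<and> F \<subseteq> \<G>}" using F(2) F'(2) by blast
      ultimately show ?thesis unfolding \<N>_def by (rule image_eqI)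
    qed
    have sep: "\<exists>V\<in>\<B>. z \<in> V \<and> (\<exists>W. openin ?Z W \<and> z' \<in> W \<and> V \<inter> W = {})"
      if z: "z \<in> ?\<Omega>" "z' \<in> ?\<Omega>" "z \<noteq> z'" for z z'
    proof -
      obtain U W where UW: "openin ?Z U" "openin ?Z W" "z \<in> U" "z' \<in> W" "disjnt U W"
        using haus[unfolded Hausdorff_space_def, rule_format, of z z'] z Z(1) by auto
      then obtain V where "V \<in> \<B>" "z \<in> V" "V \<subseteq> U" using \<B>(3) by blast
      with UW show ?thesis by (intro bexI[of _ V]) (auto simp: disjnt_def)
    qed
    show "\<exists>N\<in>\<N>. z \<in> N \<and> z' \<notin> N" if z: "z \<in> ?\<Omega>" "z' \<in> ?\<Omega>" "z \<noteq> z'" for z z'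
    proof -
      obtain V where V: "V \<in> \<B>" "z \<in> V" "z' \<notin> V" using sep[OF z] by blast
      then have "?\<Omega> \<inter> \<Inter>{V} \<in> \<N>" unfolding \<N>_def \<G>_def by blast
      then show ?thesis using V z by (intro bexI[of _ "?\<Omega> \<inter> \<Inter>{V}"]) auto
    qed
    fix x D assume x: "x \<in> space M" and cnt: "countable (R `` {x})" and D: "D \<subseteq> R `` {x}" "D \<noteq> {}"
    show "\<exists>N\<in>\<N>. \<exists>y. {y \<in> D. (x, y) \<in> N} = {y}"
    proof (rule ccontr)
      assume no: "\<not> ?thesis"
      define q where "q = from_nat_into (R `` {x})"
      have q: "range q = R `` {x}" unfolding q_def using cnt D by (intro range_from_nat_into) auto
      have R\<Omega>: "R \<subseteq> ?\<Omega>" using sets.sets_into_space[OF R] sp by simp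
      \<comment> \<open>Since no member of \<open>\<N>\<close> isolates a point of \<open>D\<close>,
        any finite set of conditions met by some value in \<open>D\<close> is also met by a value
        different from a prescribed \<open>y\<close>.\<close>
      have avoid: "\<exists>d\<in>D. d \<noteq> y \<and> (\<forall>A\<in>F. (x, d) \<in> A)"
        if F: "finite F" "F \<subseteq> \<G>" "e \<in> D" "\<forall>A\<in>F. (x, e) \<in> A" for F y e
      proof -
        have "?\<Omega> \<inter> \<Inter>F \<in> \<N>" unfolding \<N>_def using F by blast
        then have "{d \<in> D. (x, d) \<in> ?\<Omega> \<inter> \<Inter>F} \<noteq> {y}" using no by blast
        moreover have "e \<in> {d \<in> D. (x, d) \<in> ?\<Omega> \<inter> \<Inter>F}" using F(3,4) D(1) R\<Omega> by blast
        ultimately obtain d where "d \<in> {d \<in> D. (x, d) \<in> ?\<Omega> \<inter> \<Inter>F}" "d \<noteq> y" by blast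
        then show ?thesis by blast
      qed
      \<comment> \<open>At stage n a cover element \<open>N\<close> is added together with a set
        \<open>V\<close> kept away from the n-th point of the section by the open set
        \<open>W\<close>. All conditions collected so far stay satisfied by a single value in
        \<open>D\<close>, so the choices have the finite intersection property.\<close>
      define P where "P = (\<lambda>n (F, N, V, W). finite F \<and> F \<subseteq> \<G> \<and> N \<in> \<U> n \<and> N \<in> F \<and> V \<in> F \<and>
        openin ?Z W \<and> (x, q n) \<in> W \<and> V \<inter> W = {} \<and> (\<exists>e\<in>D. \<forall>A\<in>F. (x, e) \<in> A))"
      have step: "\<exists>s. P n s \<and> F \<subseteq> fst s"
        if F: "finite F" "F \<subseteq> \<G>" "\<exists>e\<in>D. \<forall>A\<in>F. (x, e) \<in> A" for F n
      proof -
        obtain d where d: "d \<in> D" "d \<noteq> q n" "\<forall>A\<in>F. (x, d) \<in> A"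
          using F(3) avoid[OF F(1,2), of _ "q n"] by metis
        have xd: "(x, d) \<in> R" "(x, q n) \<in> R" using d(1) D(1) q by auto
        then obtain N where N: "N \<in> \<U> n" "(x, d) \<in> N" using complete_coversD(3)[OF cc] by blast
        obtain V W where VW: "V \<in> \<B>" "(x, d) \<in> V" "openin ?Z W" "(x, q n) \<in> W" "V \<inter> W = {}"
          using sep[of "(x, d)" "(x, q n)"] xd R\<Omega> d(2) by blast
        have "P n (insert N (insert V F), N, V, W)"
          unfolding P_def using F d N VW by (auto simp: \<G>_def)
        then show ?thesis by (intro exI[of _ "(insert N (insert V F), N, V, W)"]) auto
      qed
      have "\<exists>s. \<forall>n. P n (s n) \<and> fst (s n) \<subseteq> fst (s (Suc n))"
      proof (rule dependent_nat_choice)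
        show "\<exists>s. P 0 s" using step[of "{}" 0] D(2) by blast
        show "\<exists>s'. P (Suc n) s' \<and> fst s \<subseteq> fst s'" if "P n s" for s n
          using step[of "fst s" "Suc n"] that unfolding P_def by (cases s) auto
      qed
      then obtain s where s: "\<And>n. P n (s n)" "\<And>n. fst (s n) \<subseteq> fst (s (Suc n))" by blast
      define F where "F = (\<lambda>n. fst (s n))"
      define N where "N = (\<lambda>n. fst (snd (s n)))"
      define V where "V = (\<lambda>n. fst (snd (snd (s n))))"
      define W where "W = (\<lambda>n. snd (snd (snd (s n))))"
      have sn: "s n = (F n, N n, V n, W n)" for n unfolding F_def N_def V_def W_def by simp
      have P: "N n \<in> \<U> n" "N n \<in> F n" "V n \<in> F n" "openin ?Z (W n)" "(x, q n) \<in> W n"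
        "V n \<inter> W n = {}"
        "\<exists>e\<in>D. \<forall>A\<in>F n. (x, e) \<in> A" for n
        using s(1)[of n] unfolding P_def sn by auto
      have Fmono: "F m \<subseteq> F n" if "m \<le> n" for m n
        by (rule lift_Suc_mono_le[OF _ that]) (use s(2) in \<open>simp add: F_def\<close>)
      have wit: "\<exists>e\<in>D. (x, e) \<in> R \<inter> (\<Inter>j\<le>k. N j) \<and> (x, e) \<in> V m" for k m
      proof -
        obtain e where e: "e \<in> D" "\<forall>A\<in>F (max k m). (x, e) \<in> A" using P(7) by blast
        have "N j \<in> F (max k m)" if "j \<le> k" for j
        proof -
          have "j \<le> max k m" using that by simp
          from Fmono[OF this] P(2)[of j] show ?thesis by blast
        qed
        moreover have "V m \<in> F (max k m)" using P(3)[of m] Fmono[of m "max k m"] by auto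
        ultimately show ?thesis using e D(1) by (intro bexI[of _ e]) auto
      qed
      then have "R \<inter> (\<Inter>j\<le>k. N j) \<noteq> {}" for k by blast
      then obtain p where p: "p \<in> R" "\<And>V. openin ?Z V \<Longrightarrow> p \<in> V \<Longrightarrow> \<exists>k. R \<inter> (\<Inter>j\<le>k. N j) \<subseteq> V"
        using complete_covers_limit[OF cc, of N] P(1) by blast
      have p\<Omega>: "p \<in> ?\<Omega>" using p(1) R\<Omega> by blast
      \<comment> \<open>Every finite intersection contains a point over \<open>x\<close>, so the
        limit cannot be separated from the fibre over \<open>x\<close>. It is therefore one of the
        enumerated points, the very points that the sets \<open>V\<close> were chosen to
        avoid.\<close>
      have "fst p = x"
      proof (rule ccontr)
        assume "fst p \<noteq> x"
        moreover have "fst p \<in> topspace T" using p\<Omega> T(2) by (metis mem_Times_iff)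
        ultimately obtain U U' where U: "openin T U" "fst p \<in> U" "x \<in> U'" "disjnt U U'"
          using polish_Hausdorff[OF T(1)] x T(2) unfolding Hausdorff_space_def by metis
        have "openin ?Z (U \<times> topspace T)" using U by (simp add: openin_prod_Times_iff)
        moreover have "p \<in> U \<times> topspace T" using U p\<Omega> T(2) by (cases p) auto
        ultimately obtain k where "R \<inter> (\<Inter>j\<le>k. N j) \<subseteq> U \<times> topspace T" using p(2) by blast
        moreover obtain e where "(x, e) \<in> R \<inter> (\<Inter>j\<le>k. N j)" using wit by blast
        ultimately have "x \<in> U" by blast
        with U show False by (auto simp: disjnt_def)
      qed
      then have "snd p \<in> range q" using p(1) q by (cases p) auto
      then obtain m where m: "p = (x, q m)" using \<open>fst p = x\<close> by (cases p) auto
      then obtain k where "R \<inter> (\<Inter>j\<le>k. N j) \<subseteq> W m"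
        using p(2)[OF P(4)[of m]] P(5)[of m] by metis
      then show False using wit[of k m] P(6)[of m] by blast
    qed
  qed
qed

text \<open>An almost-everywhere form of the Lusin--Novikov theorem. For each isolating set \<open>N\<close> take a
  maximal set \<open>B N\<close> over which the part of \<open>R\<close> inside \<open>N\<close> is already covered by countably many
  functions. If a section over a nonnull set avoided all these parts, an isolated value of it
  would be covered by a single additional function and contradict maximality.\<close>

lemma countable_sections_covered:
  assumes std: "standard_borel M" and sf: "sigma_finite_measure M"
    and R: "R \<in> sets (M \<Otimes>\<^sub>M M)" and cnt: "\<And>x. x \<in> space M \<Longrightarrow> countable (R `` {x})"
  obtains \<F> where "countable \<F>" "\<F> \<subseteq> measurable M M"
    "\<And>A g. A \<in> sets M \<Longrightarrow> g \<in> measurable M M \<Longrightarrow> \<forall>x\<in>A. (x, g x) \<in> R \<Longrightarrow>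
       AE x in M. x \<in> A \<longrightarrow> (\<exists>f\<in>\<F>. g x = f x)"
proof -
  let ?\<Omega> = "space M \<times> space M"
  obtain \<N> where \<N>: "countable \<N>" "\<N> \<subseteq> sets (M \<Otimes>\<^sub>M M)"
    and \<N>_Int: "\<And>N N'. N \<in> \<N> \<Longrightarrow> N' \<in> \<N> \<Longrightarrow> N \<inter> N' \<in> \<N>"
    and \<N>_sep: "\<And>z z'. z \<in> ?\<Omega> \<Longrightarrow> z' \<in> ?\<Omega> \<Longrightarrow> z \<noteq> z' \<Longrightarrow> \<exists>N\<in>\<N>. z \<in> N \<and> z' \<notin> N"
    and \<N>_iso: "\<And>x D. x \<in> space M \<Longrightarrow> countable (R `` {x}) \<Longrightarrow> D \<subseteq> R `` {x} \<Longrightarrow> D \<noteq> {} \<Longrightarrow>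
        \<exists>N\<in>\<N>. \<exists>y. {y \<in> D. (x, y) \<in> N} = {y}"
    by (rule ex_isolating_sets[OF std R]) (rule that)
  have graph_meas: "{x \<in> A. (x, g x) \<in> N} \<in> sets M"
    if "A \<in> sets M" "g \<in> measurable M M" "N \<in> sets (M \<Otimes>\<^sub>M M)" for A g N
  proof -
    have "(\<lambda>x. (x, g x)) \<in> measurable M (M \<Otimes>\<^sub>M M)" using that(2) by simp
    from measurable_sets[OF this that(3)]
    have "{x \<in> space M. (x, g x) \<in> N} \<in> sets M" by (simp add: vimage_def Int_def conj_commute)
    then have "A \<inter> {x \<in> space M. (x, g x) \<in> N} \<in> sets M" using that(1) by blast
    moreover have "A \<inter> {x \<in> space M. (x, g x) \<in> N} = {x \<in> A. (x, g x) \<in> N}"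
      using sets.sets_into_space[OF that(1)] by blast
    ultimately show ?thesis by simp
  qed
  define sec where "sec = (\<lambda>A g. A \<in> sets M \<and> g \<in> measurable M M \<and> (\<forall>x\<in>A. (x, g x) \<in> R))"
  define cov where "cov = (\<lambda>(\<F>::('a \<Rightarrow> 'a) set) A g. AE x in M. x \<in> A \<longrightarrow> (\<exists>f\<in>\<F>. g x = f x))"
  define small where "small = (\<lambda>N B. B \<in> sets M \<and> (\<exists>\<F>. countable \<F> \<and> \<F> \<subseteq> measurable M M \<and>
      (\<forall>A g. sec A g \<and> A \<subseteq> B \<and> (\<forall>x\<in>A. (x, g x) \<in> N) \<longrightarrow> cov \<F> A g)))"
  have sec_sub: "sec A' g" if "sec A g" "A' \<in> sets M" "A' \<subseteq> A" for A A' g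
    using that unfolding sec_def by blast
  \<comment> \<open>Countable families belonging to countably many sets combine into one, so the
    essential union of all sets that are \<open>small\<close> for \<open>N\<close> is again
    \<open>small\<close>, and it is the largest one up to null sets.\<close>
  have "\<exists>B. small N B \<and> (\<forall>B'. small N B' \<longrightarrow> B' - B \<in> null_sets M)" for N
  proof -
    have "{B. small N B} \<subseteq> sets M" unfolding small_def by blast
    then obtain \<B> where \<B>: "countable \<B>" "\<B> \<subseteq> {B. small N B}"
      "\<And>A. A \<in> {B. small N B} \<Longrightarrow> A - \<Union>\<B> \<in> null_sets M"
      using essential_union[OF sf] by metis
    have "\<forall>B\<in>\<B>. \<exists>\<F>. countable \<F> \<and> \<F> \<subseteq> measurable M M \<and>
      (\<forall>A g. sec A g \<and> A \<subseteq> B \<and> (\<forall>x\<in>A. (x, g x) \<in> N) \<longrightarrow> cov \<F> A g)"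
      using \<B>(2) unfolding small_def by blast
    then obtain \<F> where \<F>: "\<And>B. B \<in> \<B> \<Longrightarrow> countable (\<F> B)" "\<And>B. B \<in> \<B> \<Longrightarrow> \<F> B \<subseteq> measurable M M"
      "\<And>B A g. B \<in> \<B> \<Longrightarrow> sec A g \<Longrightarrow> A \<subseteq> B \<Longrightarrow> (\<forall>x\<in>A. (x, g x) \<in> N) \<Longrightarrow> cov (\<F> B) A g"
      by metis
    have \<B>s: "B \<in> sets M" if "B \<in> \<B>" for B using \<B>(2) that unfolding small_def by blast
    have "small N (\<Union>\<B>)"
      unfolding small_def
    proof (intro conjI exI[of _ "\<Union>B\<in>\<B>. \<F> B"] allI impI)
      show "\<Union>\<B> \<in> sets M" using \<B>(1) \<B>s by (intro sets.countable_Union) auto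
      show "countable (\<Union>B\<in>\<B>. \<F> B)" using \<B>(1) \<F>(1) by (intro countable_UN) auto
      show "(\<Union>B\<in>\<B>. \<F> B) \<subseteq> measurable M M" using \<F>(2) by blast
      fix A g assume A: "sec A g \<and> A \<subseteq> \<Union>\<B> \<and> (\<forall>x\<in>A. (x, g x) \<in> N)"
      have "AE x in M. \<forall>B\<in>\<B>. x \<in> A \<inter> B \<longrightarrow> (\<exists>f\<in>\<F> B. g x = f x)"
      proof (rule AE_ball_countable'[OF _ \<B>(1)])
        fix B assume B: "B \<in> \<B>"
        have "A \<in> sets M" using conjunct1[OF A] unfolding sec_def by (rule conjunct1)
        then have "sec (A \<inter> B) g"
          using sec_sub[OF conjunct1[OF A] sets.Int[OF _ \<B>s[OF B]] Int_lower1] by blast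
        then have "cov (\<F> B) (A \<inter> B) g" using \<F>(3)[OF B] A by blast
        then show "AE x in M. x \<in> A \<inter> B \<longrightarrow> (\<exists>f\<in>\<F> B. g x = f x)" unfolding cov_def .
      qed
      then show "cov (\<Union>B\<in>\<B>. \<F> B) A g"
        unfolding cov_def
      proof eventually_elim
        case (elim x)
        show ?case
        proof
          assume x: "x \<in> A"
          then obtain B where "B \<in> \<B>" "x \<in> B" using A by (meson UnionE subsetD)
          with elim x show "\<exists>f\<in>\<Union>B\<in>\<B>. \<F> B. g x = f x" by (metis IntI UN_I)
        qed
      qed
    qed
    with \<B>(3) show ?thesis by blast
  qed
  then obtain B where B: "\<And>N. small N (B N)" "\<And>N B'. small N B' \<Longrightarrow> B' - B N \<in> null_sets M"
    by metis
  have Bs: "B N \<in> sets M" for N using B(1) unfolding small_def by blast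
  have "\<forall>N. \<exists>\<F>. countable \<F> \<and> \<F> \<subseteq> measurable M M \<and>
      (\<forall>A g. sec A g \<and> A \<subseteq> B N \<and> (\<forall>x\<in>A. (x, g x) \<in> N) \<longrightarrow> cov \<F> A g)"
    using B(1) unfolding small_def by blast
  then obtain \<F> where \<F>: "\<And>N. countable (\<F> N)" "\<And>N. \<F> N \<subseteq> measurable M M"
      "\<And>N A g. sec A g \<Longrightarrow> A \<subseteq> B N \<Longrightarrow> (\<forall>x\<in>A. (x, g x) \<in> N) \<Longrightarrow> cov (\<F> N) A g"
    by metis
  define \<G> where "\<G> = (\<Union>N\<in>\<N>. \<F> N)"
  have \<G>: "countable \<G>" "\<G> \<subseteq> measurable M M"
    unfolding \<G>_def using \<N>(1) \<F> by auto
  \<comment> \<open>What the maximal sets leave over. Where the graph of a section runs outside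
    \<open>P\<close>, \<open>\<G>\<close> already covers it, so it remains to see that a section
    with graph inside \<open>P\<close> has null domain.\<close>
  define P where "P = ?\<Omega> - (\<Union>N\<in>\<N>. N \<inter> (B N \<times> space M))"
  have P: "P \<in> sets (M \<Otimes>\<^sub>M M)"
  proof -
    have "N \<inter> (B N \<times> space M) \<in> sets (M \<Otimes>\<^sub>M M)" if "N \<in> \<N>" for N
      using \<N>(2) that Bs by (intro sets.Int) auto
    then have "(\<Union>N\<in>\<N>. N \<inter> (B N \<times> space M)) \<in> sets (M \<Otimes>\<^sub>M M)"
      using \<N>(1) by (intro sets.countable_UN') auto
    then show ?thesis unfolding P_def using sets.compl_sets[of _ "M \<Otimes>\<^sub>M M"]
      by (simp add: space_pair_measure)
  qed
  have outside: "AE x in M. x \<in> A \<longrightarrow> (x, g x) \<notin> P \<longrightarrow> (\<exists>f\<in>\<G>. g x = f x)" if s: "sec A g" for A g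
  proof -
    have Ag: "A \<in> sets M" "g \<in> measurable M M" using s unfolding sec_def by auto
    have "AE x in M. \<forall>N\<in>\<N>. x \<in> A \<inter> B N \<and> (x, g x) \<in> N \<longrightarrow> (\<exists>f\<in>\<F> N. g x = f x)"
    proof (rule AE_ball_countable'[OF _ \<N>(1)])
      fix N assume N: "N \<in> \<N>"
      have "{x \<in> A \<inter> B N. (x, g x) \<in> N} \<in> sets M"
        by (rule graph_meas) (use Ag Bs \<N>(2) N in auto)
      then have "sec {x \<in> A \<inter> B N. (x, g x) \<in> N} g" by (intro sec_sub[OF s]) auto
      then have "cov (\<F> N) {x \<in> A \<inter> B N. (x, g x) \<in> N} g" by (intro \<F>(3)) auto
      then show "AE x in M. x \<in> A \<inter> B N \<and> (x, g x) \<in> N \<longrightarrow> (\<exists>f\<in>\<F> N. g x = f x)"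
        unfolding cov_def by eventually_elim auto
    qed
    then show ?thesis using AE_space
    proof eventually_elim
      case (elim x)
      have "(x, g x) \<in> ?\<Omega>" using elim(2) Ag(2) by (auto dest: measurable_space)
      then show ?case using elim(1) unfolding P_def \<G>_def by blast
    qed
  qed
  define sec' where "sec' = (\<lambda>A g. sec A g \<and> (\<forall>x\<in>A. (x, g x) \<in> P))"
  have null: "A0 \<in> null_sets M" if A0: "sec' A0 g0" for A0 g0
  proof -
    define hit where "hit = (\<lambda>N (A::'a set, g::'a \<Rightarrow> 'a). {x \<in> A. (x, g x) \<in> N})"
    have hit_meas: "hit N (A, g) \<in> sets M" if "sec' A g" "N \<in> \<N>" for N A g
      unfolding hit_def using that \<N>(2) by (auto simp: sec'_def sec_def intro!: graph_meas)
    have "\<exists>\<S>. countable \<S> \<and> \<S> \<subseteq> {(A, g). sec' A g} \<and>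
        (\<forall>A g. sec' A g \<longrightarrow> hit N (A, g) - \<Union>(hit N ` \<S>) \<in> null_sets M)" if N: "N \<in> \<N>" for N
    proof -
      have "hit N ` {(A, g). sec' A g} \<subseteq> sets M" using hit_meas N by auto
      then obtain \<B> where \<B>: "countable \<B>" "\<B> \<subseteq> hit N ` {(A, g). sec' A g}"
        "\<And>A. A \<in> hit N ` {(A, g). sec' A g} \<Longrightarrow> A - \<Union>\<B> \<in> null_sets M"
        using essential_union[OF sf] by metis
      then obtain \<S> where "countable \<S>" "\<S> \<subseteq> {(A, g). sec' A g}" "\<B> = hit N ` \<S>"
        by (metis countable_subset_image)
      with \<B>(3) show ?thesis by (intro exI[of _ \<S>]) blast
    qed
    then obtain \<S>' where \<S>': "\<And>N. N \<in> \<N> \<Longrightarrow> countable (\<S>' N)"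
      "\<And>N. N \<in> \<N> \<Longrightarrow> \<S>' N \<subseteq> {(A, g). sec' A g}"
      "\<And>N A g. N \<in> \<N> \<Longrightarrow> sec' A g \<Longrightarrow> hit N (A, g) - \<Union>(hit N ` \<S>' N) \<in> null_sets M"
      by metis
    \<comment> \<open>Countably many sections that witness all others: where a section inside
      \<open>P\<close> passes through a member of \<open>\<N>\<close>, almost everywhere some
      section in \<open>\<S>\<close> passes through it too. The pair \<open>(A0, g0)\<close> is
      included so that there is a value over every point of \<open>A0\<close>.\<close>
    define \<S> where "\<S> = insert (A0, g0) (\<Union>N\<in>\<N>. \<S>' N)"
    have \<S>: "countable \<S>" "\<S> \<subseteq> {(A, g). sec' A g}"
      unfolding \<S>_def using \<S>'(1,2) \<N>(1) A0 by auto
    have near: "AE x in M. x \<in> A \<longrightarrow> (\<forall>N\<in>\<N>. (x, g x) \<in> N \<longrightarrow> (\<exists>(A', g')\<in>\<S>. x \<in> A' \<and> (x, g' x) \<in> N))"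
      if s: "sec' A g" for A g
    proof -
      have "AE x in M. \<forall>N\<in>\<N>. x \<notin> hit N (A, g) - \<Union>(hit N ` \<S>' N)"
        by (rule AE_ball_countable'[OF _ \<N>(1)], rule AE_not_in, rule \<S>'(3)[OF _ s])
      then show ?thesis
        by eventually_elim (fastforce simp: hit_def \<S>_def)
    qed
    \<comment> \<open>The points at which \<open>N\<close> isolates the value of \<open>g\<close>
      among the values of the sections in \<open>\<S>\<close>; countability of \<open>\<S>\<close>
      makes this set measurable.\<close>
    define I where "I = (\<lambda>N (A, g). {x \<in> A0 \<inter> A. (x, g x) \<in> N \<and>
      (\<forall>(A', g')\<in>\<S>. x \<in> A' \<and> (x, g' x) \<in> N \<longrightarrow> g' x = g x)})"
    have S_sec: "A' \<in> sets M" "g' \<in> measurable M M" "\<And>x. x \<in> A' \<Longrightarrow> (x, g' x) \<in> R"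
      "\<And>x. x \<in> A' \<Longrightarrow> (x, g' x) \<in> P"
      if "(A', g') \<in> \<S>" for A' g' using that \<S>(2) unfolding sec'_def sec_def by blast+
    have A0s: "A0 \<in> sets M" using A0 unfolding sec'_def sec_def by blast
    have I_meas: "I N (A, g) \<in> sets M" if N: "N \<in> \<N>" and Ag: "(A, g) \<in> \<S>" for N A g
    proof -
      have "{x \<in> A'. (x, g' x) \<in> N} - {x \<in> space M. g' x = g x} \<in> sets M"
        if "(A', g') \<in> \<S>" for A' g'
        using that N \<N>(2) S_sec[OF that] S_sec[OF Ag] graph_meas
          sets_Collect_eq_standard_borel[OF std]
        by (intro sets.Diff) auto
      then have "(\<Union>(A', g')\<in>\<S>. {x \<in> A'. (x, g' x) \<in> N} - {x \<in> space M. g' x = g x}) \<in> sets M"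
        using \<S>(1) by (intro sets.countable_UN') auto
      then have "{x \<in> A0 \<inter> A. (x, g x) \<in> N} - (\<Union>(A', g')\<in>\<S>. {x \<in> A'. (x, g' x) \<in> N} - {x \<in> space M. g' x = g x}) \<in> sets M"
        using graph_meas[of "A0 \<inter> A" g N] A0s S_sec[OF Ag] N \<N>(2) by (intro sets.Diff) auto
      moreover have "{x \<in> A0 \<inter> A. (x, g x) \<in> N} - (\<Union>(A', g')\<in>\<S>. {x \<in> A'. (x, g' x) \<in> N} - {x \<in> space M. g' x = g x}) = I N (A, g)"
        unfolding I_def using sets.sets_into_space[OF A0s] by auto
      ultimately show ?thesis by simp
    qed
    have I_null: "I N (A, g) \<in> null_sets M" if N: "N \<in> \<N>" and Ag: "(A, g) \<in> \<S>" for N A g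
    proof -
      \<comment> \<open>A section through \<open>N\<close> over this set either leaves
        \<open>P\<close>, where \<open>\<G>\<close> covers it, or agrees with \<open>g\<close>:
        otherwise some \<open>N'\<close> separates the two values, and a section in
        \<open>\<S>\<close> passing through \<open>N \<inter> N'\<close> contradicts isolation. By
        maximality the set is contained in \<open>B N\<close> up to a null set, but inside
        \<open>P\<close> nothing over \<open>B N\<close> meets \<open>N\<close>.\<close>
      have "small N (I N (A, g))"
        unfolding small_def
      proof (intro conjI exI[of _ "insert g \<G>"] allI impI I_meas[OF N Ag])
        show "countable (insert g \<G>)" "insert g \<G> \<subseteq> measurable M M" using \<G> S_sec[OF Ag] by auto
        fix A1 g1 assume A1: "sec A1 g1 \<and> A1 \<subseteq> I N (A, g) \<and> (\<forall>x\<in>A1. (x, g1 x) \<in> N)"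
        have g1: "g1 \<in> measurable M M" using A1 unfolding sec_def by blast
        have "{x \<in> A1. (x, g1 x) \<in> P} \<in> sets M" using A1 P unfolding sec_def
          by (intro graph_meas) auto
        then have "sec' {x \<in> A1. (x, g1 x) \<in> P} g1"
          unfolding sec'_def using A1 by (auto intro: sec_sub)
        from near[OF this] outside[OF A1[THEN conjunct1]] AE_space
        show "cov (insert g \<G>) A1 g1"
          unfolding cov_def
        proof eventually_elim
          case (elim x)
          show ?case
          proof (intro impI)
            assume x: "x \<in> A1"
            show "\<exists>f\<in>insert g \<G>. g1 x = f x"
            proof (cases "(x, g1 x) \<in> P")
              case False then show ?thesis using elim(2) x by blast
            next
              case True
              have "g1 x = g x"
              proof (rule ccontr)
                assume neq: "g1 x \<noteq> g x"
                have "(x, g1 x) \<in> ?\<Omega>" "(x, g x) \<in> ?\<Omega>"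
                  using elim(3) g1 S_sec(2)[OF Ag] by (auto dest: measurable_space)
                then obtain N' where N': "N' \<in> \<N>" "(x, g1 x) \<in> N'" "(x, g x) \<notin> N'"
                  using \<N>_sep neq by blast
                have "N \<inter> N' \<in> \<N>" "(x, g1 x) \<in> N \<inter> N'" using \<N>_Int N N' A1 x by auto
                then obtain A' g' where "(A', g') \<in> \<S>" "x \<in> A'" "(x, g' x) \<in> N \<inter> N'"
                  using elim(1) x True by blast
                moreover have "x \<in> I N (A, g)" using A1 x by blast
                ultimately have "g' x = g x" "(x, g' x) \<in> N'" unfolding I_def by auto
                then show False using N' by simp
              qed
              then show ?thesis by blast
            qed
          qed
        qed
      qed
      then have "I N (A, g) - B N \<in> null_sets M" by (rule B(2))
      moreover have "I N (A, g) \<inter> B N = {}"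
      proof -
        have False if "x \<in> I N (A, g)" "x \<in> B N" for x
        proof -
          have "x \<in> A" "(x, g x) \<in> N" using that(1) unfolding I_def by auto
          then have "(x, g x) \<in> P" using S_sec(4)[OF Ag] by blast
          then show False using \<open>(x, g x) \<in> N\<close> that(2) N unfolding P_def by blast
        qed
        then show ?thesis by blast
      qed
      ultimately show ?thesis by (simp add: Diff_triv)
    qed
    have "(\<Union>(N, s)\<in>\<N> \<times> \<S>. I N s) \<in> null_sets M"
      by (rule null_sets_UN') (use \<N>(1) \<S>(1) I_null in auto)
    \<comment> \<open>The value of \<open>g0\<close> shows that \<open>D\<close> is nonempty, so
      every point of \<open>A0\<close> has some isolated value and \<open>A0\<close> is covered by
      countably many null sets.\<close>
    moreover have "A0 \<subseteq> (\<Union>(N, s)\<in>\<N> \<times> \<S>. I N s)"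
    proof
      fix x assume x: "x \<in> A0"
      then have xs: "x \<in> space M" using sets.sets_into_space[OF A0s] by blast
      define D where "D = {y. \<exists>(A, g)\<in>\<S>. x \<in> A \<and> y = g x}"
      have "D \<subseteq> R `` {x}" unfolding D_def using S_sec(3) by auto
      moreover have "g0 x \<in> D" unfolding D_def \<S>_def using x by auto
      ultimately obtain N y where N: "N \<in> \<N>" "{y \<in> D. (x, y) \<in> N} = {y}"
        using \<N>_iso[OF xs cnt[OF xs], of D] by blast
      then have "y \<in> D" "(x, y) \<in> N" by auto
      then obtain A g where Ag: "(A, g) \<in> \<S>" "x \<in> A" "y = g x" unfolding D_def by blast
      have iso: "g' x = g x" if "(A', g') \<in> \<S>" "x \<in> A'" "(x, g' x) \<in> N" for A' g'
      proof -
        have "g' x \<in> {y \<in> D. (x, y) \<in> N}" using that unfolding D_def by auto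
        then show ?thesis using N(2) Ag(3) by blast
      qed
      have "\<forall>(A', g')\<in>\<S>. x \<in> A' \<and> (x, g' x) \<in> N \<longrightarrow> g' x = g x"
        by (intro ballI) (use iso in \<open>auto split: prod.split\<close>)
      then have "x \<in> I N (A, g)" unfolding I_def using x Ag \<open>(x, y) \<in> N\<close> by simp
      with N(1) Ag(1) show "x \<in> (\<Union>(N, s)\<in>\<N> \<times> \<S>. I N s)" by blast
    qed
    ultimately show ?thesis using A0s by (meson null_sets_subset)
  qed
  show thesis
  proof (rule that[OF \<G>])
    fix A g assume Ag: "A \<in> sets M" "g \<in> measurable M M" "\<forall>x\<in>A. (x, g x) \<in> R"
    then have s: "sec A g" unfolding sec_def by blast
    have m: "{x \<in> A. (x, g x) \<in> P} \<in> sets M" by (rule graph_meas) (use Ag P in auto)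
    have "sec' {x \<in> A. (x, g x) \<in> P} g"
      unfolding sec'_def using sec_sub[OF s m] by auto
    then have "AE x in M. x \<notin> {x \<in> A. (x, g x) \<in> P}" by (intro AE_not_in null)
    then show "AE x in M. x \<in> A \<longrightarrow> (\<exists>f\<in>\<G>. g x = f x)"
      using outside[OF s] by eventually_elim blast
  qed
qed

section \<open>Pasting measure-preserving bijections\<close>

abbreviation mpb :: "'a measure \<Rightarrow> ('a \<Rightarrow> 'a) set" where
  "mpb \<equiv> measure_preserving_bijections"

definition mpb_inverse :: "'a measure \<Rightarrow> ('a \<Rightarrow> 'a) \<Rightarrow> 'a \<Rightarrow> 'a" where
  "mpb_inverse M T = (\<lambda>x\<in>space M. inv_into (space M) T x)"

lemma mpbD:
  assumes "T \<in> mpb M"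
  shows "bij_betw T (space M) (space M)" "T \<in> extensional (space M)" "T \<in> measurable M M"
    "\<And>A. A \<in> sets M \<Longrightarrow> emeasure M (T ` A) = emeasure M A"
    "\<And>A. A \<in> sets M \<Longrightarrow> emeasure M (T -` A \<inter> space M) = emeasure M A"
    "inj_on T (space M)"
  using assms by (auto simp: measure_preserving_bijections_def Bij_def bij_betw_def)

lemma mpb_eqI: "S \<in> mpb M \<Longrightarrow> T \<in> mpb M \<Longrightarrow> (\<And>x. x \<in> space M \<Longrightarrow> S x = T x) \<Longrightarrow> S = T"
  using mpbD(2) by (metis extensionalityI)

lemma mpb_inverse_mpb: "T \<in> mpb M \<Longrightarrow> mpb_inverse M T \<in> mpb M"
  unfolding mpb_inverse_def by (rule mpb_inv)

lemma mpb_inverse_left: "T \<in> mpb M \<Longrightarrow> x \<in> space M \<Longrightarrow> mpb_inverse M T (T x) = x"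
  unfolding mpb_inverse_def using mpbD(1) mpb_in_space
  by (metis bij_betw_inv_into_left restrict_apply)

lemma mpb_inverse_right: "T \<in> mpb M \<Longrightarrow> x \<in> space M \<Longrightarrow> T (mpb_inverse M T x) = x"
  unfolding mpb_inverse_def using mpbD(1) by (metis bij_betw_inv_into_right restrict_apply)

lemma mpb_inverse_in_space: "T \<in> mpb M \<Longrightarrow> x \<in> space M \<Longrightarrow> mpb_inverse M T x \<in> space M"
  using mpb_inverse_mpb mpb_in_space by metis

lemma mpb_compose_apply [simp]: "x \<in> space M \<Longrightarrow> compose (space M) S T x = S (T x)"
  by (simp add: compose_def)

lemma mpb_null_image: "T \<in> mpb M \<Longrightarrow> N \<in> null_sets M \<Longrightarrow> T ` N \<in> null_sets M"
  using mpbD(4)[of T M N] mpb_image_sets[of T M N] by (auto simp: null_sets_def)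

text \<open>Bijectivity is a hypothesis because the images of the pieces might overlap otherwise.
  Given it, the images of the blocks are disjoint and countable additivity transfers the measure; a
  preimage is measured by mapping it forward again.\<close>

lemma mpb_paste_disjoint:
  fixes A :: "nat \<Rightarrow> 'a set"
  assumes T: "T \<in> Bij (space M)" and A: "range A \<subseteq> sets M" "disjoint_family A" "(\<Union>n. A n) = space M"
    and S: "\<And>n. S n \<in> mpb M" and eq: "\<And>n x. x \<in> A n \<Longrightarrow> T x = S n x"
  shows "T \<in> mpb M"
proof -
  have bT: "bij_betw T (space M) (space M)" using T by (simp add: Bij_def)
  have As: "A n \<in> sets M" "A n \<subseteq> space M" for n using A by auto
  have image: "T ` B = (\<Union>n. S n ` (A n \<inter> B))" if "B \<subseteq> space M" for B
  proof -
    have "T ` B = (\<Union>n. T ` (A n \<inter> B))" using A(3) that by blast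
    also have "\<dots> = (\<Union>n. S n ` (A n \<inter> B))" using eq by (intro SUP_cong image_cong) auto
    finally show ?thesis .
  qed
  have piece: "S n ` (A n \<inter> B) \<in> sets M" "emeasure M (S n ` (A n \<inter> B)) = emeasure M (A n \<inter> B)"
    if "B \<in> sets M" for B n using mpb_image_sets[OF S] mpbD(4)[OF S] As that by auto
  have img: "T ` B \<in> sets M" "emeasure M (T ` B) = emeasure M B" if B: "B \<in> sets M" for B
  proof -
    note BM = sets.sets_into_space[OF B]
    show "T ` B \<in> sets M" unfolding image[OF BM] using piece[OF B] by auto
    have "disjoint_family (\<lambda>n. S n ` (A n \<inter> B))"
    proof (unfold disjoint_family_on_def, intro ballI impI)
      fix m n :: nat assume "m \<noteq> n"
      then have "A m \<inter> A n = {}" using A(2) by (auto simp: disjoint_family_on_def)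
      then have "(A m \<inter> B) \<inter> (A n \<inter> B) = {}" by blast
      moreover have "inj_on T (space M)" using bT by (rule bij_betw_imp_inj_on)
      ultimately have "T ` (A m \<inter> B) \<inter> T ` (A n \<inter> B) = {}"
        using inj_on_image_Int[of T "space M" "A m \<inter> B" "A n \<inter> B"] BM by auto
      moreover have "T ` (A k \<inter> B) = S k ` (A k \<inter> B)" for k
        using eq[of _ k] by (intro image_cong) auto
      ultimately show "S m ` (A m \<inter> B) \<inter> S n ` (A n \<inter> B) = {}" by simp
    qed
    then have "emeasure M (T ` B) = (\<Sum>n. emeasure M (S n ` (A n \<inter> B)))"
      unfolding image[OF BM] using piece[OF B] by (intro suminf_emeasure[symmetric]) auto
    also have "\<dots> = (\<Sum>n. emeasure M (A n \<inter> B))" using piece[OF B] by simp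
    also have "\<dots> = emeasure M (\<Union>n. A n \<inter> B)"
    proof (intro suminf_emeasure)
      show "disjoint_family (\<lambda>n. A n \<inter> B)" using A(2) unfolding disjoint_family_on_def by blast
    qed (use As B in auto)
    also have "(\<Union>n. A n \<inter> B) = B" using A(3) BM by auto
    finally show "emeasure M (T ` B) = emeasure M B" .
  qed
  have pre: "T -` B \<inter> space M \<in> sets M" if B: "B \<in> sets M" for B
  proof -
    have "T -` B \<inter> space M = (\<Union>n. A n \<inter> (S n -` B \<inter> space M))"
    proof (intro equalityI subsetI)
      fix x assume x: "x \<in> T -` B \<inter> space M"
      then obtain n where n: "x \<in> A n" using A(3) by blast
      then show "x \<in> (\<Union>n. A n \<inter> (S n -` B \<inter> space M))" using x eq[OF n] by auto
    next
      fix x assume "x \<in> (\<Union>n. A n \<inter> (S n -` B \<inter> space M))"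
      then obtain n where n: "x \<in> A n" "S n x \<in> B" "x \<in> space M" by blast
      then show "x \<in> T -` B \<inter> space M" using eq[OF n(1)] by simp
    qed
    also have "\<dots> \<in> sets M" using As measurable_sets[OF mpbD(3)[OF S] B] by auto
    finally show ?thesis .
  qed
  have "emeasure M (T -` B \<inter> space M) = emeasure M B" if B: "B \<in> sets M" for B
  proof -
    have "B \<subseteq> T ` space M" using bij_betw_imp_surj_on[OF bT] sets.sets_into_space[OF B] by simp
    then have "T ` (T -` B \<inter> space M) = B" by blast
    then show ?thesis using img(2)[OF pre[OF B]] by simp
  qed
  moreover have "T \<in> measurable M M"
    using pre bT by (intro measurableI) (auto simp: bij_betw_def)
  moreover have "inv_into (space M) T \<in> measurable M M"
  proof (rule measurableI)
    show "inv_into (space M) T x \<in> space M" if "x \<in> space M" for x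
      using that bT by (metis bij_betw_def inv_into_into)
    show "inv_into (space M) T -` B \<inter> space M \<in> sets M" if B: "B \<in> sets M" for B
    proof -
      have "inv_into (space M) T -` B \<inter> space M = (\<lambda>x\<in>space M. inv_into (space M) T x) -` B \<inter> space M"
        by auto
      then show ?thesis using mpb_inv_image(2)[OF T sets.sets_into_space[OF B]] img(1)[OF B] by simp
    qed
  qed
  ultimately show ?thesis
    using T img(2) by (simp add: measure_preserving_bijections_def)
qed

lemma mpb_paste:
  assumes T: "T \<in> Bij (space M)" and P: "countable P" "space M \<subseteq> \<Union>(fst ` P)"
    and AS: "\<And>A S. (A, S) \<in> P \<Longrightarrow> A \<in> sets M" "\<And>A S. (A, S) \<in> P \<Longrightarrow> S \<in> mpb M"
    and eq: "\<And>A S x. (A, S) \<in> P \<Longrightarrow> x \<in> A \<Longrightarrow> T x = S x"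
  shows "T \<in> mpb M"
proof -
  let ?P = "insert ({}, \<lambda>x\<in>space M. x) P"
  define p where "p = from_nat_into ?P"
  have ran: "range p = ?P" unfolding p_def using P(1) by (intro range_from_nat_into) auto
  have p: "p n \<in> ?P" for n using ran by blast
  have ps: "fst (p n) \<in> sets M" "snd (p n) \<in> mpb M" "\<And>x. x \<in> fst (p n) \<Longrightarrow> T x = snd (p n) x" for n
    using p[of n] AS eq mpb_id by (cases "p n"; auto)+
  have cov: "(\<Union>n. fst (p n)) = space M"
  proof
    show "(\<Union>n. fst (p n)) \<subseteq> space M" using ps(1) sets.sets_into_space by blast
    have "(\<Union>n. fst (p n)) = \<Union>(fst ` range p)" by auto
    then show "space M \<subseteq> (\<Union>n. fst (p n))" using P(2) unfolding ran by auto
  qed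
  show ?thesis
  proof (rule mpb_paste_disjoint[OF T])
    show "range (disjointed (\<lambda>n. fst (p n))) \<subseteq> sets M"
      using ps(1) by (intro sets.range_disjointed_sets) auto
    show "disjoint_family (disjointed (\<lambda>n. fst (p n)))" by (rule disjoint_family_disjointed)
    show "(\<Union>n. disjointed (\<lambda>n. fst (p n)) n) = space M" using cov by (simp add: UN_disjointed_eq)
    show "snd (p n) \<in> mpb M" for n by (rule ps)
    show "T x = snd (p n) x" if "x \<in> disjointed (\<lambda>n. fst (p n)) n" for n x
      by (rule ps(3)) (use disjointed_subset[of "\<lambda>n. fst (p n)" n] that in blast)
  qed
qed

text \<open>Extends a partial injection with disjoint domain and range to an involution of the whole
  space, so that no choice of extension of \<open>f\<close> is required.\<close>

definition swap_along :: "'a measure \<Rightarrow> 'a set \<Rightarrow> ('a \<Rightarrow> 'a) \<Rightarrow> 'a \<Rightarrow> 'a" where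
  "swap_along M C f =
     (\<lambda>x\<in>space M. if x \<in> C then f x else if x \<in> f ` C then inv_into C f x else x)"

lemma swap_along_simps:
  assumes "inj_on f C" "C \<subseteq> space M" "f ` C \<subseteq> space M" "f ` C \<inter> C = {}"
  shows "x \<in> C \<Longrightarrow> swap_along M C f x = f x" "x \<in> C \<Longrightarrow> swap_along M C f (f x) = x"
    "x \<in> space M \<Longrightarrow> x \<notin> C \<Longrightarrow> x \<notin> f ` C \<Longrightarrow> swap_along M C f x = x"
    "x \<in> space M \<Longrightarrow> swap_along M C f (swap_along M C f x) = x"
    "x \<in> space M \<Longrightarrow> swap_along M C f x \<in> space M"
proof -
  show 1: "x \<in> C \<Longrightarrow> swap_along M C f x = f x" for x using assms unfolding swap_along_def by auto
  show 2: "x \<in> C \<Longrightarrow> swap_along M C f (f x) = x" for x using assms unfolding swap_along_def by auto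
  show 3: "x \<in> space M \<Longrightarrow> x \<notin> C \<Longrightarrow> x \<notin> f ` C \<Longrightarrow> swap_along M C f x = x" for x
    unfolding swap_along_def by auto
  show "x \<in> space M \<Longrightarrow> swap_along M C f (swap_along M C f x) = x"
    using 1 2 3 by (cases "x \<in> C"; cases "x \<in> f ` C"; auto)
  show "x \<in> space M \<Longrightarrow> swap_along M C f x \<in> space M"
    using 1 2 3 assms by (cases "x \<in> C"; cases "x \<in> f ` C"; auto)
qed

lemma swap_along_Bij:
  assumes "inj_on f C" "C \<subseteq> space M" "f ` C \<subseteq> space M" "f ` C \<inter> C = {}"
  shows "swap_along M C f \<in> Bij (space M)"
  unfolding Bij_def
proof
  show "swap_along M C f \<in> extensional (space M)" unfolding swap_along_def by simp
  have "bij_betw (swap_along M C f) (space M) (space M)"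
    by (rule bij_betw_byWitness[where f' = "swap_along M C f"])
      (use swap_along_simps(4,5)[OF assms] in auto)
  then show "swap_along M C f \<in> {f. bij_betw f (space M) (space M)}" by simp
qed

section \<open>The full group as a group of bijections\<close>

locale measure_full_group =
  fixes M :: "'a measure" and G :: "('a \<Rightarrow> 'a) set set"
  assumes space_std: "standard_sigma_finite_space M" and full: "full_group M G"
begin

lemma std: "standard_borel M" and sf: "sigma_finite_measure M" and atomless: "atomless M"
  and infinite: "emeasure M (space M) = \<infinity>"
  using space_std unfolding standard_sigma_finite_space_def by auto

sublocale sigma_finite_measure M by (rule sf)

text \<open>The union of the classes in \<open>G\<close>. Pointwise arguments take place here, and
  classes return only for statements on the group itself.\<close>

definition H :: "('a \<Rightarrow> 'a) set" where "H = {T \<in> mpb M. aut_class M T \<in> G}"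

lemma H_mpb: "T \<in> H \<Longrightarrow> T \<in> mpb M" unfolding H_def by simp

lemma subgroup_G: "subgroup G (Aut M)" using full unfolding full_group_def by blast

lemma G_eq: "G = aut_class M ` H"
  using subgroup.subset[OF subgroup_G] unfolding H_def Aut_def by auto

lemma H_id: "(\<lambda>x\<in>space M. x) \<in> H"
  using subgroup.one_closed[OF subgroup_G] mpb_id unfolding H_def by (simp add: Aut_def)

lemma H_compose: "S \<in> H \<Longrightarrow> T \<in> H \<Longrightarrow> compose (space M) S T \<in> H"
  using subgroup.m_closed[OF subgroup_G, of "aut_class M S" "aut_class M T"]
    mpb_compose[of S M T] aut_class_mult[of S M T] unfolding H_def by auto

lemma aut_class_inverse: "T \<in> mpb M \<Longrightarrow> inv\<^bsub>Aut M\<^esub> (aut_class M T) = aut_class M (mpb_inverse M T)"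
proof (rule group.inv_equality[OF group_Aut])
  assume T: "T \<in> mpb M"
  note I = mpb_inverse_mpb[OF T]
  have "compose (space M) (mpb_inverse M T) T = (\<lambda>x\<in>space M. x)"
    by (rule mpb_eqI) (use mpb_compose[OF I T] mpb_id mpb_inverse_left[OF T] in auto)
  then show "aut_class M (mpb_inverse M T) \<otimes>\<^bsub>Aut M\<^esub> aut_class M T = \<one>\<^bsub>Aut M\<^esub>"
    by (subst aut_class_mult[OF I T]) (simp add: Aut_def)
qed (auto simp: Aut_def mpb_inverse_mpb)

lemma H_inverse: "T \<in> H \<Longrightarrow> mpb_inverse M T \<in> H"
  using subgroup.m_inv_closed[OF subgroup_G] aut_class_inverse mpb_inverse_mpb
  unfolding H_def by fastforce

text \<open>Cutting and pasting without an explicit partition: the sets where \<open>T\<close>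
  agrees with the members of \<open>F\<close> are measurable and are made disjoint.\<close>

lemma H_countable:
  assumes T: "T \<in> mpb M" and F: "countable F" "F \<subseteq> H" and eq: "AE x in M. \<exists>S\<in>F. T x = S x"
  shows "T \<in> H"
proof -
  let ?F = "insert (\<lambda>x\<in>space M. x) F"
  define s where "s = from_nat_into ?F"
  have ran: "range s = ?F" unfolding s_def using F(1) by (intro range_from_nat_into) auto
  have s: "s n \<in> H" for n
  proof -
    have "s n \<in> ?F" using ran by (metis rangeI)
    then show ?thesis using F(2) H_id by auto
  qed
  define E where "E = (\<lambda>n. {x \<in> space M. T x = s n x})"
  have E: "E n \<in> sets M" for n
    unfolding E_def by (intro sets_Collect_eq_standard_borel[OF std] mpbD T H_mpb s)
  define N where "N = space M - (\<Union>n. E n)"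
  have N: "N \<in> sets M" unfolding N_def using E by auto
  have "AE x in M. x \<notin> N"
    using eq by eventually_elim (use ran in \<open>auto simp: N_def E_def, metis insertCI rangeE\<close>)
  then have N0: "N \<in> null_sets M" using N AE_iff_null_sets by blast
  \<comment> \<open>The null set left over joins the block of index 0, because the partition has to
    be exact while agreement on the blocks is required only almost everywhere.\<close>
  define A where "A = (\<lambda>n. disjointed E n \<union> (if n = 0 then N else {}))"
  have dE: "disjointed E n \<in> sets M" for n using sets.range_disjointed_sets[of E M] E by auto
  have dU: "(\<Union>n. disjointed E n) = (\<Union>n. E n)" by (rule UN_disjointed_eq)
  have dN: "disjointed E n \<inter> N = {}" for n using dU unfolding N_def by blast
  have "aut_class M T \<in> G"
  proof (rule full[unfolded full_group_def, THEN conjunct2, rule_format, OF T, of A s],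
    intro conjI allI)
    show "range A \<subseteq> sets M" unfolding A_def using dE N E by auto
    show "disjoint_family A"
    proof (unfold disjoint_family_on_def, intro ballI impI)
      fix m n :: nat assume "m \<noteq> n"
      then have "disjointed E m \<inter> disjointed E n = {}"
        using disjoint_family_disjointed[of E] unfolding disjoint_family_on_def by blast
      then show "A m \<inter> A n = {}"
        unfolding A_def using dN[of m] dN[of n] \<open>m \<noteq> n\<close> by (auto simp del: disjointed_0)
    qed
    have "(\<Union>n. A n) = (\<Union>n. disjointed E n) \<union> N" unfolding A_def by (auto split: if_splits)
    then show "(\<Union>n. A n) = space M" unfolding dU N_def using sets.sets_into_space[OF E] by auto
    show "s n \<in> mpb M" "aut_class M (s n) \<in> G" for n using s unfolding H_def by auto
    show "AE x in M. x \<in> A n \<longrightarrow> T x = s n x" for n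
      using \<open>AE x in M. x \<notin> N\<close>
    proof eventually_elim
      case (elim x)
      then show ?case using disjointed_subset[of E n] unfolding A_def E_def
        by (auto split: if_splits)
    qed
  qed
  then show ?thesis using T unfolding H_def by simp
qed

lemma H_paste:
  assumes T: "T \<in> Bij (space M)" and P: "countable P" "space M \<subseteq> \<Union>(fst ` P)"
    and AS: "\<And>A S. (A, S) \<in> P \<Longrightarrow> A \<in> sets M" "\<And>A S. (A, S) \<in> P \<Longrightarrow> S \<in> H"
    and eq: "\<And>A S x. (A, S) \<in> P \<Longrightarrow> x \<in> A \<Longrightarrow> T x = S x"
  shows "T \<in> H"
proof (rule H_countable[of T "snd ` P"])
  show "T \<in> mpb M" by (rule mpb_paste[OF T P]; use AS eq H_mpb in blast)
  show "countable (snd ` P)" "snd ` P \<subseteq> H" using P AS by auto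
  show "AE x in M. \<exists>S\<in>snd ` P. T x = S x"
    using AE_space
  proof eventually_elim
    case (elim x)
    then obtain A S where "(A, S) \<in> P" "x \<in> A" using P(2) by auto
    then show ?case using eq by force
  qed
qed

lemma H_swap_along:
  assumes inj: "inj_on f C" "f ` C \<inter> C = {}" and P: "countable P" "C = \<Union>(fst ` P)"
    and AS: "\<And>A S. (A, S) \<in> P \<Longrightarrow> A \<in> sets M" "\<And>A S. (A, S) \<in> P \<Longrightarrow> S \<in> H"
    and eq: "\<And>A S x. (A, S) \<in> P \<Longrightarrow> x \<in> A \<Longrightarrow> f x = S x"
  shows "swap_along M C f \<in> H"
proof -
  have Cs: "C \<in> sets M" unfolding P(2) using P(1) AS(1) by (intro sets.countable_Union) auto
  have CM: "C \<subseteq> space M" using sets.sets_into_space[OF Cs] .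
  have fS: "f ` A = S ` A" if "(A, S) \<in> P" for A S using eq[OF that] by auto
  have "f ` C = (\<Union>p\<in>P. f ` fst p)" unfolding P(2) by blast
  also have "\<dots> = (\<Union>(A, S)\<in>P. S ` A)" by (intro SUP_cong refl) (use fS in force)
  finally have "f ` C = (\<Union>(A, S)\<in>P. S ` A)" .
  moreover have SA: "S ` A \<in> sets M" if "(A, S) \<in> P" for A S
    using mpb_image_sets AS H_mpb that by blast
  ultimately have fCs: "f ` C \<in> sets M" using P(1) by (auto intro!: sets.countable_UN')
  have fCM: "f ` C \<subseteq> space M" using sets.sets_into_space[OF fCs] .
  note sw = swap_along_simps[OF inj(1) CM fCM inj(2)]
  \<comment> \<open>On the range of \<open>f\<close> the involution is the inverse of
    \<open>f\<close>, which is pasted from the inverses of the same pieces; elsewhere it is the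
    identity.\<close>
  define Q where "Q = P \<union> (\<lambda>(A, S). (S ` A, mpb_inverse M S)) ` P \<union> {(space M - C - f ` C, \<lambda>x\<in>space M. x)}"
  show ?thesis
  proof (rule H_paste[of _ Q])
    show "swap_along M C f \<in> Bij (space M)" by (rule swap_along_Bij[OF inj(1) CM fCM inj(2)])
    show "countable Q" unfolding Q_def using P(1) by auto
    have "f ` C \<subseteq> \<Union>(fst ` (\<lambda>(A, S). (S ` A, mpb_inverse M S)) ` P)"
      using fS unfolding P(2) by force
    then show "space M \<subseteq> \<Union>(fst ` Q)" unfolding Q_def using P(2) by auto
    fix A S assume "(A, S) \<in> Q"
    then consider "(A, S) \<in> P" | A' S' where "(A', S') \<in> P" "A = S' ` A'" "S = mpb_inverse M S'"
      | "A = space M - C - f ` C" "S = (\<lambda>x\<in>space M. x)" unfolding Q_def by auto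
    note cs = this
    show "A \<in> sets M" using cs by cases (use AS SA Cs fCs in auto)
    show "S \<in> H" using cs by cases (use AS H_inverse H_id in auto)
    show "swap_along M C f x = S x" if x: "x \<in> A" for x
      using cs
    proof cases
      case 1
      then have "x \<in> C" unfolding P(2) using x by force
      then show ?thesis using sw(1) eq[OF 1 x] by simp
    next
      case 2
      then obtain y where y: "y \<in> A'" "x = S' y" using x by blast
      then have yC: "y \<in> C" unfolding P(2) using 2(1) by force
      have "x = f y" using eq[OF 2(1) y(1)] y(2) by simp
      then have "swap_along M C f x = y" using sw(2) yC by simp
      also have "y = mpb_inverse M S' (S' y)"
        using mpb_inverse_left[of S' M y] AS(2)[OF 2(1)] H_mpb yC CM by auto
      finally show ?thesis using 2(3) y(2) by simp
    next
      case 3 then show ?thesis using sw(3) x by auto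
    qed
  qed
qed

lemma countable_subgroup:
  assumes "countable F" "F \<subseteq> H"
  obtains \<Gamma> where "countable \<Gamma>" "F \<subseteq> \<Gamma>" "\<Gamma> \<subseteq> H" "(\<lambda>x\<in>space M. x) \<in> \<Gamma>"
    "\<And>T. T \<in> \<Gamma> \<Longrightarrow> mpb_inverse M T \<in> \<Gamma>" "\<And>S T. S \<in> \<Gamma> \<Longrightarrow> T \<in> \<Gamma> \<Longrightarrow> compose (space M) S T \<in> \<Gamma>"
  using countable_closure[of "insert (\<lambda>x\<in>space M. x) F" H "mpb_inverse M" "compose (space M)"]
    assms H_id H_inverse H_compose by (metis countable_insert insert_subset)

end

section \<open>Exchange involutions from ergodicity\<close>

locale ergodic_full_group = measure_full_group +
  assumes erg: "ergodic M G"
begin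

text \<open>The essential union \<open>E\<close> of all translates of \<open>A\<close> is invariant
  up to null sets and not null, so by ergodicity it is conull. As countably many translates make up
  \<open>E\<close>, one of them meets \<open>B\<close> in a nonnull set.\<close>

lemma ex_meet:
  assumes A: "A \<in> sets M" "A \<notin> null_sets M" and B: "B \<in> sets M" "B \<notin> null_sets M"
  obtains g where "g \<in> H" "g ` A \<inter> B \<notin> null_sets M"
proof -
  have img: "g ` C \<in> sets M" if "g \<in> H" "C \<in> sets M" for g C
    using mpb_image_sets[OF H_mpb] that by blast
  have "(\<lambda>g. g ` A) ` H \<subseteq> sets M" using img A by blast
  then obtain \<B> where \<B>: "countable \<B>" "\<B> \<subseteq> (\<lambda>g. g ` A) ` H"
    "\<And>C. C \<in> (\<lambda>g. g ` A) ` H \<Longrightarrow> C - \<Union>\<B> \<in> null_sets M"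
    using essential_union[OF sf] by metis
  define E where "E = \<Union>\<B>"
  have E: "E \<in> sets M" unfolding E_def using \<B>(1,2) img A by (intro sets.countable_Union) auto
  have gA: "g ` A - E \<in> null_sets M" if "g \<in> H" for g unfolding E_def using \<B>(3) that by blast
  have TE: "T ` E - E \<in> null_sets M" if T: "T \<in> H" for T
  proof -
    have "(\<Union>C\<in>\<B>. T ` C - E) \<in> null_sets M"
    proof (rule null_sets_UN'[OF \<B>(1)])
      fix C assume "C \<in> \<B>"
      then obtain g where g: "g \<in> H" "C = g ` A" using \<B>(2) by blast
      have "T ` C = compose (space M) T g ` A"
        using sets.sets_into_space[OF A(1)] unfolding g(2) by (auto simp: compose_def image_image)
      then show "T ` C - E \<in> null_sets M" using gA[OF H_compose[OF T g(1)]] by simp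
    qed
    moreover have "T ` E - E = (\<Union>C\<in>\<B>. T ` C - E)" unfolding E_def by blast
    ultimately show ?thesis by simp
  qed
  have "E \<in> null_sets M \<or> space M - E \<in> null_sets M"
  proof (rule erg[unfolded ergodic_def, rule_format, OF E])
    fix T assume "T \<in> mpb M" "aut_class M T \<in> G"
    then have T: "T \<in> H" unfolding H_def by simp
    note Tm = H_mpb[OF T]
    \<comment> \<open>\<open>TE\<close> controls one half of the symmetric difference; the other
      half is the image under \<open>T\<close> of the same estimate for the inverse.\<close>
    have "E - T ` E = T ` (mpb_inverse M T ` E - E)"
    proof
      have EM: "E \<subseteq> space M" by (rule sets.sets_into_space[OF E])
      show "E - T ` E \<subseteq> T ` (mpb_inverse M T ` E - E)"
      proof
        fix x assume x: "x \<in> E - T ` E"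
        then have xT: "x = T (mpb_inverse M T x)" using mpb_inverse_right[OF Tm] EM by auto
        then have "mpb_inverse M T x \<notin> E" using x by (metis DiffE imageI)
        then show "x \<in> T ` (mpb_inverse M T ` E - E)" using xT x by blast
      qed
      show "T ` (mpb_inverse M T ` E - E) \<subseteq> E - T ` E"
      proof
        fix y assume "y \<in> T ` (mpb_inverse M T ` E - E)"
        then obtain x where x: "x \<in> E" "mpb_inverse M T x \<notin> E" "y = T (mpb_inverse M T x)" by blast
        have xM: "x \<in> space M" using x EM by blast
        have y: "y = x" using x mpb_inverse_right[OF Tm xM] by simp
        have "y \<notin> T ` E"
        proof
          assume "y \<in> T ` E"
          then obtain z where z: "z \<in> E" "y = T z" by blast
          then have "mpb_inverse M T x = z" using y mpb_inverse_left[OF Tm] EM by auto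
          then show False using z x by simp
        qed
        then show "y \<in> E - T ` E" using x y by simp
      qed
    qed
    then have "E - T ` E \<in> null_sets M"
      using mpb_null_image[OF Tm TE[OF H_inverse[OF T]]] by simp
    then have "sym_diff (T ` E) E \<in> null_sets M" using TE[OF T] by blast
    then show "emeasure M (sym_diff (T ` E) E) = 0" by blast
  qed
  moreover have "E \<notin> null_sets M"
  proof
    assume N: "E \<in> null_sets M"
    have "(\<lambda>x\<in>space M. x) ` A = A" using sets.sets_into_space[OF A(1)] by force
    then have "A - E \<in> null_sets M" using gA[OF H_id] by simp
    then have "A - E \<union> E \<in> null_sets M" using N by blast
    then show False using A by (metis Un_Diff_cancel2 Un_upper1 null_sets_subset)
  qed
  ultimately have co: "space M - E \<in> null_sets M" by blast
  have "\<exists>C\<in>\<B>. C \<inter> B \<notin> null_sets M"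
  proof (rule ccontr)
    assume "\<not> ?thesis"
    then have "(\<Union>C\<in>\<B>. C \<inter> B) \<in> null_sets M" using \<B>(1) by (intro null_sets_UN') auto
    then have "(\<Union>C\<in>\<B>. C \<inter> B) \<union> (space M - E) \<in> null_sets M" using co by blast
    moreover have "B \<subseteq> (\<Union>C\<in>\<B>. C \<inter> B) \<union> (space M - E)"
      using sets.sets_into_space[OF B(1)] unfolding E_def by blast
    ultimately show False using B by (meson null_sets_subset)
  qed
  with \<B>(2) that show thesis by blast
qed

text \<open>Exhaustion: repeatedly exchange a piece of at least half the largest possible measure.\<close>

lemma ex_involution_disjoint:
  assumes A: "A \<in> sets M" and B: "B \<in> sets M" and disj: "A \<inter> B = {}"
    and le: "emeasure M A \<le> emeasure M B" and fin: "emeasure M B < \<infinity>"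
  obtains U where "U \<in> H" "\<And>x. x \<in> space M \<Longrightarrow> U (U x) = x"
    "\<And>x. x \<in> space M \<Longrightarrow> x \<notin> A \<union> B \<Longrightarrow> U x = x" "AE x in M. x \<in> A \<longrightarrow> U x \<in> B"
proof -
  have Afin: "emeasure M A < \<infinity>" using le fin by (rule le_less_trans)
  define ok where "ok = (\<lambda>A' B' C g. C \<in> sets M \<and> C \<subseteq> A' \<and> g \<in> H \<and> g ` C \<subseteq> B')"
  define P where "P = (\<lambda>(n::nat) (A', B', C, g). A' \<in> sets M \<and> B' \<in> sets M \<and> A' \<subseteq> A \<and> B' \<subseteq> B \<and> ok A' B' C g \<and>
     (\<forall>C' g'. ok A' B' C' g' \<longrightarrow> measure M C' \<le> 2 * measure M C))"
  define Q where "Q = (\<lambda>(n::nat) (A'::'a set, B'::'a set, C, g::'a \<Rightarrow> 'a) (A'', B'', C'::'a set, g'::'a \<Rightarrow> 'a).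
     A'' = A' - C \<and> B'' = B' - g ` C)"
  have pick: "\<exists>C g. P n (A', B', C, g)"
    if A': "A' \<in> sets M" "A' \<subseteq> A" and B': "B' \<in> sets M" "B' \<subseteq> B" for A' B' n
  proof -
    define V where "V = {measure M C |C g. ok A' B' C g}"
    have "measure M C \<le> measure M A" if "ok A' B' C g" for C g
      using that A A' Afin unfolding ok_def
        by (intro measure_mono_fmeasurable) (auto intro: fmeasurableI)
    then have bdd: "bdd_above V" unfolding V_def by (intro bdd_aboveI) auto
    have ok0: "ok A' B' {} (\<lambda>x\<in>space M. x)" unfolding ok_def using H_id by auto
    show ?thesis
    proof (cases "\<exists>v\<in>V. v > 0")
      case True
      then obtain v where v: "v \<in> V" "v > 0" by blast
      have S: "Sup V > 0" using cSup_upper[OF v(1) bdd] v(2) by simp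
      then have "Sup V / 2 < Sup V" by simp
      then obtain w where w: "w \<in> V" "Sup V / 2 < w" using less_cSup_iff[OF _ bdd] v(1) by blast
      then obtain C g where Cg: "ok A' B' C g" "w = measure M C" unfolding V_def by blast
      have "measure M C' \<le> 2 * measure M C" if "ok A' B' C' g'" for C' g'
      proof -
        have "measure M C' \<le> Sup V" by (rule cSup_upper[OF _ bdd]) (use that in \<open>auto simp: V_def\<close>)
        then show ?thesis using w Cg by simp
      qed
      then show ?thesis using Cg A' B' unfolding P_def by auto
    next
      case False
      have "measure M C' \<le> 2 * measure M {}" if "ok A' B' C' g'" for C' g'
      proof -
        have "measure M C' \<in> V" using that unfolding V_def by blast
        then show ?thesis using False by (auto simp: not_less)
      qed
      then have "P n (A', B', {}, \<lambda>x\<in>space M. x)"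
        unfolding P_def prod.case using ok0 A' B' by blast
      then show ?thesis by blast
    qed
  qed
  have "\<exists>s. \<forall>n. (P n (s n) \<and> (n = 0 \<longrightarrow> fst (s n) = A \<and> fst (snd (s n)) = B)) \<and> Q n (s n) (s (Suc n))"
  proof (rule dependent_nat_choice)
    show "\<exists>s. P 0 s \<and> (0 = (0::nat) \<longrightarrow> fst s = A \<and> fst (snd s) = B)"
      using pick[OF A order_refl B order_refl, of 0] by force
    fix s n assume s: "P n s \<and> (n = 0 \<longrightarrow> fst s = A \<and> fst (snd s) = B)"
    obtain A' B' C g where s': "s = (A', B', C, g)" by (cases s)
    have "A' \<in> sets M" "B' \<in> sets M" "A' \<subseteq> A" "B' \<subseteq> B" "C \<in> sets M" "g \<in> H"
      using s unfolding s' P_def ok_def by auto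
    then have "A' - C \<in> sets M" "A' - C \<subseteq> A" "B' - g ` C \<in> sets M" "B' - g ` C \<subseteq> B"
      using mpb_image_sets[OF H_mpb] by auto
    then obtain C' g' where "P (Suc n) (A' - C, B' - g ` C, C', g')" using pick by blast
    then show "\<exists>s'. (P (Suc n) s' \<and> (Suc n = 0 \<longrightarrow> fst s' = A \<and> fst (snd s') = B)) \<and> Q n s s'"
      unfolding s' Q_def by (intro exI[of _ "(A' - C, B' - g ` C, C', g')"]) auto
  qed
  then obtain s where s: "\<And>n. P n (s n)" "fst (s 0) = A" "fst (snd (s 0)) = B"
    "\<And>n. Q n (s n) (s (Suc n))"
    by blast
  define a where "a = (\<lambda>n. fst (s n))"
  define b where "b = (\<lambda>n. fst (snd (s n)))"
  define C where "C = (\<lambda>n. fst (snd (snd (s n))))"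
  define g where "g = (\<lambda>n. snd (snd (snd (s n))))"
  have sn: "s n = (a n, b n, C n, g n)" for n unfolding a_def b_def C_def g_def by simp
  have ab0: "a 0 = A" "b 0 = B" using s(2,3) unfolding a_def b_def by auto
  have abS: "a (Suc n) = a n - C n" "b (Suc n) = b n - g n ` C n" for n
    using s(4)[of n] unfolding Q_def sn by auto
  have P: "a n \<in> sets M" "b n \<in> sets M" "a n \<subseteq> A" "b n \<subseteq> B" "C n \<in> sets M" "C n \<subseteq> a n" "g n \<in> H"
    "g n ` C n \<subseteq> b n" for n
    using s(1)[of n] unfolding P_def sn ok_def by auto
  have max: "measure M C' \<le> 2 * measure M (C n)" if "ok (a n) (b n) C' g'" for C' g' n
    using s(1)[of n] that unfolding P_def sn by auto
  have adec: "a n \<subseteq> a m" and bdec: "b n \<subseteq> b m" if "m \<le> n" for m n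
    using lift_Suc_antimono_le[of a m n] lift_Suc_antimono_le[of b m n] that abS by auto
  have Cdisj: "disjoint_family C"
  proof -
    have "C m \<inter> C n = {}" if "m < n" for m n
      using P(6)[of n] adec[of "Suc m" n] that abS(1)[of m] by auto
    then show ?thesis unfolding disjoint_family_on_def by (metis Int_commute linorder_neqE_nat)
  qed
  have gCdisj: "disjoint_family (\<lambda>n. g n ` C n)"
  proof -
    have "g m ` C m \<inter> g n ` C n = {}" if "m < n" for m n
      using P(8)[of n] bdec[of "Suc m" n] that abS(2)[of m] by auto
    then show ?thesis unfolding disjoint_family_on_def by (metis Int_commute linorder_neqE_nat)
  qed
  have gC: "g n ` C n \<in> sets M" "emeasure M (g n ` C n) = emeasure M (C n)" for n
    using mpb_image_sets[OF H_mpb] mpbD(4)[OF H_mpb] P by auto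
  define UC where "UC = (\<Union>n. C n)"
  define UD where "UD = (\<Union>n. g n ` C n)"
  have UC: "UC \<in> sets M" "UC \<subseteq> A" unfolding UC_def using P by (auto, blast)
  have UD: "UD \<in> sets M" "UD \<subseteq> B" unfolding UD_def using gC P by (auto, blast)
  have eUC: "(\<Sum>n. emeasure M (C n)) = emeasure M UC" unfolding UC_def
    using P Cdisj by (intro suminf_emeasure) auto
  have "(\<Sum>n. emeasure M (g n ` C n)) = emeasure M UD" unfolding UD_def
    using gC gCdisj by (intro suminf_emeasure) auto
  then have eUD: "emeasure M UD = emeasure M UC" using gC eUC by simp
  have resA: "A - UC \<subseteq> a n" for n
    by (induction n) (auto simp: ab0 abS UC_def)
  have resB: "B - UD \<subseteq> b n" for n
    by (induction n) (auto simp: ab0 abS UD_def)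
  have UCfin: "emeasure M UC < \<infinity>" using UC A Afin emeasure_mono[OF UC(2) A]
    by (auto simp: less_top[symmetric] top_unique)
  have Cm: "emeasure M (C n) = ennreal (measure M (C n))" for n
  proof -
    have "emeasure M (C n) \<le> emeasure M UC" using UC by (intro emeasure_mono) (auto simp: UC_def)
    then show ?thesis using UCfin by (intro emeasure_eq_ennreal_measure) (auto simp: top_unique)
  qed
  have "(\<Sum>n. ennreal (measure M (C n))) < \<infinity>" using eUC UCfin Cm by simp
  then have "summable (\<lambda>n. measure M (C n))" by (intro summable_suminf_not_top) auto
  then have C0: "(\<lambda>n. measure M (C n)) \<longlonglongrightarrow> 0" by (rule summable_LIMSEQ_zero)
  \<comment> \<open>If a nonnull part of \<open>A\<close> remained, at least as much of
    \<open>B\<close> would remain, and \<open>ex_meet\<close> would give a set \<open>D\<close> of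
    positive measure admissible at every stage. Near-maximality bounds its measure by twice that of
    each \<open>C n\<close>, which tends to 0 because the disjoint \<open>C n\<close> have finite
    total measure.\<close>
  have A0: "A - UC \<in> null_sets M"
  proof (rule ccontr)
    assume nn: "A - UC \<notin> null_sets M"
    have "emeasure M (A - UC) \<le> emeasure M (B - UD)"
    proof -
      have "emeasure M (A - UC) = emeasure M A - emeasure M UC"
        using UC A UCfin by (intro emeasure_Diff) auto
      also have "\<dots> \<le> emeasure M B - emeasure M UD" unfolding eUD using le
        by (rule ennreal_minus_mono) simp
      also have "\<dots> = emeasure M (B - UD)" using UD B UCfin eUD
        by (intro emeasure_Diff[symmetric]) auto
      finally show ?thesis .
    qed
    then have nnB: "B - UD \<notin> null_sets M" using nn UC UD A B unfolding null_sets_def by auto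
    obtain h where h: "h \<in> H" "h ` (A - UC) \<inter> (B - UD) \<notin> null_sets M"
      using ex_meet[OF _ nn _ nnB] A B UC UD by auto
    define D where "D = (A - UC) \<inter> (h -` (B - UD) \<inter> space M)"
    have Ds: "D \<in> sets M" unfolding D_def
      using A B UC UD measurable_sets[OF mpbD(3)[OF H_mpb[OF h(1)]], of "B - UD"] by auto
    have hD: "h ` D = h ` (A - UC) \<inter> (B - UD)" unfolding D_def using sets.sets_into_space[OF A]
      by auto
    have "emeasure M D = emeasure M (h ` D)" using mpbD(4)[OF H_mpb[OF h(1)] Ds] by simp
    moreover have "h ` D \<in> sets M" using mpb_image_sets[OF H_mpb[OF h(1)] Ds] .
    ultimately have "emeasure M D \<noteq> 0" using h(2) unfolding hD by (auto simp: null_sets_def)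
    moreover have "emeasure M D \<le> emeasure M A" using A by (intro emeasure_mono) (auto simp: D_def)
    ultimately have pos: "measure M D > 0" 
      using Afin by (auto simp: measure_def enn2real_positive_iff less_top[symmetric] top_unique zero_less_iff_neq_zero)
    have "ok (a n) (b n) D h" for n
      unfolding ok_def using Ds h(1) resA[of n] resB[of n] hD by (auto simp: D_def)
    then have le2: "measure M D \<le> 2 * measure M (C n)" for n by (rule max)
    have "(\<lambda>n. 2 * measure M (C n)) \<longlonglongrightarrow> 2 * 0" using C0 by (intro tendsto_mult_left)
    then have "measure M D \<le> 2 * 0" by (rule LIMSEQ_le_const) (use le2 in blast)
    then show False using pos by simp
  qed
  define f where "f = (\<lambda>x. g (LEAST n. x \<in> C n) x)"
  have f: "f x = g n x" if "x \<in> C n" for x n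
  proof -
    have "x \<in> C (LEAST n. x \<in> C n)" using that by (rule LeastI)
    then have "(LEAST n. x \<in> C n) = n" using that Cdisj unfolding disjoint_family_on_def by blast
    then show ?thesis unfolding f_def by simp
  qed
  have fUC: "f ` UC = UD" unfolding UC_def UD_def using f by force
  have inj: "inj_on f UC"
  proof (rule inj_onI)
    fix x y assume xy: "x \<in> UC" "y \<in> UC" "f x = f y"
    then obtain m n where mn: "x \<in> C m" "y \<in> C n" unfolding UC_def by blast
    have eq: "g m x = g n y" using f mn xy(3) by simp
    have "m = n"
    proof (rule ccontr)
      assume "m \<noteq> n"
      then have "g m ` C m \<inter> g n ` C n = {}" using gCdisj unfolding disjoint_family_on_def by blast
      then show False using eq mn by blast
    qed
    then show "x = y"
      using eq mn mpbD(6)[OF H_mpb[OF P(7)]] sets.sets_into_space[OF P(5)[of n]]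
      by (metis inj_onD subsetD)
  qed
  have UCM: "UC \<subseteq> space M" "UD \<subseteq> space M" using UC UD sets.sets_into_space by blast+
  have dj: "f ` UC \<inter> UC = {}" unfolding fUC using UC UD disj by blast
  have cond: "inj_on f UC" "UC \<subseteq> space M" "f ` UC \<subseteq> space M" "f ` UC \<inter> UC = {}"
    using inj UCM fUC dj by auto
  note sw = swap_along_simps[OF cond]
  show thesis
  proof (rule that[of "swap_along M UC f"])
    show "swap_along M UC f \<in> H"
    proof (rule H_swap_along[OF inj dj, of "range (\<lambda>n. (C n, g n))"])
      show "UC = \<Union>(fst ` range (\<lambda>n. (C n, g n)))" unfolding UC_def by auto
    qed (use P f in auto)
    show "swap_along M UC f (swap_along M UC f x) = x" if "x \<in> space M" for x
      by (rule sw(4)[OF that])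
    show "swap_along M UC f x = x" if "x \<in> space M" "x \<notin> A \<union> B" for x
      by (rule sw(3)) (use that UC UD fUC in auto)
    have "AE x in M. x \<notin> A - UC" using A0 by (rule AE_not_in)
    then show "AE x in M. x \<in> A \<longrightarrow> swap_along M UC f x \<in> B"
      by eventually_elim (use sw(1) fUC UD in blast)
  qed
qed

text \<open>The exchange takes place between \<open>A - B\<close> and \<open>B - A\<close> and fixes
  the points common to both sets. Subtracting the finite measure of the common part keeps the
  inequality.\<close>

lemma ex_involution:
  assumes A: "A \<in> sets M" and B: "B \<in> sets M"
    and le: "emeasure M A \<le> emeasure M B" and fin: "emeasure M B < \<infinity>"
  obtains U where "U \<in> H" "\<And>x. x \<in> space M \<Longrightarrow> U (U x) = x"
    "\<And>x. x \<in> space M \<Longrightarrow> x \<notin> A \<union> B \<Longrightarrow> U x = x" "AE x in M. x \<in> A \<longrightarrow> U x \<in> B"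
proof -
  have "emeasure M (A \<inter> B) < \<infinity>"
    using fin emeasure_mono[of "A \<inter> B" B M] B by (auto simp: less_top[symmetric] top_unique)
  then have d: "emeasure M (A - B) = emeasure M A - emeasure M (A \<inter> B)"
    "emeasure M (B - A) = emeasure M B - emeasure M (A \<inter> B)"
    using A B by (subst emeasure_Diff[symmetric]; auto intro!: arg_cong[of _ _ "emeasure M"])+
  have "emeasure M (A - B) \<le> emeasure M (B - A)" unfolding d using le
    by (rule ennreal_minus_mono) simp
  moreover have "emeasure M (B - A) < \<infinity>"
    using fin emeasure_mono[of "B - A" B M] B by (auto simp: less_top[symmetric] top_unique)
  ultimately obtain U where U: "U \<in> H" "\<And>x. x \<in> space M \<Longrightarrow> U (U x) = x"
    "\<And>x. x \<in> space M \<Longrightarrow> x \<notin> (A - B) \<union> (B - A) \<Longrightarrow> U x = x" "AE x in M. x \<in> A - B \<longrightarrow> U x \<in> B - A"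
    using ex_involution_disjoint[of "A - B" "B - A"] A B by blast
  have "AE x in M. x \<in> A \<longrightarrow> U x \<in> B"
    using U(4)
  proof eventually_elim
    case (elim x)
    show ?case
    proof
      assume x: "x \<in> A"
      then show "U x \<in> B"
        using elim U(3)[of x] sets.sets_into_space[OF A] by (cases "x \<in> B") auto
    qed
  qed
  then show thesis using that[OF U(1,2)] U(3) by blast
qed

end

section \<open>The uniform metric\<close>

definition disagreement :: "'a measure \<Rightarrow> ('a \<Rightarrow> 'a) \<Rightarrow> ('a \<Rightarrow> 'a) \<Rightarrow> 'a set" where
  "disagreement M S T = {x \<in> space M. S x \<noteq> T x}"

lemma disagreement_sym: "disagreement M S T = disagreement M T S"
  unfolding disagreement_def by auto

lemma disagreement_sets:
  "standard_borel M \<Longrightarrow> S \<in> measurable M M \<Longrightarrow> T \<in> measurable M M \<Longrightarrow> disagreement M S T \<in> sets M"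
proof -
  assume "standard_borel M" "S \<in> measurable M M" "T \<in> measurable M M"
  then have "space M - {x \<in> space M. S x = T x} \<in> sets M"
    using sets_Collect_eq_standard_borel[of M S M T] by blast
  moreover have "disagreement M S T = space M - {x \<in> space M. S x = T x}"
    unfolding disagreement_def by auto
  ultimately show ?thesis by simp
qed

lemma emeasure_disagreement_triangle:
  assumes "standard_borel M" "R \<in> measurable M M" "S \<in> measurable M M" "T \<in> measurable M M"
  shows "emeasure M (disagreement M R T) \<le> emeasure M (disagreement M R S) + emeasure M (disagreement M S T)"
proof -
  have "emeasure M (disagreement M R T) \<le> emeasure M (disagreement M R S \<union> disagreement M S T)"
    using assms by (intro emeasure_mono) (auto simp: disagreement_sets, auto simp: disagreement_def)
  also have "\<dots> \<le> emeasure M (disagreement M R S) + emeasure M (disagreement M S T)"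
    using assms by (intro emeasure_subadditive disagreement_sets)
  finally show ?thesis .
qed

lemma disagreement_compose_left:
  assumes "U \<in> mpb M" "S \<in> mpb M" "T \<in> mpb M"
  shows "disagreement M (compose (space M) U S) (compose (space M) U T) = disagreement M S T"
proof -
  have "U (S x) = U (T x) \<longleftrightarrow> S x = T x" if "x \<in> space M" for x
    using inj_on_eq_iff[OF mpbD(6)[OF assms(1)]] mpb_in_space[OF assms(2) that]
      mpb_in_space[OF assms(3) that]
    by blast
  then show ?thesis unfolding disagreement_def by auto
qed

lemma emeasure_disagreement_compose_right:
  assumes std: "standard_borel M" and "U \<in> mpb M" "S \<in> mpb M" "T \<in> mpb M"
  shows "emeasure M (disagreement M (compose (space M) S U) (compose (space M) T U)) = emeasure M (disagreement M S T)"
proof -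
  have "disagreement M (compose (space M) S U) (compose (space M) T U) = U -` disagreement M S T \<inter> space M"
    using mpb_in_space[OF assms(2)] unfolding disagreement_def by auto
  then show ?thesis
    using mpbD(5)[OF assms(2) disagreement_sets[OF std mpbD(3)[OF assms(3)] mpbD(3)[OF assms(4)]]]
      by simp
qed

text \<open>\<open>S\<close> maps the set where \<open>S\<close> and \<open>T\<close> differ onto
  the set where their inverses differ.\<close>

lemma emeasure_disagreement_inverse:
  assumes std: "standard_borel M" and S: "S \<in> mpb M" and T: "T \<in> mpb M"
  shows "emeasure M (disagreement M (mpb_inverse M S) (mpb_inverse M T)) = emeasure M (disagreement M S T)"
proof -
  have "disagreement M (mpb_inverse M S) (mpb_inverse M T) = S ` disagreement M S T"
  proof (intro equalityI subsetI)
    fix x assume "x \<in> disagreement M (mpb_inverse M S) (mpb_inverse M T)"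
    then have x: "x \<in> space M" "mpb_inverse M S x \<noteq> mpb_inverse M T x" unfolding disagreement_def
      by auto
    have "T (mpb_inverse M S x) \<noteq> x"
      using x mpb_inverse_left[OF T] mpb_inverse_in_space[OF S] by metis
    then have "mpb_inverse M S x \<in> disagreement M S T"
      unfolding disagreement_def using mpb_inverse_in_space[OF S x(1)] mpb_inverse_right[OF S x(1)]
        by auto
    then show "x \<in> S ` disagreement M S T" using mpb_inverse_right[OF S x(1)] by (metis imageI)
  next
    fix x assume "x \<in> S ` disagreement M S T"
    then obtain y where y: "y \<in> space M" "S y \<noteq> T y" "x = S y" unfolding disagreement_def by blast
    then have "mpb_inverse M S x = y" "x \<in> space M" using mpb_inverse_left[OF S] mpb_in_space[OF S]
      by auto
    moreover have "mpb_inverse M T x \<noteq> y" using y mpb_inverse_right[OF T] calculation(2) by metis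
    ultimately show "x \<in> disagreement M (mpb_inverse M S) (mpb_inverse M T)"
      unfolding disagreement_def by auto
  qed
  then show ?thesis
    using mpbD(4)[OF S disagreement_sets[OF std mpbD(3)[OF S] mpbD(3)[OF T]]] by simp
qed

text \<open>\<open>eventual_value s\<close> is unspecified when \<open>s\<close> is not eventually constant.\<close>

definition eventual_value :: "(nat \<Rightarrow> 'a) \<Rightarrow> 'a" where
  "eventual_value s = (SOME y. \<forall>\<^sub>F n in sequentially. s n = y)"

lemma eventual_value_eq: "\<forall>\<^sub>F n in sequentially. s n = y \<Longrightarrow> eventual_value s = y"
proof -
  assume y: "\<forall>\<^sub>F n in sequentially. s n = y"
  then have "\<forall>\<^sub>F n in sequentially. s n = eventual_value s"
    unfolding eventual_value_def by (rule someI)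
  with y have "\<forall>\<^sub>F n in sequentially. eventual_value s = y" by eventually_elim simp
  then show ?thesis by simp
qed

section \<open>The subgroup of finitely supported elements with its uniform metric\<close>

context measure_full_group
begin

abbreviation edist :: "('a \<Rightarrow> 'a) \<Rightarrow> ('a \<Rightarrow> 'a) \<Rightarrow> ennreal" where
  "edist S T \<equiv> emeasure M (disagreement M S T)"

lemma edist_triangle:
  "R \<in> measurable M M \<Longrightarrow> S \<in> measurable M M \<Longrightarrow> T \<in> measurable M M \<Longrightarrow> edist R T \<le> edist R S + edist S T"
  by (rule emeasure_disagreement_triangle[OF std])

lemma edist_zero_iff:
  "S \<in> mpb M \<Longrightarrow> T \<in> mpb M \<Longrightarrow> edist S T = 0 \<longleftrightarrow> (AE x in M. S x = T x)"
  using AE_iff_measurable[OF disagreement_sets[OF std mpbD(3) mpbD(3)], of S T "\<lambda>x. S x = T x"]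
  unfolding disagreement_def by auto

lemma edist_cong_AE:
  assumes "S \<in> mpb M" "T \<in> mpb M" "S' \<in> mpb M" "T' \<in> mpb M" "AE x in M. S x = S' x"
    "AE x in M. T x = T' x"
  shows "edist S T = edist S' T'"
proof (rule emeasure_eq_AE)
  show "AE x in M. (x \<in> disagreement M S T) = (x \<in> disagreement M S' T')"
    using assms(5,6) by eventually_elim (auto simp: disagreement_def)
qed (use assms in \<open>auto intro!: disagreement_sets[OF std] mpbD(3)\<close>)

text \<open>Finite support is expressed as finite distance from the identity, so that closure under
  products follows from invariance and the triangle inequality.\<close>

definition Hf :: "('a \<Rightarrow> 'a) set" where "Hf = {T \<in> H. edist T (\<lambda>x\<in>space M. x) < \<infinity>}"

lemma Hf_H: "T \<in> Hf \<Longrightarrow> T \<in> H" and Hf_mpb: "T \<in> Hf \<Longrightarrow> T \<in> mpb M"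
  and Hf_measurable: "T \<in> Hf \<Longrightarrow> T \<in> measurable M M"
  unfolding Hf_def using H_mpb mpbD(3) by auto

lemma support_eq: "support M T = disagreement M T (\<lambda>x\<in>space M. x)"
  unfolding support_def disagreement_def by auto

lemma finite_support_part_eq: "finite_support_part M G = aut_class M ` Hf"
  unfolding finite_support_part_def Hf_def H_def support_eq by auto

lemma Hf_id: "(\<lambda>x\<in>space M. x) \<in> Hf"
  unfolding Hf_def using H_id by (simp add: disagreement_def)

lemma Hf_compose:
  assumes S: "S \<in> Hf" and T: "T \<in> Hf"
  shows "compose (space M) S T \<in> Hf"
proof -
  note m = Hf_mpb[OF S] Hf_mpb[OF T] mpb_id
  have "compose (space M) (\<lambda>x\<in>space M. x) T = T"
  proof (rule mpb_eqI[OF mpb_compose[OF mpb_id m(2)] m(2)])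
    fix x assume x: "x \<in> space M"
    then show "compose (space M) (\<lambda>x\<in>space M. x) T x = T x" using mpb_in_space[OF m(2) x] by simp
  qed
  then have "edist (compose (space M) S T) T = edist S (\<lambda>x\<in>space M. x)"
    using emeasure_disagreement_compose_right[OF std m(2,1) mpb_id] by simp
  moreover have "edist (compose (space M) S T) (\<lambda>x\<in>space M. x)
      \<le> edist (compose (space M) S T) T + edist T (\<lambda>x\<in>space M. x)"
    by (intro edist_triangle mpbD(3) mpb_compose m)
  ultimately show ?thesis using S T H_compose unfolding Hf_def
    by (auto simp: less_top[symmetric] top_unique)
qed

lemma Hf_inverse:
  assumes T: "T \<in> Hf"
  shows "mpb_inverse M T \<in> Hf"
proof -
  have "mpb_inverse M (\<lambda>x\<in>space M. x) = (\<lambda>x\<in>space M. x)"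
  proof (rule mpb_eqI[OF mpb_inverse_mpb[OF mpb_id] mpb_id])
    fix x assume x: "x \<in> space M"
    show "mpb_inverse M (\<lambda>x\<in>space M. x) x = (\<lambda>x\<in>space M. x) x" using mpb_inverse_left[OF mpb_id x] x
      by simp
  qed
  then have "edist (mpb_inverse M T) (\<lambda>x\<in>space M. x) = edist T (\<lambda>x\<in>space M. x)"
    using emeasure_disagreement_inverse[OF std Hf_mpb[OF T] mpb_id] by simp
  then show ?thesis using T H_inverse unfolding Hf_def by auto
qed

lemma Hf_near:
  assumes T: "T \<in> Hf" and S: "S \<in> H" and "edist S T < \<infinity>"
  shows "S \<in> Hf"
proof -
  have "edist S (\<lambda>x\<in>space M. x) \<le> edist S T + edist T (\<lambda>x\<in>space M. x)"
    by (intro edist_triangle mpbD(3) H_mpb S Hf_mpb T mpb_id)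
  then show ?thesis using assms unfolding Hf_def
    by (auto simp: less_top[symmetric] top_unique)
qed

lemma edist_Hf_finite: "S \<in> Hf \<Longrightarrow> T \<in> Hf \<Longrightarrow> edist S T < \<infinity>"
proof -
  assume S: "S \<in> Hf" and T: "T \<in> Hf"
  have "edist S T \<le> edist S (\<lambda>x\<in>space M. x) + edist (\<lambda>x\<in>space M. x) T"
    by (intro edist_triangle mpbD(3) Hf_mpb S T mpb_id)
  then show ?thesis using S T disagreement_sym unfolding Hf_def
    by (auto simp: less_top[symmetric] top_unique disagreement_sym)
qed

abbreviation Gf :: "('a \<Rightarrow> 'a) set monoid" where "Gf \<equiv> (Aut M)\<lparr>carrier := finite_support_part M G\<rparr>"

lemma subgroup_finite_support: "subgroup (finite_support_part M G) (Aut M)"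
proof
  show "finite_support_part M G \<subseteq> carrier (Aut M)"
    unfolding finite_support_part_eq using Hf_mpb by (auto simp: Aut_def)
  show "x \<otimes>\<^bsub>Aut M\<^esub> y \<in> finite_support_part M G"
    if xy: "x \<in> finite_support_part M G" "y \<in> finite_support_part M G" for x y
  proof -
    obtain S T where "S \<in> Hf" "T \<in> Hf" "x = aut_class M S" "y = aut_class M T"
      using xy unfolding finite_support_part_eq by blast
    then show ?thesis unfolding finite_support_part_eq using Hf_compose
      by (simp add: aut_class_mult Hf_mpb)
  qed
  show "\<one>\<^bsub>Aut M\<^esub> \<in> finite_support_part M G"
    unfolding finite_support_part_eq using Hf_id by (auto simp: Aut_def)
  show "inv\<^bsub>Aut M\<^esub> x \<in> finite_support_part M G" if x: "x \<in> finite_support_part M G" for x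
  proof -
    obtain S where "S \<in> Hf" "x = aut_class M S" using x unfolding finite_support_part_eq by blast
    then show ?thesis unfolding finite_support_part_eq using Hf_inverse
      by (simp add: aut_class_inverse Hf_mpb)
  qed
qed

lemma group_Gf: "group Gf"
  by (rule subgroup.subgroup_is_group[OF subgroup_finite_support group_Aut])

lemma Gf_simps:
  assumes "S \<in> Hf" "T \<in> Hf"
  shows "aut_class M S \<otimes>\<^bsub>Gf\<^esub> aut_class M T = aut_class M (compose (space M) S T)"
    "inv\<^bsub>Gf\<^esub> (aut_class M S) = aut_class M (mpb_inverse M S)"
proof -
  show "aut_class M S \<otimes>\<^bsub>Gf\<^esub> aut_class M T = aut_class M (compose (space M) S T)"
    using assms by (simp add: aut_class_mult Hf_mpb)
  have "aut_class M S \<in> finite_support_part M G" using assms unfolding finite_support_part_eq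
    by simp
  then show "inv\<^bsub>Gf\<^esub> (aut_class M S) = aut_class M (mpb_inverse M S)"
    using group.m_inv_consistent[OF group_Aut subgroup_finite_support]
      aut_class_inverse[OF Hf_mpb[OF assms(1)]]
    by simp
qed

text \<open>Points of the metric space are classes, so distances are read off from a chosen
  bijection; \<open>udist_class\<close> shows that the choice is immaterial.\<close>

definition rep :: "('a \<Rightarrow> 'a) set \<Rightarrow> 'a \<Rightarrow> 'a" where "rep s = (SOME T. T \<in> Hf \<and> aut_class M T = s)"

lemma rep: "s \<in> finite_support_part M G \<Longrightarrow> rep s \<in> Hf \<and> aut_class M (rep s) = s"
proof -
  assume "s \<in> finite_support_part M G"
  then have "\<exists>T. T \<in> Hf \<and> aut_class M T = s" unfolding finite_support_part_eq by auto
  then show ?thesis unfolding rep_def by (rule someI_ex)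
qed

lemma rep_AE: "T \<in> Hf \<Longrightarrow> AE x in M. rep (aut_class M T) x = T x"
  using rep[of "aut_class M T"] aut_class_eq_iff[of "rep (aut_class M T)" M T] Hf_mpb
  unfolding finite_support_part_eq by blast

definition udist :: "('a \<Rightarrow> 'a) set \<Rightarrow> ('a \<Rightarrow> 'a) set \<Rightarrow> real" where
  "udist s t = measure M (disagreement M (rep s) (rep t))"

lemma udist_rep: "s \<in> finite_support_part M G \<Longrightarrow> t \<in> finite_support_part M G \<Longrightarrow>
   ennreal (udist s t) = edist (rep s) (rep t)"
  unfolding udist_def using edist_Hf_finite[of "rep s" "rep t"] rep
  by (simp add: emeasure_eq_ennreal_measure less_top)

lemma udist_class:
  assumes "S \<in> Hf" "T \<in> Hf"
  shows "ennreal (udist (aut_class M S) (aut_class M T)) = edist S T"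
proof -
  have c: "aut_class M S \<in> finite_support_part M G" "aut_class M T \<in> finite_support_part M G"
    using assms unfolding finite_support_part_eq by auto
  have "edist (rep (aut_class M S)) (rep (aut_class M T)) = edist S T"
    by (rule edist_cong_AE) (use assms rep_AE Hf_mpb rep c in auto)
  then show ?thesis using udist_rep[OF c] by simp
qed

lemma udist_nonneg: "udist s t \<ge> 0" unfolding udist_def by simp

sublocale UM: Metric_space "finite_support_part M G" udist
proof
  show "0 \<le> udist s t" for s t by (rule udist_nonneg)
  show "udist s t = udist t s" for s t unfolding udist_def by (simp add: disagreement_sym)
  fix s t assume st: "s \<in> finite_support_part M G" "t \<in> finite_support_part M G"
  note r = rep[OF st(1)] rep[OF st(2)]
  have "udist s t = 0 \<longleftrightarrow> edist (rep s) (rep t) = 0"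
    using udist_rep[OF st] udist_nonneg[of s t] by (metis ennreal_0 ennreal_eq_0_iff order_antisym)
  also have "\<dots> \<longleftrightarrow> s = t"
    using edist_zero_iff aut_class_eq_iff r Hf_mpb by metis
  finally show "udist s t = 0 \<longleftrightarrow> s = t" .
next
  fix s t u assume st: "s \<in> finite_support_part M G" "t \<in> finite_support_part M G"
    "u \<in> finite_support_part M G"
  have "edist (rep s) (rep u) \<le> edist (rep s) (rep t) + edist (rep t) (rep u)"
    using st rep by (intro edist_triangle Hf_measurable) auto
  then have "ennreal (udist s u) \<le> ennreal (udist s t + udist t u)"
    using st udist_nonneg by (simp add: udist_rep ennreal_plus)
  then show "udist s u \<le> udist s t + udist t u"
    by (subst (asm) ennreal_le_iff) (auto intro: add_nonneg_nonneg udist_nonneg)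
qed

lemma udist_mult:
  assumes "s \<in> finite_support_part M G" "t \<in> finite_support_part M G" "u \<in> finite_support_part M G"
  shows "udist (u \<otimes>\<^bsub>Gf\<^esub> s) (u \<otimes>\<^bsub>Gf\<^esub> t) = udist s t" "udist (s \<otimes>\<^bsub>Gf\<^esub> u) (t \<otimes>\<^bsub>Gf\<^esub> u) = udist s t"
    "udist (inv\<^bsub>Gf\<^esub> s) (inv\<^bsub>Gf\<^esub> t) = udist s t"
proof -
  obtain S T U where S: "S \<in> Hf" "T \<in> Hf" "U \<in> Hf" and eq: "s = aut_class M S" "t = aut_class M T"
    "u = aut_class M U"
    using assms unfolding finite_support_part_eq by blast
  note m = Hf_mpb[OF S(1)] Hf_mpb[OF S(2)] Hf_mpb[OF S(3)]
  have e: "udist a b = udist c d" if "ennreal (udist a b) = ennreal (udist c d)" for a b c d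
    using that udist_nonneg by simp
  show "udist (u \<otimes>\<^bsub>Gf\<^esub> s) (u \<otimes>\<^bsub>Gf\<^esub> t) = udist s t"
    unfolding eq Gf_simps[OF S(3,1)] Gf_simps[OF S(3,2)]
    by (rule e) (simp add: udist_class S Hf_compose disagreement_compose_left[OF m(3,1,2)])
  show "udist (s \<otimes>\<^bsub>Gf\<^esub> u) (t \<otimes>\<^bsub>Gf\<^esub> u) = udist s t"
    unfolding eq Gf_simps[OF S(1,3)] Gf_simps[OF S(2,3)]
    by (rule e) (simp add: udist_class S Hf_compose
      emeasure_disagreement_compose_right[OF std m(3,1,2)])
  show "udist (inv\<^bsub>Gf\<^esub> s) (inv\<^bsub>Gf\<^esub> t) = udist s t"
    unfolding eq Gf_simps(2)[OF S(1,1)] Gf_simps(2)[OF S(2,2)]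
    by (rule e) (simp add: udist_class S Hf_inverse emeasure_disagreement_inverse[OF std m(1,2)])
qed

text \<open>Changing one factor at a time, two-sided invariance bounds the distance of two products
  by the sum of the distances of their factors.\<close>

lemma continuous_mult: "continuous_map (prod_topology UM.mtopology UM.mtopology) UM.mtopology (\<lambda>(x, y). x \<otimes>\<^bsub>Gf\<^esub> y)"
  unfolding UM.continuous_map_to_metric
proof (intro ballI allI impI)
  interpret K: group Gf by (rule group_Gf)
  fix z and e :: real assume z: "z \<in> topspace (prod_topology UM.mtopology UM.mtopology)" and e:
    "e > 0"
  obtain s t where st: "z = (s, t)" "s \<in> finite_support_part M G" "t \<in> finite_support_part M G"
    using z by (cases z) auto
  let ?U = "UM.mball s (e / 2) \<times> UM.mball t (e / 2)"
  have "(\<lambda>(x, y). x \<otimes>\<^bsub>Gf\<^esub> y) w \<in> UM.mball ((\<lambda>(x, y). x \<otimes>\<^bsub>Gf\<^esub> y) z) e" if W: "w \<in> ?U" for w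
  proof -
    obtain s' t' where w: "w = (s', t')" "s' \<in> finite_support_part M G"
      "t' \<in> finite_support_part M G"
      "udist s s' < e / 2" "udist t t' < e / 2" using W by (cases w) auto
    have c: "x \<otimes>\<^bsub>Gf\<^esub> y \<in> finite_support_part M G"
      if "x \<in> finite_support_part M G" "y \<in> finite_support_part M G" for x y
      using K.m_closed[of x y] that by simp
    have "udist (s \<otimes>\<^bsub>Gf\<^esub> t) (s' \<otimes>\<^bsub>Gf\<^esub> t') \<le> udist (s \<otimes>\<^bsub>Gf\<^esub> t) (s \<otimes>\<^bsub>Gf\<^esub> t') + udist (s \<otimes>\<^bsub>Gf\<^esub> t') (s' \<otimes>\<^bsub>Gf\<^esub> t')"
      by (intro UM.triangle c st w)
    also have "\<dots> = udist t t' + udist s s'"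
      using udist_mult(1)[OF st(3) w(3) st(2)] udist_mult(2)[OF st(2) w(2) w(3)] by simp
    also have "\<dots> < e" using w by simp
    finally show ?thesis using c st w by (simp add: UM.in_mball)
  qed
  moreover have "openin (prod_topology UM.mtopology UM.mtopology) ?U"
    by (simp add: openin_prod_Times_iff)
  moreover have "z \<in> ?U" using st e by simp
  ultimately show "\<exists>U. openin (prod_topology UM.mtopology UM.mtopology) U \<and> z \<in> U \<and>
      (\<forall>y\<in>U. (\<lambda>(x, y). x \<otimes>\<^bsub>Gf\<^esub> y) y \<in> UM.mball ((\<lambda>(x, y). x \<otimes>\<^bsub>Gf\<^esub> y) z) e)"
    by (intro exI[of _ ?U]) blast
qed

lemma continuous_inverse: "continuous_map UM.mtopology UM.mtopology (m_inv Gf)"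
  unfolding UM.continuous_map_to_metric
proof (intro ballI allI impI)
  interpret K: group Gf by (rule group_Gf)
  fix s and e :: real assume s: "s \<in> topspace UM.mtopology" and e: "e > 0"
  then have s': "s \<in> finite_support_part M G" by simp
  have "inv\<^bsub>Gf\<^esub> t \<in> UM.mball (inv\<^bsub>Gf\<^esub> s) e" if "t \<in> UM.mball s e" for t
    using that udist_mult(3)[OF s' _ s', of t] K.inv_closed[of s] K.inv_closed[of t] by auto
  then show "\<exists>U. openin UM.mtopology U \<and> s \<in> U \<and> (\<forall>t\<in>U. inv\<^bsub>Gf\<^esub> t \<in> UM.mball (inv\<^bsub>Gf\<^esub> s) e)"
    using s' e by (intro exI[of _ "UM.mball s e"]) auto
qed

section \<open>Completeness of the uniform metric\<close>

text \<open>By Borel-Cantelli the values \<open>T k x\<close> are eventually constant for almost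
  every \<open>x\<close>, and so are those of the inverses. The limit of the inverses is what makes
  the limit bijective, and cutting and pasting puts it into the full group.\<close>

lemma ex_limit:
  assumes T: "\<And>k::nat. T k \<in> Hf" and small: "\<And>k. edist (T k) (T (Suc k)) \<le> ennreal ((1/2) ^ k)"
  obtains U where "U \<in> Hf" "\<And>k. edist (T k) U \<le> ennreal (2 * (1/2) ^ k)"
proof -
  note Tm = Hf_mpb[OF T]
  define I where "I = (\<lambda>k. mpb_inverse M (T k))"
  have I: "I k \<in> Hf" for k unfolding I_def by (rule Hf_inverse[OF T])
  note Im = Hf_mpb[OF I]
  have ev: "AE x in M. \<forall>\<^sub>F k in sequentially. S k x = S (Suc k) x"
    if S: "\<And>k. S k \<in> mpb M" "\<And>k. edist (S k) (S (Suc k)) \<le> ennreal ((1/2) ^ k)" for S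
  proof -
    have ms: "disagreement M (S k) (S (Suc k)) \<in> sets M" for k
      using disagreement_sets[OF std] mpbD(3) S(1) by blast
    have fin: "emeasure M (disagreement M (S k) (S (Suc k))) < \<infinity>" for k
      using S(2)[of k] by (auto simp: less_top[symmetric] top_unique)
    have le: "measure M (disagreement M (S k) (S (Suc k))) \<le> (1/2) ^ k" for k
      unfolding measure_def using S(2)[of k] by (intro enn2real_leI) auto
    have "summable (\<lambda>k. (1/2::real) ^ k)" by (rule summable_geometric) simp
    then have "summable (\<lambda>k. measure M (disagreement M (S k) (S (Suc k))))"
      by (rule summable_comparison_test'[where N = 0]) (use le in simp)
    then have "AE x in M. eventually (\<lambda>k. x \<in> space M - disagreement M (S k) (S (Suc k))) sequentially"
      using ms fin by (intro borel_cantelli_AE1) auto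
    then show ?thesis
      by (rule eventually_mono) (auto elim!: eventually_mono simp: disagreement_def)
  qed
  have const: "\<exists>y. \<forall>\<^sub>F k in sequentially. s k = y"
    if e: "\<forall>\<^sub>F k in sequentially. s k = s (Suc k)" for s :: "nat \<Rightarrow> 'a"
  proof -
    obtain N where N: "\<And>k. k \<ge> N \<Longrightarrow> s k = s (Suc k)" using e unfolding eventually_sequentially
      by blast
    have "s k = s N" if "k \<ge> N" for k using that
      by (induction rule: dec_induct) (simp_all add: N[symmetric])
    then show ?thesis unfolding eventually_sequentially by blast
  qed
  have T_ev: "AE x in M. \<forall>\<^sub>F k in sequentially. T k x = T (Suc k) x" by (rule ev[OF Tm small])
  have I_small: "edist (I k) (I (Suc k)) \<le> ennreal ((1/2) ^ k)" for k
    using small[of k] emeasure_disagreement_inverse[OF std Tm Tm, of k "Suc k"] unfolding I_def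
      by simp
  have I_ev: "AE x in M. \<forall>\<^sub>F k in sequentially. I k x = I (Suc k) x" by (rule ev[OF Im I_small])
  define E where "E = {x \<in> space M. (\<forall>\<^sub>F k in sequentially. T k x = T (Suc k) x) \<and> (\<forall>\<^sub>F k in sequentially. I k x = I (Suc k) x)}"
  obtain \<Gamma> where \<Gamma>: "countable \<Gamma>" "range T \<subseteq> \<Gamma>" "\<Gamma> \<subseteq> H" "(\<lambda>x\<in>space M. x) \<in> \<Gamma>"
    "\<And>T. T \<in> \<Gamma> \<Longrightarrow> mpb_inverse M T \<in> \<Gamma>" "\<And>S T. S \<in> \<Gamma> \<Longrightarrow> T \<in> \<Gamma> \<Longrightarrow> compose (space M) S T \<in> \<Gamma>"
    using countable_subgroup[of "range T"] T Hf_H by auto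
  have T\<Gamma>: "T k \<in> \<Gamma>" and I\<Gamma>: "I k \<in> \<Gamma>" for k using \<Gamma>(2,5) unfolding I_def by auto
  \<comment> \<open>The pointwise limits have to be a true bijection, not one up to null sets. On
    \<open>X\<close>, which is conull and invariant under a countable group containing all
    \<open>T k\<close>, both limits exist at every point and map \<open>X\<close> into itself, so
    they are mutually inverse there; off \<open>X\<close> the identity is used.\<close>
  define X where "X = {x \<in> space M. \<forall>\<gamma>\<in>\<Gamma>. \<gamma> x \<in> E}"
  have meas_eq: "{x \<in> space M. S x = S' x} \<in> sets M" if "S \<in> mpb M" "S' \<in> mpb M" for S S'
    by (intro sets_Collect_eq_standard_borel[OF std] mpbD that)
  have E: "E \<in> sets M"
    unfolding E_def eventually_sequentially
    by (intro sets.sets_Collect_conj sets.sets_Collect_countable_Ex sets.sets_Collect_countable_All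
        sets.sets_Collect_imp sets.sets_Collect_const meas_eq Tm Im)
  have \<Gamma>m: "\<gamma> \<in> mpb M" if "\<gamma> \<in> \<Gamma>" for \<gamma> using \<Gamma>(3) H_mpb that by blast
  have X: "X \<in> sets M"
  proof -
    have "X = space M \<inter> (\<Inter>\<gamma>\<in>\<Gamma>. \<gamma> -` E \<inter> space M)" unfolding X_def by auto
    moreover have "(\<Inter>\<gamma>\<in>\<Gamma>. \<gamma> -` E \<inter> space M) \<in> sets M"
      using \<Gamma>(1,4) measurable_sets[OF mpbD(3)[OF \<Gamma>m] E] by (intro sets.countable_INT') auto
    ultimately show ?thesis by auto
  qed
  have X_AE: "AE x in M. x \<in> X"
  proof -
    have "AE x in M. x \<in> E" using T_ev I_ev AE_space by eventually_elim (auto simp: E_def)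
    then have "AE x in M. \<gamma> x \<in> E" if "\<gamma> \<in> \<Gamma>" for \<gamma> using mpb_AE[OF \<Gamma>m[OF that]] by blast
    then have "AE x in M. \<forall>\<gamma>\<in>\<Gamma>. \<gamma> x \<in> E" by (rule AE_ball_countable'[OF _ \<Gamma>(1)])
    then show ?thesis using AE_space by eventually_elim (auto simp: X_def)
  qed
  have X_inv: "\<gamma> x \<in> X" if "x \<in> X" "\<gamma> \<in> \<Gamma>" for x \<gamma>
  proof -
    have x: "x \<in> space M" using that unfolding X_def by auto
    have "\<delta> (\<gamma> x) \<in> E" if "\<delta> \<in> \<Gamma>" for \<delta>
    proof -
      have "compose (space M) \<delta> \<gamma> x \<in> E" using \<Gamma>(6)[OF that \<open>\<gamma> \<in> \<Gamma>\<close>] \<open>x \<in> X\<close> unfolding X_def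
        by blast
      then show ?thesis using x by simp
    qed
    then show ?thesis using mpb_in_space[OF \<Gamma>m[OF that(2)] x] unfolding X_def by auto
  qed
  have XE: "X \<subseteq> E"
  proof
    fix x assume x: "x \<in> X"
    then have "(\<lambda>x\<in>space M. x) x \<in> E" using \<Gamma>(4) unfolding X_def by blast
    then show "x \<in> E" using x unfolding X_def by simp
  qed
  have XM: "X \<subseteq> space M" unfolding X_def by auto
  define U where "U = (\<lambda>x\<in>space M. if x \<in> X then eventual_value (\<lambda>k. T k x) else x)"
  define V where "V = (\<lambda>x. if x \<in> X then eventual_value (\<lambda>k. I k x) else x)"
  have evT: "\<forall>\<^sub>F k in sequentially. T k x = eventual_value (\<lambda>k. T k x)" if x: "x \<in> X" for x
  proof -
    obtain y where "\<forall>\<^sub>F k in sequentially. T k x = y" using const[of "\<lambda>k. T k x"] x XE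
      unfolding E_def by auto
    then show ?thesis using eventual_value_eq by metis
  qed
  have evI: "\<forall>\<^sub>F k in sequentially. I k x = eventual_value (\<lambda>k. I k x)" if x: "x \<in> X" for x
  proof -
    obtain y where "\<forall>\<^sub>F k in sequentially. I k x = y" using const[of "\<lambda>k. I k x"] x XE
      unfolding E_def by auto
    then show ?thesis using eventual_value_eq by metis
  qed
  have IT: "I k (T k x) = x" and TI: "T k (I k x) = x" if "x \<in> space M" for k x
    unfolding I_def using mpb_inverse_left[OF Tm that] mpb_inverse_right[OF Tm that] by auto
  have UX: "U x \<in> X \<and> V (U x) = x" if x: "x \<in> X" for x
  proof -
    have Ux: "U x = eventual_value (\<lambda>k. T k x)" using x XM unfolding U_def by auto
    obtain k where "T k x = U x" using eventually_happens'[OF _ evT[OF x]] Ux by auto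
    then have UxX: "U x \<in> X" using X_inv[OF x T\<Gamma>] by metis
    have "\<forall>\<^sub>F k in sequentially. I k (U x) = x"
      using evT[OF x] by (rule eventually_mono) (use IT x XM Ux in \<open>metis subsetD\<close>)
    then have "eventual_value (\<lambda>k. I k (U x)) = x" by (rule eventual_value_eq)
    then show ?thesis using UxX unfolding V_def by simp
  qed
  have VX: "V x \<in> X \<and> U (V x) = x" if x: "x \<in> X" for x
  proof -
    have Vx: "V x = eventual_value (\<lambda>k. I k x)" using x unfolding V_def by auto
    obtain k where "I k x = V x" using eventually_happens'[OF _ evI[OF x]] Vx by auto
    then have VxX: "V x \<in> X" using X_inv[OF x I\<Gamma>] by metis
    have "\<forall>\<^sub>F k in sequentially. T k (V x) = x"
      using evI[OF x] by (rule eventually_mono) (use TI x XM Vx in \<open>metis subsetD\<close>)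
    then have "eventual_value (\<lambda>k. T k (V x)) = x" by (rule eventual_value_eq)
    then show ?thesis using VxX XM unfolding U_def by auto
  qed
  have out: "U x = x" "V x = x" if "x \<in> space M" "x \<notin> X" for x using that unfolding U_def V_def
    by auto
  have Bij: "U \<in> Bij (space M)"
    unfolding Bij_def
  proof
    show "U \<in> extensional (space M)" unfolding U_def by simp
    have "bij_betw U (space M) (space M)"
    proof (rule bij_betw_byWitness[where f' = V])
      show "\<forall>x\<in>space M. V (U x) = x" using UX out by (metis (full_types))
      show "\<forall>x\<in>space M. U (V x) = x" using VX out by (metis (full_types))
      show "U ` space M \<subseteq> space M" using UX out XM by (metis image_subsetI subsetD)
      show "V ` space M \<subseteq> space M" using VX out XM by (metis image_subsetI subsetD)
    qed
    then show "U \<in> {f. bij_betw f (space M) (space M)}" by simp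
  qed
  \<comment> \<open>On \<open>A k\<close> the sequence has stabilised at stage k and the limit
    coincides with \<open>T k\<close>, so these sets provide the pieces for pasting.\<close>
  define A where "A = (\<lambda>k. X \<inter> {x \<in> space M. \<forall>j\<ge>k. T j x = T k x})"
  have A: "A k \<in> sets M" for k unfolding A_def
    by (intro sets.Int X sets.sets_Collect_countable_All sets.sets_Collect_imp sets.sets_Collect_const meas_eq Tm)
  have UA: "U x = T k x" if "x \<in> A k" for x k
  proof -
    have "\<forall>j\<ge>k. T j x = T k x" using that unfolding A_def by blast
    then have "\<forall>\<^sub>F j in sequentially. T j x = T k x" unfolding eventually_sequentially by blast
    then have "eventual_value (\<lambda>j. T j x) = T k x" by (rule eventual_value_eq)
    moreover have "x \<in> X" "x \<in> space M" using that XM unfolding A_def by blast+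
    ultimately show ?thesis unfolding U_def by simp
  qed
  have UH: "U \<in> H"
  proof (rule H_paste[OF Bij, of "insert (space M - X, \<lambda>x\<in>space M. x) (range (\<lambda>k. (A k, T k)))"])
    show "space M \<subseteq> \<Union>(fst ` insert (space M - X, \<lambda>x\<in>space M. x) (range (\<lambda>k. (A k, T k))))"
    proof
      fix x assume x: "x \<in> space M"
      show "x \<in> \<Union>(fst ` insert (space M - X, \<lambda>x\<in>space M. x) (range (\<lambda>k. (A k, T k))))"
      proof (cases "x \<in> X")
        case True
        then obtain N where "\<And>k. k \<ge> N \<Longrightarrow> T k x = eventual_value (\<lambda>k. T k x)"
          using evT unfolding eventually_sequentially by blast
        then have "x \<in> A N" using True x unfolding A_def by auto
        then show ?thesis by auto
      qed (use x in auto)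
    qed
  qed (use X A UA H_id Hf_H[OF T] out in auto)
  have dist: "edist (T k) U \<le> ennreal (2 * (1/2) ^ k)" for k
  proof -
    have ms: "disagreement M (T j) (T (Suc j)) \<in> sets M" for j
      using disagreement_sets[OF std] mpbD(3) Tm by blast
    have "disagreement M (T k) U \<subseteq> (space M - X) \<union> (\<Union>j. disagreement M (T (j + k)) (T (Suc (j + k))))"
    proof
      fix x assume x: "x \<in> disagreement M (T k) U"
      show "x \<in> (space M - X) \<union> (\<Union>j. disagreement M (T (j + k)) (T (Suc (j + k))))"
      proof (rule ccontr)
        assume no: "\<not> ?thesis"
        then have xX: "x \<in> X" and eq: "\<And>j. T (j + k) x = T (Suc (j + k)) x"
          using x unfolding disagreement_def by auto
        have "T (j + k) x = T k x" for j by (induction j) (use eq in auto)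
        then have "x \<in> A k" using xX XM unfolding A_def by (auto simp: le_iff_add add.commute)
        then show False using UA x unfolding disagreement_def by auto
      qed
    qed
    then have "edist (T k) U \<le> emeasure M ((space M - X) \<union> (\<Union>j. disagreement M (T (j + k)) (T (Suc (j + k)))))"
      using X ms by (intro emeasure_mono) auto
    also have "\<dots> = emeasure M (\<Union>j. disagreement M (T (j + k)) (T (Suc (j + k))))"
      using X_AE X ms by (intro emeasure_eq_AE) auto
    also have "\<dots> \<le> (\<Sum>j. edist (T (j + k)) (T (Suc (j + k))))"
      using ms by (intro emeasure_subadditive_countably) auto
    also have "\<dots> \<le> (\<Sum>j. ennreal ((1/2) ^ (j + k)))" by (intro suminf_le small) auto
    also have "\<dots> = ennreal (\<Sum>j. (1/2) ^ (j + k))"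
      by (intro suminf_ennreal2) (auto simp: power_add intro: summable_mult2 summable_geometric)
    also have "(\<Sum>j. (1/2::real) ^ (j + k)) = 2 * (1/2) ^ k"
      using suminf_mult2[OF summable_geometric[of "1/2::real"], of "(1/2) ^ k"]
        suminf_geometric[of "1/2::real"]
      by (simp add: power_add)
    finally show ?thesis .
  qed
  have "edist U (T 0) < \<infinity>" using dist[of 0]
    by (auto simp: disagreement_sym[of M U] less_top[symmetric] top_unique)
  then have "U \<in> Hf" using Hf_near[OF T UH] by blast
  with dist that show thesis by blast
qed

lemma udist_complete: "UM.mcomplete"
  unfolding UM.mcomplete_def
proof (intro allI impI)
  fix \<sigma> assume \<sigma>: "UM.MCauchy \<sigma>"
  have \<sigma>G: "\<sigma> n \<in> finite_support_part M G" for n using \<sigma> unfolding UM.MCauchy_def by auto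
  have "\<exists>N. \<forall>m n. N \<le> m \<longrightarrow> N \<le> n \<longrightarrow> udist (\<sigma> m) (\<sigma> n) < (1/2) ^ k" for k
    using \<sigma> unfolding UM.MCauchy_def by (metis zero_less_power half_gt_zero zero_less_one)
  then obtain N where N: "\<And>k m n. N k \<le> m \<Longrightarrow> N k \<le> n \<Longrightarrow> udist (\<sigma> m) (\<sigma> n) < (1/2) ^ k" by metis
  define r where "r = rec_nat (N 0) (\<lambda>k p. max (Suc p) (N (Suc k)))"
  have rS: "r (Suc k) = max (Suc (r k)) (N (Suc k))" for k unfolding r_def by simp
  have rN: "r k \<ge> N k" for k by (cases k) (simp_all add: rS, simp add: r_def)
  have mono: "strict_mono r" by (rule strict_monoI_Suc) (simp add: rS)
  define T where "T = (\<lambda>k. rep (\<sigma> (r k)))"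
  have T: "T k \<in> Hf" "aut_class M (T k) = \<sigma> (r k)" for k unfolding T_def using rep[OF \<sigma>G] by auto
  have step: "edist (T k) (T (Suc k)) \<le> ennreal ((1/2) ^ k)" for k
  proof -
    have "r (Suc k) \<ge> N k" using rN[of k] by (simp add: rS)
    then have "udist (\<sigma> (r k)) (\<sigma> (r (Suc k))) < (1/2) ^ k" using N rN by blast
    then show ?thesis unfolding T_def udist_rep[OF \<sigma>G \<sigma>G, symmetric] by (intro ennreal_leI) simp
  qed
  obtain U where U: "U \<in> Hf" "\<And>k. edist (T k) U \<le> ennreal (2 * (1/2) ^ k)"
    by (rule ex_limit[of T, OF T(1) step]) (rule that)
  have UG: "aut_class M U \<in> finite_support_part M G" using U unfolding finite_support_part_eq
    by auto
  have le: "udist (\<sigma> (r k)) (aut_class M U) \<le> 2 * (1/2) ^ k" for k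
  proof -
    have "ennreal (udist (\<sigma> (r k)) (aut_class M U)) \<le> ennreal (2 * (1/2) ^ k)"
      using U(2)[of k] udist_class[OF T(1) U(1), of k] unfolding T(2) by simp
    then show ?thesis by (subst (asm) ennreal_le_iff) auto
  qed
  have "limitin UM.mtopology (\<sigma> \<circ> r) (aut_class M U) sequentially"
    unfolding UM.limit_metric_sequentially
  proof (intro conjI UG allI impI)
    fix e :: real assume "e > 0"
    then obtain K where K: "(1/2) ^ K < e / 2" using real_arch_pow_inv[of "e / 2" "1/2"] by auto
    have "udist (\<sigma> (r k)) (aut_class M U) < e" if "k \<ge> K" for k
    proof -
      have "(1/2::real) ^ k \<le> (1/2) ^ K" using that by (intro power_decreasing) auto
      then show ?thesis using le[of k] K by linarith
    qed
    then show "\<exists>N. \<forall>n\<ge>N. (\<sigma> \<circ> r) n \<in> finite_support_part M G \<and> udist ((\<sigma> \<circ> r) n) (aut_class M U) < e"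
      using \<sigma>G by (intro exI[of _ K]) auto
  qed
  then have "limitin UM.mtopology \<sigma> (aut_class M U) sequentially"
    by (rule UM.MCauchy_convergent_subsequence[OF \<sigma> mono])
  then show "\<exists>x. limitin UM.mtopology \<sigma> x sequentially" by blast
qed

lemma polish_group_if_separable:
  assumes "separable_space UM.mtopology"
  shows "polish_group_topology Gf UM.mtopology"
  unfolding polish_group_topology_def polish_topology_def completely_metrizable_space_def
  using assms group_Gf continuous_mult continuous_inverse udist_complete UM.Metric_space_axioms
    by auto

section \<open>Separability of the uniform metric for a countable relation\<close>

text \<open>An approximant described by finitely many data, the first matching entry deciding and
  the identity being the default. It need not be injective, so it is compared with group elements
  only as a measurable map.\<close>

definition patch :: "('a set \<times> ('a \<Rightarrow> 'a)) list \<Rightarrow> 'a \<Rightarrow> 'a" where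
  "patch L x = foldr (\<lambda>(D, f) y. if x \<in> D then f x else y) L x"

lemma patch_measurable:
  "(\<And>D f. (D, f) \<in> set L \<Longrightarrow> D \<in> sets M \<and> f \<in> measurable M M) \<Longrightarrow> patch L \<in> measurable M M"
proof (induction L)
  case Nil
  have "patch [] = (\<lambda>x. x)" unfolding patch_def by auto
  then show ?case by simp
next
  case (Cons p L)
  obtain D f where p: "p = (D, f)" by (cases p)
  have [measurable]: "D \<in> sets M" "f \<in> measurable M M" "patch L \<in> measurable M M" using Cons p
    by auto
  have "patch (p # L) = (\<lambda>x. if x \<in> D then f x else patch L x)" unfolding patch_def p by auto
  then show ?case by simp
qed

lemma patch_eq:
  assumes "\<And>D f. (D, f) \<in> set L \<Longrightarrow> x \<in> D \<Longrightarrow> f x = y" "(\<exists>(D, f)\<in>set L. x \<in> D) \<or> x = y"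
  shows "patch L x = y"
  using assms
proof (induction L)
  case (Cons p L)
  obtain D f where p: "p = (D, f)" by (cases p)
  show ?case
  proof (cases "x \<in> D")
    case True then show ?thesis using Cons.prems(1)[of D f] unfolding patch_def p by auto
  next
    case False
    then have "patch L x = y" using Cons p by auto
    then show ?thesis using False unfolding patch_def p by auto
  qed
qed (auto simp: patch_def)

text \<open>An element of finite support is cut along the first function of the cover with which it
  agrees; finitely many cells, replaced by members of a countable dense family of sets, yield a
  \<open>patch\<close> close to it. There are only countably many such patches.\<close>

lemma separable_if_covered:
  assumes \<F>: "countable \<F>" "\<F> \<subseteq> measurable M M" and cov: "\<And>T. T \<in> H \<Longrightarrow> AE x in M. \<exists>f\<in>\<F>. T x = f x"
  shows "separable_space UM.mtopology"
proof -
  obtain \<D> where \<D>: "countable \<D>" "\<D> \<subseteq> sets M"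
    "\<And>B e. B \<in> sets M \<Longrightarrow> emeasure M B < \<infinity> \<Longrightarrow> e > 0 \<Longrightarrow> \<exists>D\<in>\<D>. emeasure M (sym_diff B D) < ennreal e"
    using countable_dense_measure_algebra[OF std sf] by metis
  let ?F = "insert (\<lambda>x. x) \<F>"
  define f where "f = from_nat_into ?F"
  have ran: "range f = ?F" unfolding f_def using \<F>(1) by (intro range_from_nat_into) auto
  have fm: "f n \<in> measurable M M" for n
  proof -
    have "f n \<in> ?F" using ran by blast
    then show ?thesis using \<F>(2) by auto
  qed
  define \<L> where "\<L> = lists (\<D> \<times> range f)"
  have \<L>: "countable \<L>" unfolding \<L>_def using \<D>(1) by (intro countable_lists) auto
  have pm: "patch L \<in> measurable M M" if "L \<in> \<L>" for L
    using that \<D>(2) fm unfolding \<L>_def by (intro patch_measurable) (auto simp: lists_eq_set)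
  have approx: "\<exists>L\<in>\<L>. edist T (patch L) < ennreal e" if T: "T \<in> Hf" and e: "e > 0" for T e
  proof -
    note Tm = Hf_measurable[OF T]
    define W where "W = support M T"
    have W: "W \<in> sets M" "emeasure M W < \<infinity>"
      unfolding W_def support_eq using T disagreement_sets[OF std Tm mpbD(3)[OF mpb_id]]
      unfolding Hf_def by auto
    define B where "B = (\<lambda>n. W \<inter> ({x \<in> space M. T x = f n x} - (\<Union>m<n. {x \<in> space M. T x = f m x})))"
    have eqm: "{x \<in> space M. T x = f n x} \<in> sets M" for n
      by (rule sets_Collect_eq_standard_borel[OF std Tm fm])
    have B: "B n \<in> sets M" "emeasure M (B n) < \<infinity>" for n
    proof -
      show "B n \<in> sets M" unfolding B_def using W(1) eqm by auto
      have "emeasure M (B n) \<le> emeasure M W" using W(1) by (intro emeasure_mono) (auto simp: B_def)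
      then show "emeasure M (B n) < \<infinity>" using W(2) by (rule le_less_trans)
    qed
    define K where "K = (\<lambda>N. W - (\<Union>n<N. B n))"
    have K: "K N \<in> sets M" for N unfolding K_def using W(1) B(1) by auto
    have "(\<lambda>N. emeasure M (K N)) \<longlonglongrightarrow> emeasure M (\<Inter>N. K N)"
    proof (rule Lim_emeasure_decseq)
      show "decseq K" unfolding K_def decseq_def by fastforce
      show "emeasure M (K i) \<noteq> \<infinity>" for i
        using W emeasure_mono[of "K i" W M] unfolding K_def
          by (auto simp: top_unique less_top[symmetric])
    qed (use K in auto)
    moreover have "(\<Inter>N. K N) \<in> null_sets M"
    proof -
      have "AE x in M. x \<notin> (\<Inter>N. K N)"
        using cov[OF Hf_H[OF T]] AE_space
      proof eventually_elim
        case (elim x)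
        then obtain n0 where n0: "T x = f n0 x" using ran by (metis insertI2 rangeE)
        define n where "n = (LEAST n. T x = f n x)"
        have n: "T x = f n x" "\<And>m. m < n \<Longrightarrow> T x \<noteq> f m x"
          unfolding n_def using LeastI[of "\<lambda>n. T x = f n x", OF n0] not_less_Least by auto
        have "x \<in> B n" if "x \<in> W" using n elim(2) that unfolding B_def by auto
        then have "x \<notin> K (Suc n)" unfolding K_def by auto
        then show ?case by blast
      qed
      moreover have "(\<Inter>N. K N) \<in> sets M" using K by auto
      ultimately show ?thesis using AE_iff_null_sets by blast
    qed
    ultimately have "(\<lambda>N. emeasure M (K N)) \<longlonglongrightarrow> 0" by auto
    then have "\<forall>\<^sub>F N in sequentially. emeasure M (K N) < ennreal (e / 2)"
      using e by (intro order_tendstoD(2)) auto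
    then obtain N where N: "emeasure M (K N) < ennreal (e / 2)"
      by (auto simp: eventually_sequentially)
    \<comment> \<open>Each of the \<open>N\<close> cells may contribute an error \<open>d\<close>;
      the denominator contains \<open>N + 1\<close> so that the total stays below
      \<open>e / 2\<close> and the case \<open>N = 0\<close> is included.\<close>
    define d where "d = e / (2 * (real N + 1))"
    have d: "d > 0" "real N * d < e / 2" unfolding d_def using e by (auto simp: field_simps)
    have "\<forall>n. \<exists>D\<in>\<D>. emeasure M (sym_diff (B n) D) < ennreal d" using \<D>(3) B d(1) by blast
    then obtain D where D: "\<And>n. D n \<in> \<D>" "\<And>n. emeasure M (sym_diff (B n) (D n)) < ennreal d"
      by metis
    have Dm: "D n \<in> sets M" for n using D(1) \<D>(2) by blast
    define L where "L = map (\<lambda>n. (D n, f n)) [0..<N]"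
    have L: "L \<in> \<L>" unfolding L_def \<L>_def using D(1) by (auto simp: lists_eq_set)
    have setL: "set L = (\<lambda>n. (D n, f n)) ` {..<N}" unfolding L_def by (auto simp: atLeast0LessThan)
    have "disagreement M T (patch L) \<subseteq> K N \<union> (\<Union>n<N. sym_diff (B n) (D n))"
    proof (rule subsetI, rule ccontr)
      fix x assume x: "x \<in> disagreement M T (patch L)" "x \<notin> K N \<union> (\<Union>n<N. sym_diff (B n) (D n))"
      have xM: "x \<in> space M" using x unfolding disagreement_def by auto
      have BD: "x \<in> B n \<longleftrightarrow> x \<in> D n" if "n < N" for n using x(2) that by auto
      have "patch L x = T x"
      proof (rule patch_eq)
        fix D' f' assume "(D', f') \<in> set L" "x \<in> D'"
        then obtain n where "n < N" "f' = f n" "x \<in> D n" unfolding setL by auto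
        then have "x \<in> B n" "f' = f n" using BD by auto
        then show "f' x = T x" unfolding B_def by auto
      next
        show "(\<exists>(D, f)\<in>set L. x \<in> D) \<or> x = T x"
        proof (cases "x \<in> W")
          case False then show ?thesis using xM unfolding W_def support_def by auto
        next
          case True
          then obtain n where "n < N" "x \<in> B n" using x(2) unfolding K_def by auto
          then show ?thesis using BD unfolding setL by auto
        qed
      qed
      then show False using x unfolding disagreement_def by auto
    qed
    then have "edist T (patch L) \<le> emeasure M (K N \<union> (\<Union>n<N. sym_diff (B n) (D n)))"
      using K B Dm by (intro emeasure_mono) auto
    also have "\<dots> \<le> emeasure M (K N) + emeasure M (\<Union>n<N. sym_diff (B n) (D n))"
      using K B Dm by (intro emeasure_subadditive) auto
    also have "\<dots> \<le> emeasure M (K N) + (\<Sum>n<N. emeasure M (sym_diff (B n) (D n)))"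
      using B Dm by (intro add_left_mono emeasure_subadditive_finite) auto
    also have "\<dots> \<le> emeasure M (K N) + (\<Sum>n<N. ennreal d)"
      using D(2) by (intro add_left_mono sum_mono) (auto intro: less_imp_le)
    also have "\<dots> = emeasure M (K N) + ennreal (real N * d)"
      using d(1) by (simp add: ennreal_of_nat_eq_real_of_nat ennreal_mult)
    also have "\<dots> < ennreal (e / 2) + ennreal (e / 2)"
      using N d e by (intro add_strict_mono ennreal_lessI) auto
    also have "\<dots> = ennreal e" using e by (simp flip: ennreal_plus)
    finally show ?thesis using L by blast
  qed
  \<comment> \<open>Patches lie outside the group in general, so each patch and each scale select
    one group element nearby. Where none exists \<open>SOME\<close> is arbitrary, which is why
    \<open>C\<close> keeps only the choices lying in \<open>Hf\<close>.\<close>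
  define c where "c = (\<lambda>(L, k::nat). SOME T. T \<in> Hf \<and> edist T (patch L) < ennreal (inverse (real (Suc k))))"
  define C where "C = (\<lambda>p. aut_class M (c p)) ` {p \<in> \<L> \<times> UNIV. c p \<in> Hf}"
  have "countable (\<L> \<times> (UNIV :: nat set))" using \<L> by simp
  then have "countable {p \<in> \<L> \<times> UNIV. c p \<in> Hf}" by (rule countable_subset[rotated]) auto
  then have "countable C" unfolding C_def by (rule countable_image)
  moreover have CG: "C \<subseteq> finite_support_part M G" unfolding C_def finite_support_part_eq by auto
  moreover have "UM.mtopology closure_of C = finite_support_part M G"
  proof -
    have "\<exists>t\<in>C. t \<in> UM.mball s r" if s: "s \<in> finite_support_part M G" and r: "r > 0" for s r
    proof -
      note R = rep[OF s]
      obtain k :: nat where k: "inverse (real (Suc k)) < r / 2"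
        using reals_Archimedean[of "r / 2"] r by auto
      obtain L where L: "L \<in> \<L>" "edist (rep s) (patch L) < ennreal (inverse (real (Suc k)))"
        using approx[of "rep s" "inverse (real (Suc k))"] R by auto
      then have c: "c (L, k) \<in> Hf" "edist (c (L, k)) (patch L) < ennreal (inverse (real (Suc k)))"
        unfolding c_def using someI[of "\<lambda>T. T \<in> Hf \<and> edist T (patch L) < ennreal (inverse (real (Suc k)))" "rep s"] R
        by auto
      have "edist (rep s) (c (L, k)) \<le> edist (rep s) (patch L) + edist (patch L) (c (L, k))"
        by (rule edist_triangle[OF Hf_measurable pm[OF L(1)] Hf_measurable]) (use R c in auto)
      also have "\<dots> < ennreal (inverse (real (Suc k))) + ennreal (inverse (real (Suc k)))"
        using L(2) c(2) by (intro add_strict_mono) (auto simp: disagreement_sym)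
      also have "\<dots> \<le> ennreal r" using k by (simp flip: ennreal_plus add: ennreal_leI)
      finally have "ennreal (udist s (aut_class M (c (L, k)))) < ennreal r"
        using udist_class[of "rep s" "c (L, k)"] R c(1) by simp
      then have "udist s (aut_class M (c (L, k))) < r" using udist_nonneg
        by (simp add: ennreal_less_iff)
      moreover have "aut_class M (c (L, k)) \<in> C" unfolding C_def using L c by auto
      ultimately show ?thesis using s CG by (intro bexI[of _ "aut_class M (c (L, k))"]) auto
    qed
    then show ?thesis unfolding UM.metric_closure_of by blast
  qed
  ultimately show ?thesis unfolding separable_space_def by auto
qed

lemma polish_if_full_group_of_relation:
  assumes R: "countable_equivalence_relation M R" and GR: "G = full_group_of_relation M R"
  shows "polish_group_topology Gf UM.mtopology"
proof -
  have R': "R \<in> sets (M \<Otimes>\<^sub>M M)" "\<And>x. x \<in> space M \<Longrightarrow> countable (R `` {x})" "equiv (space M) R"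
    using R unfolding countable_equivalence_relation_def by auto
  obtain \<F> where \<F>: "countable \<F>" "\<F> \<subseteq> measurable M M"
    "\<And>A g. A \<in> sets M \<Longrightarrow> g \<in> measurable M M \<Longrightarrow> \<forall>x\<in>A. (x, g x) \<in> R \<Longrightarrow>
       AE x in M. x \<in> A \<longrightarrow> (\<exists>f\<in>\<F>. g x = f x)"
    by (rule countable_sections_covered[OF std sf R'(1)]) (rule R'(2), assumption, rule that)
  have "AE x in M. \<exists>f\<in>\<F>. T x = f x" if T: "T \<in> H" for T
  proof -
    have Tm: "T \<in> mpb M" using H_mpb[OF T] .
    have "aut_class M T \<in> full_group_of_relation M R" using T GR unfolding H_def by auto
    then obtain S where S: "S \<in> mpb M" "aut_class M T = aut_class M S" "AE x in M. (S x, x) \<in> R"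
      unfolding full_group_of_relation_def by blast
    have "AE x in M. T x = S x" using S(2) aut_class_eq_iff[OF Tm S(1)] by simp
    \<comment> \<open>Symmetry of the relation reconciles the two orientations: the full group is
      defined by pairs (T x, x), the cover concerns sections (x, T x).\<close>
    with S(3) have TR: "AE x in M. (x, T x) \<in> R"
      by eventually_elim (use R'(3) in \<open>auto simp: equiv_def dest: symD\<close>)
    have "(\<lambda>x. (x, T x)) \<in> measurable M (M \<Otimes>\<^sub>M M)" using mpbD(3)[OF Tm] by simp
    from measurable_sets[OF this R'(1)]
    have "{x \<in> space M. (x, T x) \<in> R} \<in> sets M" by (simp add: vimage_def Int_def conj_commute)
    from \<F>(3)[OF this mpbD(3)[OF Tm]]
    have "AE x in M. x \<in> {x \<in> space M. (x, T x) \<in> R} \<longrightarrow> (\<exists>f\<in>\<F>. T x = f x)" by blast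
    then show ?thesis using TR AE_space by eventually_elim auto
  qed
  then show ?thesis using polish_group_if_separable separable_if_covered[OF \<F>(1,2)] by blast
qed

end

section \<open>Polish group topologies\<close>

context ergodic_full_group
begin

section \<open>Supports described through commutation\<close>

lemma finite_exhaustion:
  obtains Y :: "nat \<Rightarrow> 'a set" where "\<And>n. Y n \<in> sets M" "\<And>n. emeasure M (Y n) < \<infinity>" "incseq Y"
    "(\<Union>n. Y n) = space M"
proof -
  obtain Y :: "nat \<Rightarrow> 'a set" where "range Y \<subseteq> sets M" "(\<Union>i. Y i) = space M"
    "\<And>i. emeasure M (Y i) \<noteq> \<infinity>" "incseq Y"
    using sigma_finite_incseq by blast
  then show thesis using that[of Y] by (auto simp: less_top)
qed

text \<open>The infinite total measure enters here: outside a set of finite measure the exhaustion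
  still has unbounded measure.\<close>

lemma ex_large_finite:
  assumes Y: "\<And>n. Y n \<in> sets M" "incseq Y" "(\<Union>n. Y n) = space M"
    and W: "W \<in> sets M" "emeasure M W < \<infinity>" and c: "c < \<infinity>"
  shows "\<exists>n. c \<le> emeasure M (Y n - W)"
proof -
  have "emeasure M (space M - W) = \<infinity>"
    using emeasure_Diff[of M W "space M"] W infinite sets.sets_into_space[OF W(1)] by auto
  moreover have "(\<lambda>n. emeasure M (Y n - W)) \<longlonglongrightarrow> emeasure M (\<Union>n. Y n - W)"
    using Y W by (intro Lim_emeasure_incseq) (auto simp: incseq_def)
  moreover have "(\<Union>n. Y n - W) = space M - W" using Y(3) by auto
  ultimately have "(\<lambda>n. emeasure M (Y n - W)) \<longlonglongrightarrow> \<infinity>" by simp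
  then have "\<forall>\<^sub>F n in sequentially. c < emeasure M (Y n - W)" using c by (rule order_tendstoD(1))
  then show ?thesis by (auto simp: eventually_sequentially intro: less_imp_le)
qed

lemma Hf_supported:
  assumes U: "U \<in> H" and A: "A \<in> sets M" "emeasure M A < \<infinity>"
    and fixed: "AE x in M. x \<notin> A \<longrightarrow> U x = x"
  shows "U \<in> Hf"
proof -
  have "edist U (\<lambda>x\<in>space M. x) \<le> emeasure M A"
  proof (rule emeasure_mono_AE)
    show "AE x in M. x \<in> disagreement M U (\<lambda>x\<in>space M. x) \<longrightarrow> x \<in> A"
      using fixed by eventually_elim (auto simp: disagreement_def)
  qed (rule A)
  then show ?thesis using U A unfolding Hf_def by auto
qed

text \<open>Atomlessness splits a part of \<open>C\<close> of finite positive measure into two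
  nonnull pieces, and an involution carries the smaller one into the larger one.\<close>

lemma ex_nontrivial:
  assumes C: "C \<in> sets M" "C \<notin> null_sets M"
  obtains S where "S \<in> Hf" "\<And>x. x \<in> space M \<Longrightarrow> x \<notin> C \<Longrightarrow> S x = x" "\<not> (AE x in M. x \<in> C \<longrightarrow> S x = x)"
proof -
  obtain Y :: "nat \<Rightarrow> 'a set" where Y: "\<And>n. Y n \<in> sets M" "\<And>n. emeasure M (Y n) < \<infinity>" "incseq Y"
    "(\<Union>n. Y n) = space M" using finite_exhaustion by metis
  have "\<exists>n. C \<inter> Y n \<notin> null_sets M"
  proof (rule ccontr)
    assume "\<not> ?thesis"
    then have "(\<Union>n. C \<inter> Y n) \<in> null_sets M" by (intro null_sets_UN) auto
    moreover have "(\<Union>n. C \<inter> Y n) = C" using Y(4) sets.sets_into_space[OF C(1)] by auto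
    ultimately show False using C by simp
  qed
  then obtain n where n: "C \<inter> Y n \<notin> null_sets M" by blast
  define C' where "C' = C \<inter> Y n"
  have C': "C' \<in> sets M" "C' \<subseteq> C" "emeasure M C' > 0" "emeasure M C' < \<infinity>"
  proof -
    show s: "C' \<in> sets M" "C' \<subseteq> C" unfolding C'_def using C Y by auto
    show "emeasure M C' > 0" using n s unfolding C'_def
      by (auto simp: null_sets_def zero_less_iff_neq_zero)
    have "emeasure M C' \<le> emeasure M (Y n)" using Y by (intro emeasure_mono) (auto simp: C'_def)
    then show "emeasure M C' < \<infinity>" using Y(2) by (rule le_less_trans)
  qed
  obtain D where D: "D \<in> sets M" "D \<subseteq> C'" "0 < emeasure M D" "emeasure M D < emeasure M C'"
    using atomless C'(1,3) unfolding atomless_def by blast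
  have Dfin: "emeasure M D < \<infinity>" using D(4) C'(4) by (rule less_trans)
  have "emeasure M (C' - D) = emeasure M C' - emeasure M D" using C' D Dfin
    by (intro emeasure_Diff) auto
  then have E: "0 < emeasure M (C' - D)" using D(4) by (simp add: diff_gr0_ennreal)
  have Efin: "emeasure M (C' - D) < \<infinity>"
    using emeasure_mono[of "C' - D" C' M] C' by (auto intro: le_less_trans)
  obtain A B where AB: "A \<in> sets M" "B \<in> sets M" "A \<inter> B = {}" "A \<union> B \<subseteq> C'"
    "emeasure M A \<le> emeasure M B"
    "emeasure M B < \<infinity>" "0 < emeasure M A"
  proof (cases "emeasure M D \<le> emeasure M (C' - D)")
    case True then show thesis using that[of D "C' - D"] D C' E Efin by auto
  next
    case False
    have "(C' - D) \<inter> D = {}" "(C' - D) \<union> D \<subseteq> C'" "C' - D \<in> sets M" using D(1,2) C'(1) by auto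
    then show thesis using that[of "C' - D" D] D(1) E Dfin False by simp
  qed
  obtain U where U: "U \<in> H" "\<And>x. x \<in> space M \<Longrightarrow> x \<notin> A \<union> B \<Longrightarrow> U x = x" "AE x in M. x \<in> A \<longrightarrow> U x \<in> B"
    using ex_involution_disjoint[OF AB(1,2,3,5,6)] by metis
  show thesis
  proof (rule that[of U])
    show fx: "U x = x" if "x \<in> space M" "x \<notin> C" for x using U(2)[OF that(1)] that AB(4) C'(2)
      by blast
    have "AE x in M. x \<notin> C' \<longrightarrow> U x = x" using AE_space by eventually_elim (use U(2) AB(4) in blast)
    then show "U \<in> Hf" using Hf_supported[OF U(1) C'(1,4)] by blast
    show "\<not> (AE x in M. x \<in> C \<longrightarrow> U x = x)"
    proof
      assume "AE x in M. x \<in> C \<longrightarrow> U x = x"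
      with U(3) have "AE x in M. x \<notin> A" by eventually_elim (use AB(3,4) C'(2) in force)
      then have "A \<in> null_sets M" using AE_iff_null_sets[OF AB(1)] by blast
      then show False using AB(7) by auto
    qed
  qed
qed

text \<open>A moved point is separated from its image by some set \<open>E n\<close>. The points of
  \<open>E n\<close> that leave \<open>E n\<close> form a set disjoint from its image, and countably
  many such sets account for all moved points.\<close>

lemma ex_displaced:
  assumes T: "T \<in> H" and Z: "Z \<in> sets M" and nt: "\<not> (AE x in M. x \<in> Z \<longrightarrow> T x = x)"
  obtains C where "C \<in> sets M" "C \<subseteq> Z" "C \<notin> null_sets M" "T ` C \<inter> C = {}"
proof -
  obtain E :: "nat \<Rightarrow> 'a set" where E: "range E \<subseteq> sets M" "sets M = sigma_sets (space M) (range E)"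
    "\<And>x y. x \<in> space M \<Longrightarrow> y \<in> space M \<Longrightarrow> x \<noteq> y \<Longrightarrow> \<exists>n. x \<in> E n \<and> y \<notin> E n"
    using standard_borel_countable_base[OF std] by metis
  define C where "C = (\<lambda>n. Z \<inter> E n - (T -` E n \<inter> space M))"
  have C: "C n \<in> sets M" for n
    unfolding C_def using Z E(1) measurable_sets[OF mpbD(3)[OF H_mpb[OF T]]] by auto
  have "\<exists>n. C n \<notin> null_sets M"
  proof (rule ccontr)
    assume "\<not> ?thesis"
    then have "(\<Union>n. C n) \<in> null_sets M" by (intro null_sets_UN) auto
    then have "AE x in M. x \<notin> (\<Union>n. C n)" by (rule AE_not_in)
    then have "AE x in M. x \<in> Z \<longrightarrow> T x = x"
      using AE_space
    proof eventually_elim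
      case (elim x)
      show ?case
      proof (intro impI, rule ccontr)
        assume x: "x \<in> Z" "T x \<noteq> x"
        then obtain n where "x \<in> E n" "T x \<notin> E n"
          using E(3)[of x "T x"] elim(2) mpb_in_space[OF H_mpb[OF T]] by metis
        then have "x \<in> C n" unfolding C_def using x by auto
        then show False using elim(1) by blast
      qed
    qed
    then show False using nt by blast
  qed
  then obtain n where "C n \<notin> null_sets M" by blast
  then show thesis
    using that[of "C n"] C sets.sets_into_space[OF Z] unfolding C_def by blast
qed

text \<open>Bijections with disjoint supports commute. Conversely, if \<open>T\<close> moves points
  outside \<open>B\<close>, it displaces a nonnull set \<open>C\<close> there entirely, and a
  nontrivial \<open>S\<close> supported in \<open>C\<close> cannot commute with \<open>T\<close>.
  The criterion refers only to the group law, so it can be read in any group topology.\<close>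

lemma centralizer:
  assumes T: "T \<in> Hf" and B: "B \<in> sets M"
  shows "(AE x in M. x \<notin> B \<longrightarrow> T x = x) \<longleftrightarrow>
    (\<forall>S\<in>Hf. (\<forall>x\<in>B. S x = x) \<longrightarrow> (AE x in M. T (S x) = S (T x)))" (is "?L \<longleftrightarrow> ?R")
proof
  assume L: ?L
  note Tm = Hf_mpb[OF T]
  show ?R
  proof (intro ballI impI)
    fix S assume S: "S \<in> Hf" "\<forall>x\<in>B. S x = x"
    note Sm = Hf_mpb[OF S(1)]
    show "AE x in M. T (S x) = S (T x)"
      using L mpb_AE[OF Tm L] mpb_AE[OF Sm L] AE_space
    proof eventually_elim
      case (elim x)
      note sp = mpb_in_space[OF Tm elim(4)] mpb_in_space[OF Sm elim(4)]
      show ?case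
      proof (cases "x \<in> B")
        case True
        have "T x \<in> B"
        proof (rule ccontr)
          assume "T x \<notin> B"
          then have "T (T x) = T x" using elim(2) by blast
          then have "T x = x" using inj_onD[OF mpbD(6)[OF Tm] _ sp(1) elim(4)] by blast
          then show False using True \<open>T x \<notin> B\<close> by simp
        qed
        then show ?thesis using True S(2) by simp
      next
        case False
        have "S x \<notin> B"
        proof
          assume "S x \<in> B"
          then have "S (S x) = S x" using S(2) by blast
          then have "S x = x" using inj_onD[OF mpbD(6)[OF Sm] _ sp(2) elim(4)] by blast
          then show False using False \<open>S x \<in> B\<close> by simp
        qed
        then show ?thesis using elim(1,3) False by simp
      qed
    qed
  qed
next
  assume R: ?R
  show ?L
  proof (rule ccontr)
    assume nL: "\<not> ?L"
    have "\<not> (AE x in M. x \<in> space M - B \<longrightarrow> T x = x)"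
    proof
      assume "AE x in M. x \<in> space M - B \<longrightarrow> T x = x"
      then have ?L using AE_space by eventually_elim auto
      then show False using nL by blast
    qed
    then obtain C where C: "C \<in> sets M" "C \<subseteq> space M - B" "C \<notin> null_sets M" "T ` C \<inter> C = {}"
      using ex_displaced[OF Hf_H[OF T], of "space M - B"] B by blast
    obtain S where S: "S \<in> Hf" "\<And>x. x \<in> space M \<Longrightarrow> x \<notin> C \<Longrightarrow> S x = x" "\<not> (AE x in M. x \<in> C \<longrightarrow> S x = x)"
      using ex_nontrivial[OF C(1,3)] by metis
    note Tm = Hf_mpb[OF T] and Sm = Hf_mpb[OF S(1)]
    have "S x = x" if "x \<in> B" for x using S(2)[of x] that C(2) sets.sets_into_space[OF B] by blast
    then have "AE x in M. T (S x) = S (T x)" using R S(1) by blast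
    then have "AE x in M. x \<in> C \<longrightarrow> S x = x"
      using AE_space
    proof eventually_elim
      case (elim x)
      note sp = mpb_in_space[OF Tm elim(2)] mpb_in_space[OF Sm elim(2)]
      show ?case
      proof
        assume x: "x \<in> C"
        then have "T x \<notin> C" using C(4) by blast
        then have "T (S x) = T x" using elim(1) S(2)[OF sp(1)] by simp
        then show "S x = x" using inj_onD[OF mpbD(6)[OF Tm] _ sp(2) elim(2)] by blast
      qed
    qed
    then show False using S(3) by blast
  qed
qed

definition supported_in :: "'a set \<Rightarrow> ('a \<Rightarrow> 'a) set set" where
  "supported_in B = {s \<in> finite_support_part M G. AE x in M. x \<notin> B \<longrightarrow> rep s x = x}"

lemma class_finite_support: "T \<in> Hf \<Longrightarrow> aut_class M T \<in> finite_support_part M G"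
  unfolding finite_support_part_eq by simp

lemma supported_in_class:
  assumes "T \<in> Hf"
  shows "aut_class M T \<in> supported_in B \<longleftrightarrow> (AE x in M. x \<notin> B \<longrightarrow> T x = x)"
proof -
  have "(AE x in M. x \<notin> B \<longrightarrow> rep (aut_class M T) x = x) \<longleftrightarrow> (AE x in M. x \<notin> B \<longrightarrow> T x = x)"
    by (rule eventually_cong[OF rep_AE[OF assms]]) simp
  then show ?thesis using class_finite_support[OF assms] unfolding supported_in_def by simp
qed

text \<open>By \<open>centralizer\<close> the set is an intersection of coincidence sets of left and
  right translations, and these are closed in a Hausdorff topological group.\<close>

lemma closedin_supported_in:
  assumes P: "polish_group_topology Gf \<tau>" and B: "B \<in> sets M"
  shows "closedin \<tau> (supported_in B)"
proof -
  let ?F = "finite_support_part M G"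
  have \<tau>: "topspace \<tau> = ?F" "Hausdorff_space \<tau>"
    "continuous_map (prod_topology \<tau> \<tau>) \<tau> (\<lambda>(x, y). x \<otimes>\<^bsub>Gf\<^esub> y)"
    using P polish_Hausdorff unfolding polish_group_topology_def by auto
  define \<S> where "\<S> = {S \<in> Hf. \<forall>x\<in>B. S x = x}"
  have "(\<lambda>x\<in>space M. x) \<in> \<S>" unfolding \<S>_def using Hf_id sets.sets_into_space[OF B] by auto
  have "closedin \<tau> {s \<in> topspace \<tau>. s \<otimes>\<^bsub>Gf\<^esub> aut_class M S = aut_class M S \<otimes>\<^bsub>Gf\<^esub> s}"
    if S: "S \<in> \<S>" for S
  proof (rule closedin_continuous_maps_eq[OF \<tau>(2)])
    have c: "aut_class M S \<in> topspace \<tau>" using S class_finite_support \<tau>(1) unfolding \<S>_def by simp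
    have "continuous_map \<tau> (prod_topology \<tau> \<tau>) (\<lambda>s. (s, aut_class M S))"
      "continuous_map \<tau> (prod_topology \<tau> \<tau>) (\<lambda>s. (aut_class M S, s))"
      using c by (simp_all add: continuous_map_paired)
    from this[THEN continuous_map_compose, OF \<tau>(3)]
    show "continuous_map \<tau> \<tau> (\<lambda>s. s \<otimes>\<^bsub>Gf\<^esub> aut_class M S)"
      "continuous_map \<tau> \<tau> (\<lambda>s. aut_class M S \<otimes>\<^bsub>Gf\<^esub> s)"
      by (simp_all add: o_def)
  qed
  then have "closedin \<tau> (\<Inter>S\<in>\<S>. {s \<in> topspace \<tau>. s \<otimes>\<^bsub>Gf\<^esub> aut_class M S = aut_class M S \<otimes>\<^bsub>Gf\<^esub> s})"
    using \<open>_ \<in> \<S>\<close> by (intro closedin_INT) auto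
  moreover have "supported_in B = (\<Inter>S\<in>\<S>. {s \<in> topspace \<tau>. s \<otimes>\<^bsub>Gf\<^esub> aut_class M S = aut_class M S \<otimes>\<^bsub>Gf\<^esub> s})"
  proof -
    have comm: "aut_class M T \<otimes>\<^bsub>Gf\<^esub> aut_class M S = aut_class M S \<otimes>\<^bsub>Gf\<^esub> aut_class M T \<longleftrightarrow>
        (AE x in M. T (S x) = S (T x))" if TS: "T \<in> Hf" "S \<in> Hf" for S T
    proof -
      have "aut_class M T \<otimes>\<^bsub>Gf\<^esub> aut_class M S = aut_class M S \<otimes>\<^bsub>Gf\<^esub> aut_class M T \<longleftrightarrow>
        (AE x in M. compose (space M) T S x = compose (space M) S T x)"
        unfolding Gf_simps(1)[OF TS] Gf_simps(1)[OF TS(2,1)]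
        by (intro aut_class_eq_iff mpb_compose Hf_mpb TS)
      also have "\<dots> \<longleftrightarrow> (AE x in M. T (S x) = S (T x))"
        by (intro AE_cong) simp
      finally show ?thesis .
    qed
    have "s \<in> supported_in B \<longleftrightarrow> (\<forall>S\<in>\<S>. s \<otimes>\<^bsub>Gf\<^esub> aut_class M S = aut_class M S \<otimes>\<^bsub>Gf\<^esub> s)"
      if s: "s \<in> ?F" for s
    proof -
      obtain T where T: "T \<in> Hf" "s = aut_class M T" using s unfolding finite_support_part_eq
        by blast
      show ?thesis
        unfolding T(2) supported_in_class[OF T(1)] centralizer[OF T(1) B] \<S>_def using comm[OF T(1)]
          by auto
    qed
    moreover have "supported_in B \<subseteq> ?F" unfolding supported_in_def by blast
    ultimately show ?thesis using \<tau>(1) \<open>_ \<in> \<S>\<close> by auto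
  qed
  ultimately show ?thesis by simp
qed

section \<open>A coarse countable net from a Polish group topology\<close>

lemma involution_inverse:
  assumes U: "U \<in> mpb M" "\<And>x. x \<in> space M \<Longrightarrow> U (U x) = x"
  shows "mpb_inverse M U = U"
proof (rule mpb_eqI[OF mpb_inverse_mpb[OF U(1)] U(1)])
  fix x assume x: "x \<in> space M"
  have "mpb_inverse M U (U (U x)) = U x" by (rule mpb_inverse_left[OF U(1) mpb_in_space[OF U(1) x]])
  then show "mpb_inverse M U x = U x" using U(2)[OF x] by simp
qed

text \<open>An involution \<open>U\<close> carries the support of \<open>T\<close> into
  \<open>Y\<close>. It is the identity outside a set of finite measure, so it belongs to the group,
  and conjugating by it moves the support into \<open>Y\<close>.\<close>

lemma conjugate_into:
  assumes T: "T \<in> Hf" and Y: "Y \<in> sets M" "emeasure M Y < \<infinity>"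
    "emeasure M (support M T) \<le> emeasure M Y"
  shows "\<exists>g\<in>finite_support_part M G. \<exists>h\<in>supported_in Y. aut_class M T = g \<otimes>\<^bsub>Gf\<^esub> h \<otimes>\<^bsub>Gf\<^esub> inv\<^bsub>Gf\<^esub> g"
proof -
  note Tm = Hf_mpb[OF T]
  have s: "support M T \<in> sets M" "emeasure M (support M T) < \<infinity>"
    unfolding support_eq using T disagreement_sets[OF std mpbD(3)[OF Tm] mpbD(3)[OF mpb_id]]
      unfolding Hf_def by auto
  obtain U where U: "U \<in> H" "\<And>x. x \<in> space M \<Longrightarrow> U (U x) = x"
    "\<And>x. x \<in> space M \<Longrightarrow> x \<notin> support M T \<union> Y \<Longrightarrow> U x = x" "AE x in M. x \<in> support M T \<longrightarrow> U x \<in> Y"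
    by (rule ex_involution[OF s(1) Y(1,3,2)]) (rule that)
  have "emeasure M (support M T \<union> Y) \<le> emeasure M (support M T) + emeasure M Y"
    using s Y by (intro emeasure_subadditive) auto
  also have "\<dots> < \<infinity>" using s Y by auto
  finally have fin: "emeasure M (support M T \<union> Y) < \<infinity>" .
  have UF: "U \<in> Hf"
  proof (rule Hf_supported[OF U(1) _ fin])
    show "AE x in M. x \<notin> support M T \<union> Y \<longrightarrow> U x = x" using AE_space
      by eventually_elim (use U(3) in blast)
  qed (use s Y in auto)
  note Um = Hf_mpb[OF UF]
  define W where "W = compose (space M) U (compose (space M) T U)"
  have W: "W \<in> Hf" unfolding W_def by (intro Hf_compose UF T)
  note Wm = Hf_mpb[OF W]
  have "AE x in M. x \<notin> Y \<longrightarrow> W x = x"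
    using mpb_AE[OF Um U(4)] AE_space
  proof eventually_elim
    case (elim x)
    show ?case
    proof
      assume "x \<notin> Y"
      then have "U x \<notin> support M T" using elim U(2) by auto
      then have "T (U x) = U x" unfolding support_def using mpb_in_space[OF Um elim(2)] by auto
      then show "W x = x" unfolding W_def using elim(2) U(2) by simp
    qed
  qed
  then have h: "aut_class M W \<in> supported_in Y" using supported_in_class[OF W] by blast
  have "compose (space M) (compose (space M) U W) U = T"
  proof (rule mpb_eqI[OF mpb_compose[OF mpb_compose[OF Um Wm] Um] Tm])
    fix x assume x: "x \<in> space M"
    note sp = mpb_in_space[OF Um x] mpb_in_space[OF Tm x]
    show "compose (space M) (compose (space M) U W) U x = T x"
      unfolding W_def using x sp U(2) by simp
  qed
  moreover have "mpb_inverse M U = U" by (rule involution_inverse[OF Um]) (rule U(2))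
  ultimately have "aut_class M T = aut_class M U \<otimes>\<^bsub>Gf\<^esub> aut_class M W \<otimes>\<^bsub>Gf\<^esub> inv\<^bsub>Gf\<^esub> (aut_class M U)"
    using Gf_simps(2)[OF UF UF] Gf_simps(1)[OF UF W] Gf_simps(1)[OF Hf_compose[OF UF W] UF] by metis
  then show ?thesis using h class_finite_support[OF UF] by blast
qed

lemma udist_supported_in:
  assumes Y: "Y \<in> sets M" "emeasure M Y < \<infinity>" and h: "h \<in> supported_in Y"
  shows "udist h \<one>\<^bsub>Gf\<^esub> \<le> measure M Y"
proof -
  have hF: "h \<in> finite_support_part M G" and fx: "AE x in M. x \<notin> Y \<longrightarrow> rep h x = x"
    using h unfolding supported_in_def by auto
  have one: "\<one>\<^bsub>Gf\<^esub> = aut_class M (\<lambda>x\<in>space M. x)" by (simp add: Aut_def)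
  have "ennreal (udist h \<one>\<^bsub>Gf\<^esub>) = edist (rep h) (\<lambda>x\<in>space M. x)"
    using udist_class[of "rep h" "\<lambda>x\<in>space M. x"] rep[OF hF] Hf_id unfolding one by simp
  also have "\<dots> \<le> emeasure M Y"
  proof (rule emeasure_mono_AE)
    show "AE x in M. x \<in> disagreement M (rep h) (\<lambda>x\<in>space M. x) \<longrightarrow> x \<in> Y"
      using fx by eventually_elim (auto simp: disagreement_def)
  qed (rule Y)
  also have "\<dots> = ennreal (measure M Y)" using Y by (simp add: emeasure_eq_ennreal_measure less_top)
  finally show ?thesis by (simp add: ennreal_le_iff)
qed

text \<open>\<open>D\<close> is dense for \<open>\<tau>\<close>, while the net is one for the
  uniform distance. The bridge is the fact \<open>small\<close>: a translation under which the open
  set \<open>V\<close> meets itself is by an element at uniformly bounded distance from the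
  identity.\<close>

lemma ex_countable_net:
  assumes P: "polish_group_topology Gf \<tau>"
  obtains D c where "countable D" "D \<subseteq> finite_support_part M G"
    "\<And>t. t \<in> finite_support_part M G \<Longrightarrow> \<exists>d\<in>D. udist d t \<le> c"
proof -
  let ?F = "finite_support_part M G"
  interpret K: group Gf by (rule group_Gf)
  have pol: "polish_topology \<tau>" and top: "topspace \<tau> = ?F"
    and mult: "continuous_map (prod_topology \<tau> \<tau>) \<tau> (\<lambda>(x, y). x \<otimes>\<^bsub>Gf\<^esub> y)"
    and inv: "continuous_map \<tau> \<tau> (m_inv Gf)"
    using P unfolding polish_group_topology_def by auto
  have carr: "carrier Gf = ?F" by simp
  have mult': "continuous_map X \<tau> (\<lambda>x. f x \<otimes>\<^bsub>Gf\<^esub> g x)"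
    if "continuous_map X \<tau> f" "continuous_map X \<tau> g" for X :: "'c topology" and f g
  proof -
    have "continuous_map X (prod_topology \<tau> \<tau>) (\<lambda>x. (f x, g x))" using that
      by (simp add: continuous_map_paired)
    from continuous_map_compose[OF this mult] show ?thesis by (simp add: o_def)
  qed
  obtain Y :: "nat \<Rightarrow> 'a set" where Y: "\<And>n. Y n \<in> sets M" "\<And>n. emeasure M (Y n) < \<infinity>" "incseq Y"
    "(\<Union>n. Y n) = space M" using finite_exhaustion by metis
  define \<phi> where "\<phi> = (\<lambda>(g, h). g \<otimes>\<^bsub>Gf\<^esub> h \<otimes>\<^bsub>Gf\<^esub> inv\<^bsub>Gf\<^esub> g)"
  define Q where "Q = (\<lambda>n. prod_topology \<tau> (subtopology \<tau> (supported_in (Y n))))"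
  have sup_sub: "supported_in B \<subseteq> ?F" for B unfolding supported_in_def by blast
  have Qtop: "topspace (Q n) = ?F \<times> supported_in (Y n)" for n
    unfolding Q_def using top sup_sub by (auto simp: Int_absorb1)
  \<comment> \<open>This is what the closedness of \<open>supported_in\<close> provides: the
    parameter spaces of the conjugates are Polish.\<close>
  have Qpol: "polish_topology (Q n)" for n
    unfolding Q_def by (intro polish_prod_topology pol polish_closedin closedin_supported_in P Y)
  have Qcont: "continuous_map (Q n) \<tau> \<phi>" for n
  proof -
    have f: "continuous_map (Q n) \<tau> fst" unfolding Q_def by (rule continuous_map_fst)
    have "continuous_map (Q n) (subtopology \<tau> (supported_in (Y n))) snd" unfolding Q_def
      by (rule continuous_map_snd)
    then have s: "continuous_map (Q n) \<tau> snd" by (simp add: continuous_map_in_subtopology)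
    have "continuous_map (Q n) \<tau> (\<lambda>z. inv\<^bsub>Gf\<^esub> (fst z))"
      using continuous_map_compose[OF f inv] by (simp add: o_def)
    then have "continuous_map (Q n) \<tau> (\<lambda>z. fst z \<otimes>\<^bsub>Gf\<^esub> snd z \<otimes>\<^bsub>Gf\<^esub> inv\<^bsub>Gf\<^esub> (fst z))"
      by (intro mult' f s)
    then show ?thesis unfolding \<phi>_def by (simp add: case_prod_unfold)
  qed
  have cover: "?F = (\<Union>n. \<phi> ` topspace (Q n))"
  proof
    show "?F \<subseteq> (\<Union>n. \<phi> ` topspace (Q n))"
    proof
      fix s assume "s \<in> ?F"
      then obtain T where T: "T \<in> Hf" "s = aut_class M T" unfolding finite_support_part_eq by blast
      have "emeasure M (support M T) < \<infinity>" using T(1) unfolding Hf_def support_eq by blast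
      then obtain n where "emeasure M (support M T) \<le> emeasure M (Y n)"
        using ex_large_finite[OF Y(1,3,4), of "{}"] by auto
      then obtain g h where "g \<in> ?F" "h \<in> supported_in (Y n)" "s = g \<otimes>\<^bsub>Gf\<^esub> h \<otimes>\<^bsub>Gf\<^esub> inv\<^bsub>Gf\<^esub> g"
        using conjugate_into[OF T(1) Y(1,2)] T(2) by metis
      then have "s = \<phi> (g, h)" "(g, h) \<in> topspace (Q n)" unfolding \<phi>_def Qtop by auto
      then show "s \<in> (\<Union>n. \<phi> ` topspace (Q n))" by blast
    qed
    show "(\<Union>n. \<phi> ` topspace (Q n)) \<subseteq> ?F"
      using continuous_map_image_subset_topspace[OF Qcont] top by blast
  qed
  have sc: "second_countable \<tau>" and haus: "Hausdorff_space \<tau>" and cm: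
    "completely_metrizable_space \<tau>"
    using pol polish_second_countable polish_Hausdorff unfolding polish_topology_def by auto
  have one: "\<one>\<^bsub>Gf\<^esub> \<in> ?F" using K.one_closed by simp
  have "\<exists>n. \<not> meager_in \<tau> (\<phi> ` topspace (Q n))"
  proof (rule ccontr)
    assume "\<not> ?thesis"
    then have "meager_in \<tau> (\<Union>(range (\<lambda>n. \<phi> ` topspace (Q n))))" by (intro meager_in_Union) auto
    then have "meager_in \<tau> (topspace \<tau>)" using cover top by simp
    then show False using not_meager_in_openin[OF cm openin_topspace] one top by auto
  qed
  then obtain n where n: "\<not> meager_in \<tau> (\<phi> ` topspace (Q n))" by blast
  define S where "S = \<phi> ` topspace (Q n)"
  have SF: "S \<subseteq> ?F" unfolding S_def using cover by blast
  then have "S \<inter> topspace \<tau> = S" using top by auto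
  then obtain V where V: "openin \<tau> V" "V \<noteq> {}" "nonmeager_on \<tau> S V"
    using ex_nonmeager_on[OF sc openin_topspace, of S] n unfolding S_def by metis
  have VF: "V \<subseteq> ?F" using openin_subset[OF V(1)] top by simp
  define c where "c = measure M (Y n)"
  have Sc: "udist s \<one>\<^bsub>Gf\<^esub> \<le> c" if s: "s \<in> S" for s
  proof -
    obtain g h where gh: "g \<in> ?F" "h \<in> supported_in (Y n)" "s = g \<otimes>\<^bsub>Gf\<^esub> h \<otimes>\<^bsub>Gf\<^esub> inv\<^bsub>Gf\<^esub> g"
      using s unfolding S_def Qtop \<phi>_def by auto
    have hF: "h \<in> ?F" using gh sup_sub by blast
    have c1: "g \<in> carrier Gf" "h \<in> carrier Gf" "s \<in> carrier Gf" using gh hF s SF by auto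
    have "udist s \<one>\<^bsub>Gf\<^esub> = udist (s \<otimes>\<^bsub>Gf\<^esub> g) (\<one>\<^bsub>Gf\<^esub> \<otimes>\<^bsub>Gf\<^esub> g)"
      using udist_mult(2)[of s "\<one>\<^bsub>Gf\<^esub>" g] c1 one gh(1) s SF by auto
    also have "s \<otimes>\<^bsub>Gf\<^esub> g = g \<otimes>\<^bsub>Gf\<^esub> h" unfolding gh(3) using c1
      by (simp only: K.m_assoc K.l_inv K.r_one K.m_closed K.inv_closed)
    also have "\<one>\<^bsub>Gf\<^esub> \<otimes>\<^bsub>Gf\<^esub> g = g \<otimes>\<^bsub>Gf\<^esub> \<one>\<^bsub>Gf\<^esub>" using c1 by (simp only: K.l_one K.r_one)
    also have "udist (g \<otimes>\<^bsub>Gf\<^esub> h) (g \<otimes>\<^bsub>Gf\<^esub> \<one>\<^bsub>Gf\<^esub>) = udist h \<one>\<^bsub>Gf\<^esub>"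
      using udist_mult(1)[OF hF one gh(1)] .
    also have "\<dots> \<le> c" unfolding c_def by (rule udist_supported_in[OF Y(1,2) gh(2)])
    finally show ?thesis .
  qed
  have trans: "homeomorphic_map \<tau> \<tau> (\<lambda>x. a \<otimes>\<^bsub>Gf\<^esub> x)" if a: "a \<in> ?F" for a
  proof -
    have a': "a \<in> carrier Gf" using a by simp
    have "homeomorphic_maps \<tau> \<tau> (\<lambda>x. a \<otimes>\<^bsub>Gf\<^esub> x) (\<lambda>x. inv\<^bsub>Gf\<^esub> a \<otimes>\<^bsub>Gf\<^esub> x)"
      unfolding homeomorphic_maps_def
    proof (intro conjI ballI)
      have i: "inv\<^bsub>Gf\<^esub> a \<in> topspace \<tau>" using K.inv_closed[OF a'] top by simp
      show "continuous_map \<tau> \<tau> (\<lambda>x. a \<otimes>\<^bsub>Gf\<^esub> x)" "continuous_map \<tau> \<tau> (\<lambda>x. inv\<^bsub>Gf\<^esub> a \<otimes>\<^bsub>Gf\<^esub> x)"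
        by (rule mult'; use a top i in simp)+
      fix x assume "x \<in> topspace \<tau>"
      then have x: "x \<in> carrier Gf" using top by simp
      show "inv\<^bsub>Gf\<^esub> a \<otimes>\<^bsub>Gf\<^esub> (a \<otimes>\<^bsub>Gf\<^esub> x) = x" "a \<otimes>\<^bsub>Gf\<^esub> (inv\<^bsub>Gf\<^esub> a \<otimes>\<^bsub>Gf\<^esub> x) = x"
        using K.inv_solve_left' a' x by (metis K.m_assoc K.inv_closed K.l_inv K.r_inv K.l_one)+
    qed
    then show ?thesis unfolding homeomorphic_map_maps by blast
  qed
  \<comment> \<open>On the overlap of \<open>V\<close> and its translate by \<open>a\<close>, both
    \<open>S\<close> and its translate are nonmeager in every part, and both are continuous images
    of the same Polish space. Hence they meet: s = a t with s and t in \<open>S\<close>, and right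
    invariance bounds the distance of \<open>a\<close> from the identity by that between
    \<open>s\<close> and \<open>t\<close>.\<close>
  have small: "udist a \<one>\<^bsub>Gf\<^esub> \<le> 2 * c" if a: "a \<in> ?F" and v: "v \<in> V" "a \<otimes>\<^bsub>Gf\<^esub> v \<in> V" for a v
  proof -
    let ?L = "\<lambda>x. a \<otimes>\<^bsub>Gf\<^esub> x" and ?L' = "\<lambda>x. inv\<^bsub>Gf\<^esub> a \<otimes>\<^bsub>Gf\<^esub> x"
    have a': "a \<in> carrier Gf" using a by simp
    have ia: "inv\<^bsub>Gf\<^esub> a \<in> ?F" using K.inv_closed[OF a'] by simp
    have L'L: "?L' (?L x) = x" if "x \<in> ?F" for x
      using a' that by (metis K.m_assoc K.inv_closed K.l_inv K.l_one carr)
    have LL': "?L (?L' x) = x" if "x \<in> ?F" for x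
      using a' that by (metis K.m_assoc K.inv_closed K.r_inv K.l_one carr)
    define O' where "O' = V \<inter> ?L ` V"
    have LV: "openin \<tau> (?L ` V)"
      using homeomorphic_imp_open_map[OF trans[OF a]] V(1) unfolding open_map_def by blast
    have O'_open: "openin \<tau> O'" unfolding O'_def using V(1) LV by (rule openin_Int)
    have O'_ne: "O' \<noteq> {}" unfolding O'_def using v by blast
    have nm: "nonmeager_on \<tau> (\<phi> ` topspace (Q n)) O'"
      using V(3) unfolding S_def[symmetric] by (rule nonmeager_on_subset) (simp add: O'_def)
    have nm_L: "nonmeager_on \<tau> ((\<lambda>z. ?L (\<phi> z)) ` topspace (Q n)) O'"
      unfolding nonmeager_on_def
    proof (intro allI impI notI)
      fix W assume W: "openin \<tau> W \<and> W \<subseteq> O' \<and> W \<noteq> {}"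
        and m: "meager_in \<tau> ((\<lambda>z. ?L (\<phi> z)) ` topspace (Q n) \<inter> W)"
      have im: "(\<lambda>z. ?L (\<phi> z)) ` topspace (Q n) = ?L ` S" unfolding S_def by auto
      have op: "openin \<tau> (?L' ` W)"
        using homeomorphic_imp_open_map[OF trans[OF ia]] W unfolding open_map_def by blast
      \<comment> \<open>The inverse translation brings \<open>W\<close> back into \<open>V\<close>,
        where \<open>S\<close> itself is known to be nonmeager.\<close>
      have sub: "?L' ` W \<subseteq> V"
      proof
        fix x assume "x \<in> ?L' ` W"
        then obtain w where "w \<in> W" "x = ?L' w" by blast
        moreover then obtain u where "u \<in> V" "w = ?L u" using W unfolding O'_def by blast
        ultimately show "x \<in> V" using L'L VF by auto
      qed
      have "meager_in \<tau> (?L' ` (?L ` S \<inter> W))"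
        using meager_in_homeomorphic_image[OF trans[OF ia]] m unfolding im by blast
      moreover have "S \<inter> ?L' ` W \<subseteq> ?L' ` (?L ` S \<inter> W)"
      proof
        fix x assume x: "x \<in> S \<inter> ?L' ` W"
        then obtain w where w: "w \<in> W" "x = ?L' w" by blast
        have "w \<in> ?F" using w(1) W VF unfolding O'_def by blast
        then have "w = ?L x" using LL' w(2) by simp
        then have "w \<in> ?L ` S \<inter> W" using x w by blast
        then show "x \<in> ?L' ` (?L ` S \<inter> W)" using w(2) by blast
      qed
      ultimately have "meager_in \<tau> (S \<inter> ?L' ` W)" by (rule meager_in_mono)
      then show False using V(3) op sub W unfolding nonmeager_on_def by blast
    qed
    have cont_L: "continuous_map (Q n) \<tau> (\<lambda>z. ?L (\<phi> z))"
      using continuous_map_compose[OF Qcont homeomorphic_imp_continuous_map[OF trans[OF a]]]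
        by (simp add: o_def)
    obtain s t where st: "s \<in> S" "t \<in> S" "s = ?L t"
      using nonmeager_images_meet[OF Qpol[of n] Qpol[of n] sc haus Qcont cont_L O'_open O'_ne nm nm_L]
      unfolding S_def by blast
    have stF: "s \<in> ?F" "t \<in> ?F" using st SF by auto
    have "udist a \<one>\<^bsub>Gf\<^esub> = udist (a \<otimes>\<^bsub>Gf\<^esub> t) (\<one>\<^bsub>Gf\<^esub> \<otimes>\<^bsub>Gf\<^esub> t)"
      using udist_mult(2)[OF a one stF(2)] by simp
    also have "\<dots> = udist s t" using st(3) stF(2) K.l_one[of t] by simp
    also have "\<dots> \<le> udist s \<one>\<^bsub>Gf\<^esub> + udist \<one>\<^bsub>Gf\<^esub> t" by (rule UM.triangle[OF stF(1) one stF(2)])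
    also have "\<dots> \<le> 2 * c" using Sc st UM.commute by (smt (verit))
    finally show ?thesis .
  qed
  obtain D where D: "countable D" "D \<subseteq> topspace \<tau>" "\<tau> closure_of D = topspace \<tau>"
    using pol unfolding polish_topology_def separable_space_def by blast
  obtain v where v: "v \<in> V" using V(2) by blast
  \<comment> \<open>The elements x with x v in t V form an open set containing \<open>t\<close>, so
    it contains some \<open>d\<close> of \<open>D\<close>. Then \<open>a\<close>, the product of the
    inverse of \<open>t\<close> with \<open>d\<close>, sends \<open>v\<close> into \<open>V\<close>,
    and left invariance turns the bound on \<open>a\<close> into one on the distance of
    \<open>d\<close> and \<open>t\<close>.\<close>
  have "\<exists>d\<in>D. udist d t \<le> 2 * c" if t: "t \<in> ?F" for t
  proof -
    have t': "t \<in> carrier Gf" "v \<in> carrier Gf" using t v VF by auto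
    have "openin \<tau> ((\<lambda>x. t \<otimes>\<^bsub>Gf\<^esub> x) ` V)"
      using homeomorphic_imp_open_map[OF trans[OF t]] V(1) unfolding open_map_def by blast
    moreover have "continuous_map \<tau> \<tau> (\<lambda>x. x \<otimes>\<^bsub>Gf\<^esub> v)" using v VF top by (intro mult') auto
    ultimately have "openin \<tau> {x \<in> topspace \<tau>. x \<otimes>\<^bsub>Gf\<^esub> v \<in> (\<lambda>x. t \<otimes>\<^bsub>Gf\<^esub> x) ` V}"
      using openin_continuous_map_preimage by blast
    moreover have "t \<in> {x \<in> topspace \<tau>. x \<otimes>\<^bsub>Gf\<^esub> v \<in> (\<lambda>x. t \<otimes>\<^bsub>Gf\<^esub> x) ` V}" using t v top by blast
    ultimately obtain d where d: "d \<in> D" "d \<in> topspace \<tau>" "d \<otimes>\<^bsub>Gf\<^esub> v \<in> (\<lambda>x. t \<otimes>\<^bsub>Gf\<^esub> x) ` V"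
      using D(3) unfolding dense_intersects_open by blast
    then obtain v' where v': "v' \<in> V" "d \<otimes>\<^bsub>Gf\<^esub> v = t \<otimes>\<^bsub>Gf\<^esub> v'" by blast
    have c: "d \<in> carrier Gf" "v' \<in> carrier Gf" using d(2) top v' VF by auto
    define a where "a = inv\<^bsub>Gf\<^esub> t \<otimes>\<^bsub>Gf\<^esub> d"
    have a: "a \<in> ?F" using K.m_closed[OF K.inv_closed[OF t'(1)] c(1)] unfolding a_def by simp
    have "a \<otimes>\<^bsub>Gf\<^esub> v = inv\<^bsub>Gf\<^esub> t \<otimes>\<^bsub>Gf\<^esub> (t \<otimes>\<^bsub>Gf\<^esub> v')"
      unfolding a_def v'(2)[symmetric] by (rule K.m_assoc[OF K.inv_closed[OF t'(1)] c(1) t'(2)])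
    also have "\<dots> = v'" using t' c by (metis K.m_assoc K.inv_closed K.l_inv K.l_one)
    finally have "udist a \<one>\<^bsub>Gf\<^esub> \<le> 2 * c" using small[OF a v] v' by simp
    moreover have "udist d t = udist a \<one>\<^bsub>Gf\<^esub>"
    proof -
      have dF: "d \<in> ?F" using d(2) top by simp
      have it: "inv\<^bsub>Gf\<^esub> t \<in> ?F" using K.inv_closed[OF t'(1)] by simp
      have "udist d t = udist (inv\<^bsub>Gf\<^esub> t \<otimes>\<^bsub>Gf\<^esub> d) (inv\<^bsub>Gf\<^esub> t \<otimes>\<^bsub>Gf\<^esub> t)"
        using udist_mult(1)[OF dF t it] by simp
      then show ?thesis unfolding a_def K.l_inv[OF t'(1)] .
    qed
    ultimately show ?thesis using d(1) by (intro bexI[of _ d]) simp_all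
  qed
  then show thesis using that[of D "2 * c"] D(1,2) top by blast
qed

section \<open>Refinement of the net by disjoint copies\<close>

text \<open>The state \<open>W\<close> is the union of the sets chosen so far. It has finite
  measure, so enough room is left outside it for the next set.\<close>

lemma ex_disjoint_copies:
  assumes A: "A \<in> sets M" "emeasure M A < \<infinity>"
  obtains B :: "nat \<Rightarrow> 'a set" where "\<And>k. B k \<in> sets M" "\<And>k. emeasure M (B k) < \<infinity>"
    "\<And>k. emeasure M A \<le> emeasure M (B k)" "disjoint_family B"
proof -
  obtain Y :: "nat \<Rightarrow> 'a set" where Y: "\<And>n. Y n \<in> sets M" "\<And>n. emeasure M (Y n) < \<infinity>" "incseq Y"
    "(\<Union>n. Y n) = space M" using finite_exhaustion by metis
  define P where "P = (\<lambda>(n::nat) (W, C). W \<in> sets M \<and> C \<in> sets M \<and> emeasure M W < \<infinity> \<and> emeasure M C < \<infinity> \<and>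
    emeasure M A \<le> emeasure M C \<and> W \<inter> C = {})"
  have pick: "\<exists>C. P n (W, C)" if W: "W \<in> sets M" "emeasure M W < \<infinity>" for W n
  proof -
    obtain m where m: "emeasure M A \<le> emeasure M (Y m - W)"
      using ex_large_finite[OF Y(1,3,4) W A(2)] by blast
    have "emeasure M (Y m - W) \<le> emeasure M (Y m)" using Y(1) by (intro emeasure_mono) auto
    then have "emeasure M (Y m - W) < \<infinity>" using Y(2) by (rule le_less_trans)
    then show ?thesis using m W Y(1) unfolding P_def by (intro exI[of _ "Y m - W"]) auto
  qed
  have "\<exists>s. \<forall>n. P n (s n) \<and> fst (s (Suc n)) = fst (s n) \<union> snd (s n)"
  proof (rule dependent_nat_choice)
    obtain C where "P 0 ({}, C)" using pick[of "{}" 0] by auto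
    then show "\<exists>s. P 0 s" by blast
    fix s n assume s: "P n s"
    obtain W C where s': "s = (W, C)" by (cases s)
    have WC: "W \<in> sets M" "C \<in> sets M" "emeasure M W < \<infinity>" "emeasure M C < \<infinity>"
      using s unfolding s' P_def by auto
    have "emeasure M (W \<union> C) \<le> emeasure M W + emeasure M C" using WC by (intro emeasure_subadditive)
    also have "\<dots> < \<infinity>" using WC by auto
    finally obtain C' where "P (Suc n) (W \<union> C, C')" using pick[of "W \<union> C"] WC by blast
    then show "\<exists>s'. P (Suc n) s' \<and> fst s' = fst s \<union> snd s" unfolding s'
      by (intro exI[of _ "(W \<union> C, C')"]) auto
  qed
  then obtain s where s: "\<And>n. P n (s n)" "\<And>n. fst (s (Suc n)) = fst (s n) \<union> snd (s n)" by blast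
  define B where "B = (\<lambda>n. snd (s n))"
  have B: "B n \<in> sets M" "emeasure M (B n) < \<infinity>" "emeasure M A \<le> emeasure M (B n)"
    "fst (s n) \<inter> B n = {}" for n
    using s(1)[of n] unfolding P_def B_def by (auto simp: case_prod_unfold)
  have mono: "fst (s m) \<subseteq> fst (s n)" if "m \<le> n" for m n
    by (rule lift_Suc_mono_le[OF _ that]) (simp add: s(2))
  have sub: "B m \<subseteq> fst (s n)" if "m < n" for m n
    using mono[of "Suc m" n] that by (simp add: s(2) B_def)
  have "disjoint_family B"
    unfolding disjoint_family_on_def using sub B(4)
      by (metis disjoint_iff linorder_neqE_nat subsetD)
  then show thesis using that[of B] B by blast
qed

text \<open>\<open>R T\<close> is the product of conjugates of \<open>T\<close> by involutions
  carrying \<open>A\<close> into disjoint sets \<open>B k\<close>. It acts as a copy of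
  \<open>T\<close> in each of them, so disagreements add up.\<close>

lemma ex_copies:
  assumes A: "A \<in> sets M" "emeasure M A < \<infinity>"
  obtains R where "\<And>T. T \<in> Hf \<Longrightarrow> (AE x in M. x \<notin> A \<longrightarrow> T x = x) \<Longrightarrow> R T \<in> Hf"
    "\<And>S T. S \<in> Hf \<Longrightarrow> T \<in> Hf \<Longrightarrow> (AE x in M. x \<notin> A \<longrightarrow> S x = x) \<Longrightarrow> (AE x in M. x \<notin> A \<longrightarrow> T x = x) \<Longrightarrow>
       of_nat K * edist S T \<le> edist (R S) (R T)"
proof -
  obtain B :: "nat \<Rightarrow> 'a set" where B: "\<And>k. B k \<in> sets M" "\<And>k. emeasure M (B k) < \<infinity>"
    "\<And>k. emeasure M A \<le> emeasure M (B k)" "disjoint_family B"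
    using ex_disjoint_copies[OF A] by metis
  have "\<exists>U. U \<in> Hf \<and> (\<forall>x\<in>space M. U (U x) = x) \<and> (AE x in M. x \<in> A \<longrightarrow> U x \<in> B k)" for k
  proof -
    obtain U where U: "U \<in> H" "\<And>x. x \<in> space M \<Longrightarrow> U (U x) = x"
      "\<And>x. x \<in> space M \<Longrightarrow> x \<notin> A \<union> B k \<Longrightarrow> U x = x" "AE x in M. x \<in> A \<longrightarrow> U x \<in> B k"
      by (rule ex_involution[OF A(1) B(1)[of k] B(3)[of k] B(2)[of k]]) (rule that)
    have "emeasure M (A \<union> B k) \<le> emeasure M A + emeasure M (B k)" using A B
      by (intro emeasure_subadditive)
    also have "\<dots> < \<infinity>" using A B by auto
    finally have fin: "emeasure M (A \<union> B k) < \<infinity>" .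
    have "AE x in M. x \<notin> A \<union> B k \<longrightarrow> U x = x" using AE_space by eventually_elim (use U(3) in blast)
    then have "U \<in> Hf" using Hf_supported[OF U(1) _ fin] A B by blast
    then show ?thesis using U(2,4) by blast
  qed
  then have "\<exists>U. \<forall>k. U k \<in> Hf \<and> (\<forall>x\<in>space M. U k (U k x) = x) \<and> (AE x in M. x \<in> A \<longrightarrow> U k x \<in> B k)"
    by (intro choice) blast
  then obtain U where U: "\<And>k. U k \<in> Hf" "\<And>k x. x \<in> space M \<Longrightarrow> U k (U k x) = x"
    "\<And>k. AE x in M. x \<in> A \<longrightarrow> U k x \<in> B k" by blast
  note Um = Hf_mpb[OF U(1)]
  define cj where "cj = (\<lambda>k T. compose (space M) (U k) (compose (space M) T (U k)))"
  define R where "R = (\<lambda>T. rec_nat (\<lambda>x\<in>space M. x) (\<lambda>k W. compose (space M) W (cj k T)))"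
  have R_Suc: "R T (Suc k) = compose (space M) (R T k) (cj k T)" for T k unfolding R_def by simp
  have cj: "cj k T \<in> Hf" if "T \<in> Hf" for k T unfolding cj_def by (intro Hf_compose U that)
  have RF: "R T k \<in> Hf" if "T \<in> Hf" for T k
  proof (induction k)
    case 0
    have "R T 0 = (\<lambda>x\<in>space M. x)" by (simp add: R_def)
    then show ?case using Hf_id by metis
  next
    case (Suc k)
    then show ?case unfolding R_Suc by (intro Hf_compose cj that)
  qed
  have conj_out: "AE x in M. x \<notin> B k \<longrightarrow> cj k T x = x"
    if T: "T \<in> Hf" "AE x in M. x \<notin> A \<longrightarrow> T x = x" for T k
    using mpb_AE[OF Um U(3)[of k], of k] mpb_AE[OF Um T(2), of k] AE_space
  proof eventually_elim
    case (elim x)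
    then show ?case using U(2) unfolding cj_def by auto
  qed
  have conj_in: "AE x in M. x \<in> B k \<longrightarrow> cj k T x \<in> B k"
    if T: "T \<in> Hf" "AE x in M. x \<notin> A \<longrightarrow> T x = x" for T k
    using mpb_AE[OF Hf_mpb[OF cj[OF T(1)]] conj_out[OF T, of k], of k] AE_space
  proof eventually_elim
    case (elim x)
    note m = Hf_mpb[OF cj[OF T(1), of k]]
    show ?case
    proof (intro impI, rule ccontr)
      assume x: "x \<in> B k" "cj k T x \<notin> B k"
      then have "cj k T (cj k T x) = cj k T x" using elim(1) by blast
      then have "cj k T x = x" using inj_onD[OF mpbD(6)[OF m] _ mpb_in_space[OF m elim(2)] elim(2)]
        by blast
      then show False using x by simp
    qed
  qed
  \<comment> \<open>The conjugate of index k is the identity off \<open>B k\<close> and preserves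
    \<open>B k\<close> almost everywhere; the factors have disjoint supports and do not
    interfere.\<close>
  have R_eq: "AE x in M. (\<forall>k<n. x \<in> B k \<longrightarrow> R T n x = cj k T x) \<and> (x \<notin> (\<Union>k<n. B k) \<longrightarrow> R T n x = x)"
    if T: "T \<in> Hf" "AE x in M. x \<notin> A \<longrightarrow> T x = x" for T n
  proof (induction n)
    case 0
    show ?case using AE_space by eventually_elim (simp add: R_def)
  next
    case (Suc n)
    show ?case
      using Suc mpb_AE[OF Hf_mpb[OF cj[OF T(1)]] Suc, of n] conj_out[OF T, of n]
        conj_in[OF T, of n] AE_space
    proof eventually_elim
      case (elim x)
      have eq: "R T (Suc n) x = R T n (cj n T x)" unfolding R_Suc using elim(5) by simp
      show ?case
      proof (cases "x \<in> B n")
        case True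
        have no: "y \<notin> B k" if "y \<in> B n" "k < n" for k y
          using disjoint_family_onD[OF B(4), of n k] that by auto
        have "cj n T x \<in> B n" using True elim(4) by simp
        then have "cj n T x \<notin> B k" if "k < n" for k using no that by simp
        then have "cj n T x \<notin> (\<Union>k<n. B k)" by simp
        then have "R T (Suc n) x = cj n T x" using eq elim(2) by simp
        then show ?thesis using True no[OF True] by (auto simp: less_Suc_eq)
      next
        case False
        then have "R T (Suc n) x = R T n x" using eq elim(3) by simp
        then show ?thesis using False elim(1) by (auto simp: less_Suc_eq)
      qed
    qed
  qed
  show thesis
  proof (rule that[of "\<lambda>T. R T K"])
    show "R T K \<in> Hf" if "T \<in> Hf" for T by (rule RF[OF that])
    fix S T assume S: "S \<in> Hf" "AE x in M. x \<notin> A \<longrightarrow> S x = x" and T: "T \<in> Hf"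
      "AE x in M. x \<notin> A \<longrightarrow> T x = x"
    let ?D = "disagreement M (R S K) (R T K)"
    have D: "?D \<in> sets M" using disagreement_sets[OF std Hf_measurable Hf_measurable] RF S T
      by blast
    \<comment> \<open>Both products agree with their factors of index k on \<open>B k\<close>, and
      these factors have no disagreement elsewhere; invariance under \<open>U k\<close> gives back
      the original distance.\<close>
    have piece: "emeasure M (?D \<inter> B k) = edist S T" if k: "k < K" for k
    proof -
      have "emeasure M (?D \<inter> B k) = edist (cj k S) (cj k T)"
      proof (rule emeasure_eq_AE)
        show "AE x in M. (x \<in> ?D \<inter> B k) = (x \<in> disagreement M (cj k S) (cj k T))"
          using R_eq[OF S, of K] R_eq[OF T, of K] conj_out[OF S, of k] conj_out[OF T, of k]
        proof eventually_elim
          case (elim x)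
          then show ?case using k unfolding disagreement_def by (cases "x \<in> B k") auto
        qed
        show "?D \<inter> B k \<in> sets M" using D B by auto
        show "disagreement M (cj k S) (cj k T) \<in> sets M"
          using disagreement_sets[OF std Hf_measurable Hf_measurable] cj S T by blast
      qed
      also have "\<dots> = edist (compose (space M) S (U k)) (compose (space M) T (U k))"
        unfolding cj_def
          disagreement_compose_left[OF Um mpb_compose[OF Hf_mpb[OF S(1)] Um] mpb_compose[OF Hf_mpb[OF T(1)] Um]]
        by (rule refl)
      also have "\<dots> = edist S T"
        by (rule emeasure_disagreement_compose_right[OF std Um Hf_mpb[OF S(1)] Hf_mpb[OF T(1)]])
      finally show ?thesis .
    qed
    have "of_nat K * edist S T = (\<Sum>k<K. emeasure M (?D \<inter> B k))" using piece by simp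
    also have "\<dots> = emeasure M (\<Union>k<K. ?D \<inter> B k)"
    proof (rule sum_emeasure)
      show "disjoint_family_on (\<lambda>k. ?D \<inter> B k) {..<K}"
        using B(4) unfolding disjoint_family_on_def by blast
    qed (use D B in auto)
    also have "\<dots> \<le> emeasure M ?D" using D by (intro emeasure_mono) auto
    finally show "of_nat K * edist S T \<le> emeasure M ?D" .
  qed
qed

text \<open>Every point \<open>d\<close> of the coarse net selects one \<open>T\<close> supported in
  \<open>A\<close> whose copies lie within \<open>c\<close> of it. Two elements sharing the same
  \<open>d\<close> have copies within \<open>2 * c\<close>, so their own distance is at most 2c/K,
  and \<open>K\<close> is chosen to make this at most \<open>e\<close>. Points of the net itself
  cannot be used, since they need not be of the form \<open>R T\<close>.\<close>

lemma ex_fine_net: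
  assumes P: "polish_group_topology Gf \<tau>" and A: "A \<in> sets M" "emeasure M A < \<infinity>" and e:
    "e > (0::real)"
  obtains C where "countable C" "C \<subseteq> Hf"
    "\<And>T. T \<in> Hf \<Longrightarrow> (AE x in M. x \<notin> A \<longrightarrow> T x = x) \<Longrightarrow> \<exists>S\<in>C. edist T S \<le> ennreal e"
proof -
  obtain D c where D: "countable D" "D \<subseteq> finite_support_part M G"
    "\<And>t. t \<in> finite_support_part M G \<Longrightarrow> \<exists>d\<in>D. udist d t \<le> c"
    using ex_countable_net[OF P] by metis
  obtain d0 where "d0 \<in> D" "udist d0 (aut_class M (\<lambda>x\<in>space M. x)) \<le> c"
    using D(3)[OF class_finite_support[OF Hf_id]] by blast
  then have c: "c \<ge> 0" using udist_nonneg order_trans by blast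
  obtain K :: nat where K: "real K > 2 * c / e" using reals_Archimedean2 by blast
  then have K0: "K > 0" using c e by (cases K) (auto simp: field_simps not_less)
  obtain R where R: "\<And>T. T \<in> Hf \<Longrightarrow> (AE x in M. x \<notin> A \<longrightarrow> T x = x) \<Longrightarrow> R T \<in> Hf"
    "\<And>S T. S \<in> Hf \<Longrightarrow> T \<in> Hf \<Longrightarrow> (AE x in M. x \<notin> A \<longrightarrow> S x = x) \<Longrightarrow> (AE x in M. x \<notin> A \<longrightarrow> T x = x) \<Longrightarrow>
       of_nat K * edist S T \<le> edist (R S) (R T)"
    by (rule ex_copies[OF A, where K = K]) (rule that)
  define ok where "ok = (\<lambda>d T. T \<in> Hf \<and> (AE x in M. x \<notin> A \<longrightarrow> T x = x) \<and> udist d (aut_class M (R T)) \<le> c)"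
  define f where "f = (\<lambda>d. SOME T. ok d T)"
  show thesis
  proof (rule that[of "f ` {d \<in> D. \<exists>T. ok d T}"])
    have okf: "ok d (f d)" if "\<exists>T. ok d T" for d unfolding f_def using that by (rule someI_ex)
    show "countable (f ` {d \<in> D. \<exists>T. ok d T})" using D(1) by auto
    show "f ` {d \<in> D. \<exists>T. ok d T} \<subseteq> Hf" using okf unfolding ok_def by blast
    fix T assume T: "T \<in> Hf" "AE x in M. x \<notin> A \<longrightarrow> T x = x"
    have RT: "R T \<in> Hf" by (rule R(1)[OF T])
    obtain d where d: "d \<in> D" "udist d (aut_class M (R T)) \<le> c"
      using D(3)[OF class_finite_support[OF RT]] by blast
    then have ex: "\<exists>T. ok d T" using T unfolding ok_def by blast
    define S where "S = f d"
    have S: "S \<in> Hf" "AE x in M. x \<notin> A \<longrightarrow> S x = x" "udist d (aut_class M (R S)) \<le> c"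
      using okf[OF ex] unfolding ok_def S_def by auto
    have RS: "R S \<in> Hf" by (rule R(1)[OF S(1,2)])
    have "udist (aut_class M (R T)) (aut_class M (R S)) \<le> udist (aut_class M (R T)) d + udist d (aut_class M (R S))"
      using D(2) d(1) RT RS by (intro UM.triangle class_finite_support) auto
    also have "\<dots> \<le> 2 * c" using d(2) S(3) UM.commute[of d "aut_class M (R T)"] by simp
    finally have "edist (R T) (R S) \<le> ennreal (2 * c)"
      unfolding udist_class[OF RT RS, symmetric] by (rule ennreal_leI)
    then have "of_nat K * edist T S \<le> ennreal (2 * c)"
      using R(2)[OF T(1) S(1) T(2) S(2)] by (rule order_trans[rotated])
    moreover have "edist T S = ennreal (measure M (disagreement M T S))"
      using edist_Hf_finite[OF T(1) S(1)] by (simp add: emeasure_eq_ennreal_measure less_top)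
    ultimately have "ennreal (real K * measure M (disagreement M T S)) \<le> ennreal (2 * c)"
      by (simp add: ennreal_of_nat_eq_real_of_nat ennreal_mult)
    then have "real K * measure M (disagreement M T S) \<le> 2 * c" using c
      by (simp add: ennreal_le_iff)
    also have "\<dots> \<le> real K * e" using K e by (simp add: field_simps less_imp_le)
    finally have "measure M (disagreement M T S) \<le> e" using K0 by simp
    then have "edist T S \<le> ennreal e" using \<open>edist T S = _\<close> by (simp add: ennreal_leI)
    then show "\<exists>S\<in>f ` {d \<in> D. \<exists>T. ok d T}. edist T S \<le> ennreal e" using d(1) ex unfolding S_def
      by blast
  qed
qed

section \<open>Recovery of the relation\<close>

text \<open>The nets concern elements supported in a fixed set of finite measure, while a general
  element of the full group may move a set of infinite measure. It is therefore cut into countably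
  many partial maps inside sets of finite measure, each extended to an involution.\<close>

lemma ex_countable_generating:
  assumes P: "polish_group_topology Gf \<tau>"
  obtains \<Gamma> where "countable \<Gamma>" "\<Gamma> \<subseteq> H" "\<And>T. T \<in> H \<Longrightarrow> AE x in M. \<exists>\<gamma>\<in>\<Gamma>. T x = \<gamma> x"
proof -
  obtain Y :: "nat \<Rightarrow> 'a set" where Y: "\<And>n. Y n \<in> sets M" "\<And>n. emeasure M (Y n) < \<infinity>" "incseq Y"
    "(\<Union>n. Y n) = space M" using finite_exhaustion by metis
  obtain E :: "nat \<Rightarrow> 'a set" where E: "range E \<subseteq> sets M" "sets M = sigma_sets (space M) (range E)"
    "\<And>x y. x \<in> space M \<Longrightarrow> y \<in> space M \<Longrightarrow> x \<noteq> y \<Longrightarrow> \<exists>n. x \<in> E n \<and> y \<notin> E n"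
    using standard_borel_countable_base[OF std] by metis
  define net where "net = (\<lambda>n m C. countable C \<and> C \<subseteq> Hf \<and>
    (\<forall>T. T \<in> Hf \<longrightarrow> (AE x in M. x \<notin> Y n \<longrightarrow> T x = x) \<longrightarrow> (\<exists>S\<in>C. edist T S \<le> ennreal (inverse (real
      (Suc m))))))"
  have ex: "\<exists>C. net n m C" for n m
  proof -
    have "inverse (real (Suc m)) > 0" by simp
    then obtain C where "countable C" "C \<subseteq> Hf"
      "\<And>T. T \<in> Hf \<Longrightarrow> (AE x in M. x \<notin> Y n \<longrightarrow> T x = x) \<Longrightarrow> \<exists>S\<in>C. edist T S \<le> ennreal (inverse (real (Suc m)))"
      by (rule ex_fine_net[OF P Y(1)[of n] Y(2)[of n]]) (rule that)
    then show ?thesis unfolding net_def by blast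
  qed
  define C where "C = (\<lambda>n m. SOME C. net n m C)"
  have net: "net n m (C n m)" for n m unfolding C_def by (rule someI_ex) (rule ex)
  have C: "countable (C n m)" "C n m \<subseteq> Hf"
    "T \<in> Hf \<Longrightarrow> (AE x in M. x \<notin> Y n \<longrightarrow> T x = x) \<Longrightarrow> \<exists>S\<in>C n m. edist T S \<le> ennreal (inverse (real (Suc m)))"
    for n m T using net[of n m] unfolding net_def by blast+
  define \<Gamma> where "\<Gamma> = insert (\<lambda>x\<in>space M. x) (\<Union>n m. C n m)"
  have "C n m \<subseteq> H" for n m using C(2) Hf_H by blast
  then have \<Gamma>: "countable \<Gamma>" "\<Gamma> \<subseteq> H"
    unfolding \<Gamma>_def using C(1) H_id by auto
  have near: "AE x in M. \<exists>\<gamma>\<in>\<Gamma>. S x = \<gamma> x" if S: "S \<in> Hf" "AE x in M. x \<notin> Y n \<longrightarrow> S x = x" for S n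
  proof -
    \<comment> \<open>The points where \<open>S\<close> differs from every member of
      \<open>\<Gamma>\<close>. Since the nets contain members at arbitrarily small distance from
      \<open>S\<close>, this set is null.\<close>
    define N where "N = space M \<inter> (\<Inter>\<gamma>\<in>\<Gamma>. disagreement M S \<gamma>)"
    have d: "disagreement M S \<gamma> \<in> sets M" if "\<gamma> \<in> \<Gamma>" for \<gamma>
      by (intro disagreement_sets[OF std] mpbD(3) Hf_mpb[OF S(1)] H_mpb) (use \<Gamma>(2) that in blast)
    then have "(\<Inter>\<gamma>\<in>\<Gamma>. disagreement M S \<gamma>) \<in> sets M"
      using \<Gamma>(1) by (intro sets.countable_INT') (auto simp: \<Gamma>_def)
    then have N: "N \<in> sets M" unfolding N_def by auto
    have le: "emeasure M N \<le> ennreal (inverse (real (Suc m)))" for m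
    proof -
      obtain \<gamma> where \<gamma>: "\<gamma> \<in> C n m" "edist S \<gamma> \<le> ennreal (inverse (real (Suc m)))" using C(3)[OF S]
        by blast
      then have g: "\<gamma> \<in> \<Gamma>" unfolding \<Gamma>_def by blast
      have "emeasure M N \<le> edist S \<gamma>" by (rule emeasure_mono) (use d[OF g] g in \<open>auto simp: N_def\<close>)
      then show ?thesis using \<gamma>(2) by (rule order_trans)
    qed
    have "emeasure M N \<le> 0"
    proof (rule LIMSEQ_le_const)
      have "(\<lambda>m. ennreal (inverse (real (Suc m)))) \<longlonglongrightarrow> ennreal 0"
        using LIMSEQ_inverse_real_of_nat by (intro tendsto_ennrealI)
      then show "(\<lambda>m. ennreal (inverse (real (Suc m)))) \<longlonglongrightarrow> 0" by simp
    qed (use le in blast)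
    then have "N \<in> null_sets M" using N by auto
    then have "AE x in M. x \<notin> N" by (rule AE_not_in)
    then show ?thesis using AE_space by eventually_elim (auto simp: N_def disagreement_def)
  qed
  show thesis
  proof (rule that[OF \<Gamma>])
    fix T assume T: "T \<in> H"
    note Tm = H_mpb[OF T]
    \<comment> \<open>\<open>E i\<close> keeps domain and image apart, \<open>Y n\<close> makes the
      resulting involution finitely supported. Each moved point lies in some \<open>Z i n\<close>;
      fixed points are served by the identity in \<open>\<Gamma>\<close>.\<close>
    define Z where "Z = (\<lambda>i n. (Y n \<inter> E i) \<inter> (T -` (Y n - E i) \<inter> space M))"
    have Z: "Z i n \<in> sets M" for i n
      unfolding Z_def using Y(1) E(1) measurable_sets[OF mpbD(3)[OF Tm], of "Y n - E i"] by auto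
    have "AE x in M. x \<in> Z i n \<longrightarrow> (\<exists>\<gamma>\<in>\<Gamma>. T x = \<gamma> x)" for i n
    proof -
      have ZM: "Z i n \<subseteq> space M" by (rule sets.sets_into_space[OF Z])
      have inj: "inj_on T (Z i n)" using mpbD(6)[OF Tm] ZM by (rule inj_on_subset)
      have dj: "T ` Z i n \<inter> Z i n = {}" unfolding Z_def by auto
      have TZM: "T ` Z i n \<subseteq> space M" using mpb_in_space[OF Tm] ZM by auto
      note sw = swap_along_simps[OF inj ZM TZM dj]
      let ?S = "swap_along M (Z i n) T"
      have SH: "?S \<in> H" by (rule H_swap_along[OF inj dj, of "{(Z i n, T)}"]) (use Z T in auto)
      have "AE x in M. x \<notin> Y n \<longrightarrow> ?S x = x"
        using AE_space
      proof eventually_elim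
        case (elim x)
        have "Z i n \<subseteq> Y n" "T ` Z i n \<subseteq> Y n" unfolding Z_def by auto
        then show ?case using sw(3)[OF elim] by blast
      qed
      from near[OF Hf_supported[OF SH Y(1,2) this] this]
      show ?thesis by eventually_elim (use sw(1) in force)
    qed
    then have "AE x in M. \<forall>i n. x \<in> Z i n \<longrightarrow> (\<exists>\<gamma>\<in>\<Gamma>. T x = \<gamma> x)"
      by (intro AE_all_countable[THEN iffD2] allI)
    then show "AE x in M. \<exists>\<gamma>\<in>\<Gamma>. T x = \<gamma> x"
      using AE_space
    proof eventually_elim
      case (elim x)
      note Tx = mpb_in_space[OF Tm elim(2)]
      show ?case
      proof (cases "T x = x")
        case True
        then show ?thesis using elim(2) unfolding \<Gamma>_def by auto
      next
        case False
        then obtain i where i: "x \<in> E i" "T x \<notin> E i" using E(3)[OF elim(2) Tx] by metis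
        obtain n1 n2 where "x \<in> Y n1" "T x \<in> Y n2" using elim(2) Tx Y(4) by blast
        then have "x \<in> Y (max n1 n2)" "T x \<in> Y (max n1 n2)"
          using Y(3) unfolding incseq_def by (meson max.cobounded1 max.cobounded2 subsetD)+
        then have "x \<in> Z i (max n1 n2)" unfolding Z_def using i elim(2) by auto
        then show ?thesis using elim(1) by blast
      qed
    qed
  qed
qed

text \<open>The relation is the orbit relation of a countable group. One inclusion holds because the
  group contains a set that covers every element pointwise almost everywhere, the other because the
  full group is closed under cutting and pasting from countably many of its elements.\<close>

lemma relation_if_polish:
  assumes P: "polish_group_topology Gf \<tau>"
  shows "\<exists>R. countable_equivalence_relation M R \<and> G = full_group_of_relation M R"
proof -
  obtain \<Gamma>0 where \<Gamma>0: "countable \<Gamma>0" "\<Gamma>0 \<subseteq> H" "\<And>T. T \<in> H \<Longrightarrow> AE x in M. \<exists>\<gamma>\<in>\<Gamma>0. T x = \<gamma> x"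
    by (rule ex_countable_generating[OF P]) (rule that)
  obtain \<Gamma> where \<Gamma>: "countable \<Gamma>" "\<Gamma>0 \<subseteq> \<Gamma>" "\<Gamma> \<subseteq> H" "(\<lambda>x\<in>space M. x) \<in> \<Gamma>"
    "\<And>T. T \<in> \<Gamma> \<Longrightarrow> mpb_inverse M T \<in> \<Gamma>" "\<And>S T. S \<in> \<Gamma> \<Longrightarrow> T \<in> \<Gamma> \<Longrightarrow> compose (space M) S T \<in> \<Gamma>"
    using countable_subgroup[OF \<Gamma>0(1,2)] by metis
  have \<Gamma>m: "\<gamma> \<in> mpb M" if "\<gamma> \<in> \<Gamma>" for \<gamma> using \<Gamma>(3) H_mpb that by blast
  define R where "R = {(y, x). x \<in> space M \<and> (\<exists>\<gamma>\<in>\<Gamma>. y = \<gamma> x)}"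
  have R_sub: "R \<subseteq> space M \<times> space M" unfolding R_def using mpb_in_space[OF \<Gamma>m] by auto
  have "equiv (space M) R"
  proof (rule equivI)
    show "R \<subseteq> space M \<times> space M" by (rule R_sub)
    show "refl_on (space M) R"
    proof (rule refl_onI)
      fix x assume "x \<in> space M"
      then show "(x, x) \<in> R" unfolding R_def using \<Gamma>(4) by (auto intro!: bexI[of _ "\<lambda>x\<in>space M. x"])
    qed
    show "sym R"
    proof (rule symI)
      fix y x assume "(y, x) \<in> R"
      then obtain \<gamma> where g: "x \<in> space M" "\<gamma> \<in> \<Gamma>" "y = \<gamma> x" unfolding R_def by blast
      have "y \<in> space M" using mpb_in_space[OF \<Gamma>m[OF g(2)] g(1)] g(3) by simp
      moreover have "mpb_inverse M \<gamma> \<in> \<Gamma>" by (rule \<Gamma>(5)[OF g(2)])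
      moreover have "x = mpb_inverse M \<gamma> y" using mpb_inverse_left[OF \<Gamma>m[OF g(2)] g(1)] g(3) by simp
      ultimately show "(x, y) \<in> R" unfolding R_def by blast
    qed
    show "trans R"
    proof (rule transI)
      fix z y x assume "(z, y) \<in> R" "(y, x) \<in> R"
      then obtain \<gamma> \<delta> where g: "x \<in> space M" "\<gamma> \<in> \<Gamma>" "y = \<gamma> x" "\<delta> \<in> \<Gamma>" "z = \<delta> y" unfolding R_def
        by blast
      then have "z = compose (space M) \<delta> \<gamma> x" by simp
      then show "(z, x) \<in> R" unfolding R_def using g \<Gamma>(6) by blast
    qed
  qed
  moreover have "R \<in> sets (M \<Otimes>\<^sub>M M)"
  proof -
    have "{z \<in> space (M \<Otimes>\<^sub>M M). fst z = \<gamma> (snd z)} \<in> sets (M \<Otimes>\<^sub>M M)" if "\<gamma> \<in> \<Gamma>" for \<gamma>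
      using mpbD(3)[OF \<Gamma>m[OF that]]
        by (intro sets_Collect_eq_standard_borel[OF std] measurable_fst
          measurable_compose[OF measurable_snd])
    then have "(\<Union>\<gamma>\<in>\<Gamma>. {z \<in> space (M \<Otimes>\<^sub>M M). fst z = \<gamma> (snd z)}) \<in> sets (M \<Otimes>\<^sub>M M)"
      using \<Gamma>(1) by (intro sets.countable_UN') auto
    moreover have "R = (\<Union>\<gamma>\<in>\<Gamma>. {z \<in> space (M \<Otimes>\<^sub>M M). fst z = \<gamma> (snd z)})"
      using mpb_in_space[OF \<Gamma>m] unfolding R_def space_pair_measure by auto
    ultimately show ?thesis by simp
  qed
  moreover have "countable (R `` {x})" for x
  proof (rule countable_subset)
    \<comment> \<open>Pairs have the form (\<gamma> y, y), so the image of \<open>x\<close> under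
      \<open>R\<close> consists of preimages of \<open>x\<close>; hence the inverses.\<close>
    show "R `` {x} \<subseteq> (\<lambda>\<gamma>. mpb_inverse M \<gamma> x) ` \<Gamma>"
      unfolding R_def using mpb_inverse_left[OF \<Gamma>m] by force
  qed (use \<Gamma>(1) in simp)
  ultimately have "countable_equivalence_relation M R" unfolding countable_equivalence_relation_def
    by blast
  moreover have "G = full_group_of_relation M R"
  proof
    show "G \<subseteq> full_group_of_relation M R"
    proof
      fix s assume "s \<in> G"
      then have "s \<in> aut_class M ` H" by (rule subsetD[OF equalityD1[OF G_eq]])
      then obtain T where T: "T \<in> H" "s = aut_class M T" by blast
      have "AE x in M. (T x, x) \<in> R"
        using \<Gamma>0(3)[OF T(1)] AE_space by eventually_elim (use \<Gamma>(2) in \<open>auto simp: R_def\<close>)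
      then show "s \<in> full_group_of_relation M R"
        unfolding full_group_of_relation_def using T H_mpb by blast
    qed
    show "full_group_of_relation M R \<subseteq> G"
    proof
      fix s assume "s \<in> full_group_of_relation M R"
      then obtain T where T: "T \<in> mpb M" "s = aut_class M T" "AE x in M. (T x, x) \<in> R"
        unfolding full_group_of_relation_def by blast
      from T(3) have "AE x in M. \<exists>\<gamma>\<in>\<Gamma>. T x = \<gamma> x" by eventually_elim (auto simp: R_def)
      then have "T \<in> H" using H_countable[OF T(1) \<Gamma>(1,3)] by blast
      then have "s \<in> aut_class M ` H" using T(2) by blast
      then show "s \<in> G" by (rule subsetD[OF equalityD2[OF G_eq]])
    qed
  qed
  ultimately show ?thesis by blast
qed

end

theorem theorem5:
  fixes M :: "'a measure" and G :: "('a \<Rightarrow> 'a) set set"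
  assumes "standard_sigma_finite_space M"
    and "full_group M G"
    and "ergodic M G"
  shows "(\<exists>\<tau>. polish_group_topology ((Aut M)\<lparr>carrier := finite_support_part M G\<rparr>) \<tau>) \<longleftrightarrow>
         (\<exists>R. countable_equivalence_relation M R \<and> G = full_group_of_relation M R)"
proof -
  interpret ergodic_full_group M G by unfold_locales (fact assms)+
  show ?thesis using relation_if_polish polish_if_full_group_of_relation by blast
qed

end
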